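(* Let $X$ be a smooth subvariety of an abelian variety $A^n$ of dimension $n$. If the tangent map $f:\mathbb{P}(\Omega^1_X)\to\mathbb{P}^{n-1}$ is surjective and has connected fibers, then for all $m\ge0$ $$H^0(X,S^m\Omega^1_X)=H^0(A^n,S^m\Omega^1_{A^n}),$$ the identification being given by restriction of symmetric differentials from $A^n$ to $X$.
   Context: Varieties are over $\mathbb{C}$; $S^m$ is the $m$-th symmetric power. $\mathbb{P}(E)$ denotes the projective bundle of hyperplanes of $E$. The surjection $\Omega^1_{A^n}|_X\to\Omega^1_X$ induces an inclusion $j:\mathbb{P}(\Omega^1_X)\hookrightarrow\mathbb{P}(\Omega^1_{A^n}|_X)\subset\mathbb{P}(\Omega^1_{A^n})\simeq A^n\times\mathbb{P}^{n-1}$ (the cotangent bundle of $A^n$ being trivial). The tangent map of $X$ in $A^n$ is $f=p_2\circ j$, with $p_2$ the projection to $\mathbb{P}^{n-1}$. *)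

theory Defs
  imports
    "HOL-Analysis.Analysis"
    "HOL-Algebra.Group"
    "HOL-Library.Extended_Nat"
    "HOL-Library.Function_Algebras"
begin

text \<open>
  Varieties are embedded in complex projective space and identified with their sets of closed
  points. The homogeneous coordinates of a projective space are indexed by a finite type
  \<open>'i\<close>, so that the space has dimension \<open>CARD('i) - 1\<close>.
\<close>


section \<open>Homogeneous polynomials and projective spaces\<close>

definition monomial_at :: "('i::finite \<Rightarrow> nat) \<Rightarrow> complex ^ 'i \<Rightarrow> complex" where
  "monomial_at k v = (\<Prod>i\<in>UNIV. (v $ i) ^ k i)"

text \<open>The index sets below are finite, since the index types are.\<close>

definition hom_poly :: "nat \<Rightarrow> (complex ^ 'i::finite \<Rightarrow> complex) \<Rightarrow> bool" where
  "hom_poly d P \<longleftrightarrow>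
     (\<exists>c. P = (\<lambda>v. \<Sum>k | sum k UNIV = d. c k * monomial_at k v))"

definition bihom_poly ::
  "nat \<Rightarrow> nat \<Rightarrow> (complex ^ 'i::finite \<Rightarrow> complex ^ 'j::finite \<Rightarrow> complex) \<Rightarrow> bool" where
  "bihom_poly d e P \<longleftrightarrow>
     (\<exists>c. P = (\<lambda>v w. \<Sum>k | sum k UNIV = d. \<Sum>l | sum l UNIV = e.
                        c k l * monomial_at k v * monomial_at l w))"

text \<open>
  A point of the projective space of lines of a vector space is the set of nonzero vectors of
  a line, that is, the class of a nonzero vector modulo nonzero scalars. The scalar
  multiplication is a parameter, because tangent spaces are spaces of functionals, which are
  not instances of a complex vector space class.
\<close>

definition proj_class :: "(complex \<Rightarrow> 'v \<Rightarrow> 'v) \<Rightarrow> 'v \<Rightarrow> 'v set" where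
  "proj_class scl v = {scl c v | c. c \<noteq> 0}"

definition projectivization :: "(complex \<Rightarrow> 'v::zero \<Rightarrow> 'v) \<Rightarrow> 'v set \<Rightarrow> 'v set set" where
  "projectivization scl V = {proj_class scl v | v. v \<in> V \<and> v \<noteq> 0}"

type_synonym 'i point = "(complex ^ 'i) set"

definition proj_space :: "'i::finite point set" where
  "proj_space = projectivization (*s) UNIV"


section \<open>Zariski topologies\<close>

definition zariski :: "'i::finite point topology" where
  "zariski = topology_generated_by
     {{p \<in> proj_space. \<forall>v\<in>p. P v \<noteq> 0} | d P. hom_poly d P}"

text \<open>
  The Zariski topology of the product variety of two projective spaces; it is finer than the
  product of the two Zariski topologies.
\<close>

definition zariski_prod :: "('i::finite point \<times> 'j::finite point) topology" where
  "zariski_prod = topology_generated_by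
     {{(p, q) \<in> proj_space \<times> proj_space. \<forall>v\<in>p. \<forall>w\<in>q. P v w \<noteq> 0} | d e P. bihom_poly d e P}"

abbreviation zariski_of :: "'i::finite point set \<Rightarrow> 'i point topology" where
  "zariski_of X \<equiv> subtopology zariski X"

definition irreducible_space :: "'a topology \<Rightarrow> bool" where
  "irreducible_space T \<longleftrightarrow> topspace T \<noteq> {} \<and>
     (\<forall>C D. closedin T C \<and> closedin T D \<and> C \<union> D = topspace T
        \<longrightarrow> C = topspace T \<or> D = topspace T)"

definition krull_dim :: "'a topology \<Rightarrow> enat" where
  "krull_dim T = Sup {enat d | d. \<exists>Z.
     (\<forall>i\<le>d. closedin T (Z i) \<and> irreducible_space (subtopology T (Z i))) \<and>
     (\<forall>i<d. Z i \<subset> Z (Suc i))}"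

definition projective_variety :: "'i::finite point set \<Rightarrow> bool" where
  "projective_variety X \<longleftrightarrow> closedin zariski X \<and> irreducible_space (zariski_of X)"


section \<open>Regular functions and Zariski tangent spaces\<close>

text \<open>
  \<open>regular_at X x h\<close>: the restriction of \<open>h\<close> to some neighbourhood of \<open>x\<close> in \<open>X\<close> is a
  quotient of homogeneous polynomials of the same degree, so \<open>h\<close> represents an element of the
  local ring of \<open>X\<close> at \<open>x\<close>. Two functions represent the same element iff \<open>same_germ X x\<close>.
\<close>

definition regular_at :: "'i::finite point set \<Rightarrow> 'i point \<Rightarrow> ('i point \<Rightarrow> complex) \<Rightarrow> bool" where
  "regular_at X x h \<longleftrightarrow>
     (\<exists>U d P Q. openin (zariski_of X) U \<and> x \<in> U \<and> hom_poly d P \<and> hom_poly d Q \<and>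
        (\<forall>y\<in>U. \<forall>v\<in>y. Q v \<noteq> 0 \<and> h y = P v / Q v))"

definition same_germ ::
  "'i::finite point set \<Rightarrow> 'i point \<Rightarrow> ('i point \<Rightarrow> complex) \<Rightarrow> ('i point \<Rightarrow> complex) \<Rightarrow> bool" where
  "same_germ X x h h' \<longleftrightarrow>
     (\<exists>U. openin (zariski_of X) U \<and> x \<in> U \<and> (\<forall>y\<in>U. h y = h' y))"

text \<open>
  The Zariski tangent space at \<open>x\<close> consists of the \<open>\<complex>\<close>-linear derivations from the local ring
  at \<open>x\<close> to \<open>\<complex>\<close>; it is the dual of the fibre at \<open>x\<close> of the sheaf of differentials.
  A derivation is extended by \<open>0\<close> to the functions that are not regular at \<open>x\<close>.
\<close>

type_synonym 'i tangent = "('i point \<Rightarrow> complex) \<Rightarrow> complex"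

definition tangent_scale :: "complex \<Rightarrow> 'i tangent \<Rightarrow> 'i tangent" where
  "tangent_scale c D = (\<lambda>h. c * D h)"

lemma vector_space_tangent_scale: "vector_space tangent_scale"
  by unfold_locales (auto simp: tangent_scale_def fun_eq_iff algebra_simps)

definition tangent_space :: "'i::finite point set \<Rightarrow> 'i point \<Rightarrow> 'i tangent set" where
  "tangent_space X x = {D.
     (\<forall>h. \<not> regular_at X x h \<longrightarrow> D h = 0) \<and>
     (\<forall>h h'. regular_at X x h \<and> regular_at X x h' \<longrightarrow>
        (same_germ X x h h' \<longrightarrow> D h = D h') \<and>
        D (\<lambda>y. h y + h' y) = D h + D h' \<and>
        D (\<lambda>y. h y * h' y) = h x * D h' + h' x * D h) \<and>
     (\<forall>c h. regular_at X x h \<longrightarrow> D (\<lambda>y. c * h y) = c * D h)}"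

text \<open>
  The differential at \<open>x\<close> of a morphism \<open>F\<close> with target \<open>Y\<close> sends \<open>D\<close> to the derivation
  \<open>h \<mapsto> D (h \<circ> F)\<close> at \<open>F x\<close>.
\<close>

definition differential ::
  "'j::finite point set \<Rightarrow> ('i::finite point \<Rightarrow> 'j point) \<Rightarrow> 'i point \<Rightarrow> 'i tangent \<Rightarrow> 'j tangent" where
  "differential Y F x D = (\<lambda>h. if regular_at Y (F x) h then D (h \<circ> F) else 0)"

text \<open>The variety \<open>X\<close> is irreducible here, so it has the same dimension at all its points.\<close>

definition smooth_variety :: "'i::finite point set \<Rightarrow> bool" where
  "smooth_variety X \<longleftrightarrow> projective_variety X \<and>
     (\<forall>x\<in>X. enat (vector_space.dim tangent_scale (tangent_space X x)) = krull_dim (zariski_of X))"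


section \<open>Abelian varieties\<close>

definition morphism_to_proj ::
  "'i::finite point set \<Rightarrow> ('i point \<Rightarrow> 'j::finite point) \<Rightarrow> bool" where
  "morphism_to_proj X F \<longleftrightarrow>
     (\<forall>x\<in>X. \<exists>d f. (\<forall>j. hom_poly d (\<lambda>v. f v $ j)) \<and> (\<forall>v\<in>x. f v \<noteq> 0) \<and>
        (\<forall>y\<in>X. \<forall>v\<in>y. f v \<noteq> 0 \<longrightarrow> F y = proj_class (*s) (f v)))"

definition morphism_prod_to_proj ::
  "'i::finite point set \<Rightarrow> 'j::finite point set \<Rightarrow> ('i point \<Rightarrow> 'j point \<Rightarrow> 'k::finite point)
     \<Rightarrow> bool" where
  "morphism_prod_to_proj X Y F \<longleftrightarrow>
     (\<forall>x\<in>X. \<forall>y\<in>Y. \<exists>d e f. (\<forall>j. bihom_poly d e (\<lambda>v w. f v w $ j)) \<and>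
        (\<forall>v\<in>x. \<forall>w\<in>y. f v w \<noteq> 0) \<and>
        (\<forall>x'\<in>X. \<forall>y'\<in>Y. \<forall>v\<in>x'. \<forall>w\<in>y'.
           f v w \<noteq> 0 \<longrightarrow> F x' y' = proj_class (*s) (f v w)))"

text \<open>
  The group law is written multiplicatively, as a structure whose carrier is the set of
  closed points.
\<close>

definition abelian_variety :: "'i::finite point monoid \<Rightarrow> bool" where
  "abelian_variety A \<longleftrightarrow>
     projective_variety (carrier A) \<and> comm_group A \<and>
     morphism_prod_to_proj (carrier A) (carrier A) (\<lambda>x y. x \<otimes>\<^bsub>A\<^esub> y) \<and>
     morphism_to_proj (carrier A) (\<lambda>x. inv\<^bsub>A\<^esub> x)"


section \<open>The tangent map\<close>

text \<open>
  A closed point of \<open>\<P>(\<Omega>\<^sup>1\<^sub>X)\<close> over \<open>x\<close> is a hyperplane of the fibre of \<open>\<Omega>\<^sup>1\<^sub>X\<close> at \<open>x\<close>, that is, a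
  line of the tangent space at \<open>x\<close>.
\<close>

definition proj_cotangent :: "'i::finite point set \<Rightarrow> ('i point \<times> 'i tangent set) set" where
  "proj_cotangent X = (SIGMA x:X. projectivization tangent_scale (tangent_space X x))"

definition cotangent_inclusion ::
  "'i::finite point monoid \<Rightarrow> 'i point \<times> 'i tangent set \<Rightarrow> 'i point \<times> 'i tangent set" where
  "cotangent_inclusion A = (\<lambda>(x, L). (x, differential (carrier A) (\<lambda>y. y) x ` L))"

definition linear_coordinates :: "'i tangent set \<Rightarrow> ('i tangent \<Rightarrow> complex ^ 'n::finite) \<Rightarrow> bool" where
  "linear_coordinates V \<phi> \<longleftrightarrow>
     (\<forall>D\<in>V. \<forall>E\<in>V. \<phi> (D + E) = \<phi> D + \<phi> E) \<and>
     (\<forall>c. \<forall>D\<in>V. \<phi> (tangent_scale c D) = c *s \<phi> D) \<and>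
     bij_betw \<phi> V UNIV"

text \<open>
  The isomorphism \<open>\<P>(\<Omega>\<^sup>1\<^sub>A) \<simeq> A \<times> \<P>\<^sup>n\<^sup>-\<^sup>1\<close> obtained by translating tangent vectors to the origin and
  taking coordinates \<open>\<phi>\<close> on the tangent space at the origin.
\<close>

definition cotangent_trivialization ::
  "'i::finite point monoid \<Rightarrow> ('i tangent \<Rightarrow> complex ^ 'n::finite)
     \<Rightarrow> 'i point \<times> 'i tangent set \<Rightarrow> 'i point \<times> 'n point" where
  "cotangent_trivialization A \<phi> = (\<lambda>(a, L).
     (a, (\<lambda>D. \<phi> (differential (carrier A) (\<lambda>y. inv\<^bsub>A\<^esub> a \<otimes>\<^bsub>A\<^esub> y) a D)) ` L))"

definition tangent_map ::
  "'i::finite point monoid \<Rightarrow> ('i tangent \<Rightarrow> complex ^ 'n::finite)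
     \<Rightarrow> 'i point \<times> 'i tangent set \<Rightarrow> 'n point" where
  "tangent_map A \<phi> = snd \<circ> cotangent_trivialization A \<phi> \<circ> cotangent_inclusion A"

text \<open>The Zariski topology of \<open>\<P>(\<Omega>\<^sup>1\<^sub>X)\<close> as a closed subvariety of \<open>A \<times> \<P>\<^sup>n\<^sup>-\<^sup>1\<close>.\<close>

definition proj_cotangent_topology ::
  "'i::finite point monoid \<Rightarrow> ('i tangent \<Rightarrow> complex ^ 'n::finite) \<Rightarrow> 'i point set
     \<Rightarrow> ('i point \<times> 'i tangent set) topology" where
  "proj_cotangent_topology A \<phi> X =
     pullback_topology (proj_cotangent X)
       (cotangent_trivialization A \<phi> \<circ> cotangent_inclusion A) zariski_prod"


section \<open>Symmetric differentials\<close>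

text \<open>
  Global sections of \<open>S\<^sup>m \<Omega>\<^sup>1\<^sub>X\<close> for \<open>X\<close> smooth. The fibre of this vector bundle at \<open>x\<close> is the
  \<open>m\<close>-th symmetric power of the dual of the tangent space, that is, the space of homogeneous
  polynomial functions of degree \<open>m\<close> on the tangent space, and its sections are locally the
  finite sums \<open>\<Sum>\<^sub>i f\<^sub>i dg\<^sub>i\<^sub>0 \<cdots> dg\<^sub>i\<^sub>,\<^sub>m\<^sub>-\<^sub>1\<close> with \<open>f\<^sub>i\<close> and \<open>g\<^sub>i\<^sub>j\<close> regular. A section is extended by
  \<open>0\<close> outside the tangent bundle.
\<close>

definition symmetric_differentials ::
  "'i::finite point set \<Rightarrow> nat \<Rightarrow> ('i point \<Rightarrow> 'i tangent \<Rightarrow> complex) set" where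
  "symmetric_differentials X m = {\<omega>.
     (\<forall>x D. \<not> (x \<in> X \<and> D \<in> tangent_space X x) \<longrightarrow> \<omega> x D = 0) \<and>
     (\<forall>x\<in>X. \<exists>U (r::nat) f g. openin (zariski_of X) U \<and> x \<in> U \<and>
        (\<forall>y\<in>U. \<forall>i<r. regular_at X y (f i) \<and> (\<forall>j<m. regular_at X y (g i j))) \<and>
        (\<forall>y\<in>U. \<forall>D\<in>tangent_space X y. \<omega> y D = (\<Sum>i<r. f i y * (\<Prod>j<m. D (g i j)))))}"

definition restrict_differential ::
  "'i::finite point set \<Rightarrow> 'i point set \<Rightarrow> ('i point \<Rightarrow> 'i tangent \<Rightarrow> complex)
     \<Rightarrow> 'i point \<Rightarrow> 'i tangent \<Rightarrow> complex" where
  "restrict_differential A X \<omega> =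
     (\<lambda>x D. if x \<in> X \<and> D \<in> tangent_space X x then \<omega> x (differential A (\<lambda>y. y) x D) else 0)"

lemma restrict_differential_add:
  "restrict_differential A X (\<omega> + \<eta>) = restrict_differential A X \<omega> + restrict_differential A X \<eta>"
  by (auto simp: restrict_differential_def fun_eq_iff)

lemma restrict_differential_scale:
  "restrict_differential A X (\<lambda>x D. c * \<omega> x D) = (\<lambda>x D. c * restrict_differential A X \<omega> x D)"
  by (auto simp: restrict_differential_def fun_eq_iff)

end

theory Submission
  imports
    Defs
    "HOL-Computational_Algebra.Fundamental_Theorem_Algebra"
begin

text \<open>
  A tangent vector \<open>v\<close> at the origin extends to an invariant vector field on the abelian variety. The
  points of \<open>X\<close> at which this field is tangent to \<open>X\<close> form a closed set \<open>F v\<close>, the image of the fibre of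
  the tangent map over the class of \<open>v\<close>, so it is nonempty and connected. A symmetric
  differential evaluated along the field is a regular function on \<open>F v\<close>, hence has a constant
  value \<open>G v\<close>, and it remains to see that \<open>G\<close> is a homogeneous polynomial.

  Stein factorization and elimination theory are replaced by homomorphisms of countable
  subrings into \<open>\<complex>\<close>, which move solutions of polynomial equations to solutions. They show that the
  values of a regular function on a closed set are finite in number (they are bounded by
  compactness, but a transcendental value could be moved anywhere), and that on a line \<open>G\<close> is a
  rational function of the parameter off a countable set. As \<open>G\<close> is continuous, again by
  compactness, it is a polynomial on every line, of degree at most \<open>m\<close> by homogeneity.
\<close>

section \<open>Homomorphisms of countable rings into the complex numbers\<close>

text \<open>Homomorphisms on countable rings are easy to build: one more element can always be
  adjoined, because \<open>\<complex>\<close> is algebraically closed and contains numbers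
  transcendental over any countable ring. Only the finitely many coordinates of a point are adjoined
  at a time. The equations can be taken countable in number by the Lindelof property, so their
  coefficients lie in one countable ring.

  Finiteness of the set of values is the bridge from connectedness to constancy: the level sets of a
  regular function are closed, and finitely many disjoint closed sets cannot cover a connected set
  nontrivially.

  The obstacle to polynomiality is that a point of \<open>F v\<close> cannot be chosen as an
  algebraic function of \<open>v\<close>; only the value \<open>G v\<close> is rational. The degree
  bound \<open>m\<close>, the same for all lines, then allows interpolation in several variables. A
  homogeneous polynomial \<open>G\<close> in the trivialized coordinates is a symmetric differential
  on the abelian variety, and it restricts to the given one. Injectivity of restriction comes from
  the same constancy statement, applied to the abelian variety in place of \<open>X\<close>.\<close>

definition is_subring :: "'r::comm_ring_1 set \<Rightarrow> bool" where
  "is_subring S \<longleftrightarrow> 0 \<in> S \<and> 1 \<in> S \<and> (\<forall>a\<in>S. -a \<in> S) \<and>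
     (\<forall>a\<in>S. \<forall>b\<in>S. a + b \<in> S \<and> a * b \<in> S)"

definition polys_over :: "'r::comm_ring_1 set \<Rightarrow> 'r poly set" where
  "polys_over S = {p. \<forall>n. coeff p n \<in> S}"

definition is_hom :: "'r::comm_ring_1 set \<Rightarrow> ('r \<Rightarrow> complex) \<Rightarrow> bool" where
  "is_hom S \<sigma> \<longleftrightarrow> \<sigma> 0 = 0 \<and> \<sigma> 1 = 1 \<and> (\<forall>a\<in>S. \<forall>b\<in>S. \<sigma> (a + b) = \<sigma> a + \<sigma> b \<and> \<sigma> (a * b) = \<sigma> a * \<sigma> b)"

text \<open>An ideal of the whole ring type, not of a subring. Homomorphisms on a subring
  \<open>S\<close> are required to have kernel \<open>S \<inter> I\<close>; keeping \<open>I\<close>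
  fixed through all extensions controls vanishing and nonvanishing at once.\<close>

definition prime_ideal :: "'r::comm_ring_1 set \<Rightarrow> bool" where
  "prime_ideal I \<longleftrightarrow> 0 \<in> I \<and> 1 \<notin> I \<and> (\<forall>a\<in>I. \<forall>b\<in>I. a + b \<in> I) \<and> (\<forall>a\<in>I. \<forall>r. r * a \<in> I) \<and>
     (\<forall>a b. a * b \<in> I \<longrightarrow> a \<in> I \<or> b \<in> I)"

lemma is_subring_sum:
  assumes "is_subring S" "\<And>i. i \<in> I \<Longrightarrow> f i \<in> S"
  shows "sum f I \<in> S"
  using assms(2) by (induction I rule: infinite_finite_induct) (use assms(1) in \<open>auto simp: is_subring_def\<close>)

lemma is_subring_of_nat: "is_subring S \<Longrightarrow> of_nat n \<in> S"
  by (induction n) (auto simp: is_subring_def)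

lemma is_hom_sum:
  assumes "is_subring S" "is_hom S \<sigma>" "\<And>i. i \<in> I \<Longrightarrow> f i \<in> S"
  shows "\<sigma> (sum f I) = (\<Sum>i\<in>I. \<sigma> (f i))"
  using assms(3)
proof (induction I rule: infinite_finite_induct)
  case (insert x F)
  then show ?case using assms(1,2) is_subring_sum[OF assms(1), of F f]
    by (auto simp: is_hom_def)
qed (use assms(2) in \<open>auto simp: is_hom_def\<close>)

lemma is_hom_uminus:
  assumes "is_subring S" "is_hom S \<sigma>" "a \<in> S"
  shows "\<sigma> (-a) = - \<sigma> a"
proof -
  have "-a \<in> S" using assms by (simp add: is_subring_def)
  then have "\<sigma> (a + (-a)) = \<sigma> a + \<sigma> (-a)" using assms(2,3) unfolding is_hom_def by blast
  then show ?thesis using assms(2) by (simp add: is_hom_def add_eq_0_iff)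
qed

section \<open>Polynomials over a subring and the vanishing ideals of points\<close>

lemma polys_over_closed:
  assumes "is_subring S"
  shows "0 \<in> polys_over S" "1 \<in> polys_over S"
    "p \<in> polys_over S \<Longrightarrow> q \<in> polys_over S \<Longrightarrow> p + q \<in> polys_over S"
    "p \<in> polys_over S \<Longrightarrow> - p \<in> polys_over S"
    "p \<in> polys_over S \<Longrightarrow> q \<in> polys_over S \<Longrightarrow> p - q \<in> polys_over S"
    "p \<in> polys_over S \<Longrightarrow> q \<in> polys_over S \<Longrightarrow> p * q \<in> polys_over S"
    "c \<in> S \<Longrightarrow> p \<in> polys_over S \<Longrightarrow> smult c p \<in> polys_over S"
    "c \<in> S \<Longrightarrow> monom c n \<in> polys_over S"
    "c \<in> S \<Longrightarrow> [:c:] \<in> polys_over S"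
proof -
  have m: "a - b \<in> S" if "a \<in> S" "b \<in> S" for a b
    using assms that unfolding is_subring_def by (metis diff_conv_add_uminus)
  show "p \<in> polys_over S \<Longrightarrow> q \<in> polys_over S \<Longrightarrow> p - q \<in> polys_over S"
    using m by (auto simp: polys_over_def)
  show "p \<in> polys_over S \<Longrightarrow> q \<in> polys_over S \<Longrightarrow> p * q \<in> polys_over S"
    using assms by (auto simp: polys_over_def coeff_mult is_subring_def intro!: is_subring_sum[OF assms])
  show "c \<in> S \<Longrightarrow> [:c:] \<in> polys_over S"
    using assms by (auto simp: polys_over_def is_subring_def coeff_pCons split: nat.split)
  show "1 \<in> polys_over S"
    using assms by (auto simp: polys_over_def is_subring_def one_pCons coeff_pCons split: nat.split)
qed (use assms in \<open>auto simp: polys_over_def is_subring_def\<close>)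

text \<open>Division with remainder without fractions: each step multiplies \<open>f\<close> by the
  leading coefficient of \<open>g\<close> before cancelling the top term, and the factors accumulate
  in \<open>c\<close>.\<close>

lemma pseudo_division:
  fixes B :: "complex set"
  assumes B: "is_subring B" and g: "g \<in> polys_over B" "g \<noteq> 0"
  shows "f \<in> polys_over B \<Longrightarrow> \<exists>c q r. c \<in> B \<and> c \<noteq> 0 \<and> q \<in> polys_over B \<and> r \<in> polys_over B \<and>
           smult c f = q * g + r \<and> (r = 0 \<or> degree r < degree g)"
proof (induction "degree f" arbitrary: f rule: less_induct)
  case less
  note cl = polys_over_closed[OF B]
  show ?case
  proof (cases "f = 0 \<or> degree f < degree g")
    case True
    have "1 \<in> B" using B by (simp add: is_subring_def)
    then show ?thesis
      using less.prems cl(1) True by (intro exI[of _ 1] exI[of _ 0] exI[of _ f]) auto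
  next
    case False
    define k where "k = degree f - degree g"
    define f' where "f' = smult (lead_coeff g) f - monom (lead_coeff f) k * g"
    have lg: "lead_coeff g \<in> B" and lf: "lead_coeff f \<in> B"
      using g less.prems by (auto simp: polys_over_def)
    have f': "f' \<in> polys_over B" unfolding f'_def using cl less.prems g lg lf by auto
    have deg: "f' = 0 \<or> degree f' < degree f"
    proof -
      have d1: "degree (smult (lead_coeff g) f) = degree f" using g by simp
      have d2: "degree (monom (lead_coeff f) k * g) = degree f"
        using False g by (simp add: degree_mult_eq degree_monom_eq k_def)
      have "coeff f' (degree f) = 0"
        using False d2 unfolding f'_def
        by (simp add: coeff_monom_mult k_def)
      moreover have "degree f' \<le> degree f" unfolding f'_def using d1 d2 by (metis degree_diff_le order_refl)
      ultimately show ?thesis by (metis leading_coeff_0_iff le_neq_implies_less)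
    qed
    have "\<exists>c q r. c \<in> B \<and> c \<noteq> 0 \<and> q \<in> polys_over B \<and> r \<in> polys_over B \<and>
           smult c f' = q * g + r \<and> (r = 0 \<or> degree r < degree g)"
    proof (cases "f' = 0")
      case True
      have "1 \<in> B" using B by (simp add: is_subring_def)
      then show ?thesis using cl(1) True by (intro exI[of _ 1] exI[of _ 0] exI[of _ 0]) auto
    next
      case False
      then show ?thesis using less.hyps deg f' by blast
    qed
    then obtain c q r where c: "c \<in> B" "c \<noteq> 0" "q \<in> polys_over B" "r \<in> polys_over B"
      "smult c f' = q * g + r" "r = 0 \<or> degree r < degree g" by blast
    have "smult (c * lead_coeff g) f = (q + monom (c * lead_coeff f) k) * g + r"
    proof -
      have "smult (c * lead_coeff g) f = smult c f' + smult c (monom (lead_coeff f) k * g)"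
        unfolding f'_def by (simp add: smult_diff_right)
      also have "\<dots> = q * g + r + monom (c * lead_coeff f) k * g"
        using c(5) by (simp add: smult_monom flip: mult_smult_left)
      finally show ?thesis by (simp add: algebra_simps)
    qed
    moreover have "c * lead_coeff g \<in> B" "c * lead_coeff f \<in> B" using B c(1) lg lf by (auto simp: is_subring_def)
    moreover have "c * lead_coeff g \<noteq> 0" using c(2) g by simp
    ultimately show ?thesis using c cl
      by (intro exI[of _ "c * lead_coeff g"] exI[of _ "q + monom (c * lead_coeff f) k"] exI[of _ r]) auto
  qed
qed

text \<open>Prime ideals of \<open>B[x]\<close> that meet the constants in 0 only. Vanishing ideals
  of complex numbers are of this kind; \<open>realize_prime_polys\<close> is the converse for
  countable \<open>B\<close>.\<close>

definition prime_polys :: "complex set \<Rightarrow> complex poly set \<Rightarrow> bool" where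
  "prime_polys B M \<longleftrightarrow> M \<subseteq> polys_over B \<and> 0 \<in> M \<and> (\<forall>f\<in>M. \<forall>g\<in>M. f - g \<in> M) \<and>
     (\<forall>f\<in>M. \<forall>g\<in>polys_over B. g * f \<in> M) \<and>
     (\<forall>f\<in>polys_over B. \<forall>g\<in>polys_over B. f * g \<in> M \<longrightarrow> f \<in> M \<or> g \<in> M) \<and>
     (\<forall>c. [:c:] \<in> M \<longrightarrow> c = 0)"

lemma min_degree_poly:
  assumes "\<exists>f. f \<in> M \<and> f \<noteq> (0::complex poly)"
  obtains m where "m \<in> M" "m \<noteq> 0" "\<And>f. f \<in> M \<Longrightarrow> f \<noteq> 0 \<Longrightarrow> degree m \<le> degree f"
  using exists_least_iff[of "\<lambda>d. \<exists>f\<in>M. f \<noteq> 0 \<and> degree f = d"] assms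
  by (metis not_le)

text \<open>Over the fraction field of \<open>B\<close> the ideal \<open>M\<close> is generated by
  \<open>m\<close>, which is irreducible since \<open>M\<close> is prime; so \<open>m\<close> is up
  to a scalar the minimal polynomial of each of its roots. Pseudo-division expresses this without
  leaving \<open>B\<close>.\<close>

lemma vanishing_of_prime_polys:
  assumes B: "is_subring B" and M: "prime_polys B M"
    and m: "m \<in> M" "m \<noteq> 0" "\<And>f. f \<in> M \<Longrightarrow> f \<noteq> 0 \<Longrightarrow> degree m \<le> degree f"
    and \<alpha>: "poly m \<alpha> = 0" and f: "f \<in> polys_over B"
  shows "poly f \<alpha> = 0 \<longleftrightarrow> f \<in> M"
proof -
  note cl = polys_over_closed[OF B]
  have MB: "g \<in> polys_over B" if "g \<in> M" for g using that M by (auto simp: prime_polys_def)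
  \<comment> \<open>Nonzero constants can be cancelled modulo \<open>M\<close>, which is prime and
    contains none of them.\<close>
  have cM: "g \<in> M" if "smult c g \<in> M" "g \<in> polys_over B" "c \<in> B" "c \<noteq> 0" for c g
  proof -
    have "[:c:] * g \<in> M" using that by simp
    then have "[:c:] \<in> M \<or> g \<in> M" using M that cl(9)[OF \<open>c \<in> B\<close>] unfolding prime_polys_def by blast
    then show ?thesis using M that(4) unfolding prime_polys_def by blast
  qed
  \<comment> \<open>Stated for any ideal \<open>N\<close>, because it serves both \<open>M\<close>
    with \<open>m\<close> and the ideal of all polynomials vanishing at
    \<open>\<alpha>\<close>.\<close>
  have div: "\<exists>c q. c \<in> B \<and> c \<noteq> 0 \<and> q \<in> polys_over B \<and> smult c g = q * u"
    if g: "g \<in> N" and N: "N \<subseteq> polys_over B" "\<And>f g. f \<in> N \<Longrightarrow> g \<in> N \<Longrightarrow> f - g \<in> N"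
      "\<And>f g. f \<in> N \<Longrightarrow> g \<in> polys_over B \<Longrightarrow> g * f \<in> N" 
      and u: "u \<in> N" "u \<noteq> 0" "\<And>f. f \<in> N \<Longrightarrow> f \<noteq> 0 \<Longrightarrow> degree u \<le> degree f" for g N u
  proof -
    obtain c q r where c: "c \<in> B" "c \<noteq> 0" "q \<in> polys_over B" "r \<in> polys_over B"
      "smult c g = q * u + r" "r = 0 \<or> degree r < degree u"
      using pseudo_division[OF B, of u g] g N u by blast
    have "[:c:] * g \<in> N" using N(3) g cl(9) c(1) by blast
    then have "r \<in> N" using N(2)[of "[:c:] * g" "q * u"] N(3)[OF u(1) c(3)] c(5) by simp
    then have "r = 0" using u(3) c(6) by (meson not_le)
    then show ?thesis using c by auto
  qed
  define N where "N = {g \<in> polys_over B. poly g \<alpha> = 0}"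
  have N: "N \<subseteq> polys_over B" "\<And>f g. f \<in> N \<Longrightarrow> g \<in> N \<Longrightarrow> f - g \<in> N"
      "\<And>f g. f \<in> N \<Longrightarrow> g \<in> polys_over B \<Longrightarrow> g * f \<in> N" 
    using cl by (auto simp: N_def)
  have M': "M \<subseteq> polys_over B" "\<And>f g. f \<in> M \<Longrightarrow> g \<in> M \<Longrightarrow> f - g \<in> M"
      "\<And>f g. f \<in> M \<Longrightarrow> g \<in> polys_over B \<Longrightarrow> g * f \<in> M" 
    using M unfolding prime_polys_def by blast+
  have mN: "m \<in> N" using m(1) MB \<alpha> by (simp add: N_def)
  obtain u where u: "u \<in> N" "u \<noteq> 0" "\<And>f. f \<in> N \<Longrightarrow> f \<noteq> 0 \<Longrightarrow> degree u \<le> degree f"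
    using min_degree_poly[of N] mN m(2) by blast
  obtain c q where c: "c \<in> B" "c \<noteq> 0" "q \<in> polys_over B" "smult c m = q * u" using div[OF mN N u] by blast
  have "[:c:] * m \<in> M" using M'(3)[OF m(1) cl(9)[OF c(1)]] .
  then have "q * u \<in> M" using c(4) by simp
  then have "q \<in> M \<or> u \<in> M" using M c(3) u(1) N(1) unfolding prime_polys_def by blast
  \<comment> \<open>A nonzero \<open>u\<close> vanishing at \<open>\<alpha>\<close> is not constant,
    so the cofactor \<open>q\<close> has smaller degree than \<open>m\<close>.\<close>
  moreover have "q \<notin> M"
  proof
    assume q: "q \<in> M"
    have q0: "q \<noteq> 0" using c(2,4) m(2) by auto
    have "degree m = degree q + degree u"
      using c(2,4) degree_mult_eq[OF q0 u(2)] by (metis degree_smult_eq)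
    moreover have "degree u > 0"
    proof (rule ccontr)
      assume "\<not> degree u > 0"
      then obtain k where "u = [:k:]" by (metis gr0I degree_eq_zeroE)
      then show False using u(1,2) by (simp add: N_def)
    qed
    ultimately show False using m(3)[OF q q0] by simp
  qed
  ultimately have uM: "u \<in> M" by blast
  show ?thesis
  proof
    assume "poly f \<alpha> = 0"
    then have "f \<in> N" using f by (simp add: N_def)
    then obtain c q where c: "c \<in> B" "c \<noteq> 0" "q \<in> polys_over B" "smult c f = q * u" using div[OF _ N u] by blast
    then have "smult c f \<in> M" using M'(3)[OF uM] by simp
    then show "f \<in> M" using cM f c by blast
  next
    assume "f \<in> M"
    then obtain c q where c: "c \<in> B" "c \<noteq> 0" "q \<in> polys_over B" "smult c f = q * m" using div[OF _ M' m] by blast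
    then have "c * poly f \<alpha> = poly q \<alpha> * poly m \<alpha>" by (metis poly_mult poly_smult)
    then show "poly f \<alpha> = 0" using \<alpha> c(2) by simp
  qed
qed

lemma countable_polys_over: "countable S \<Longrightarrow> countable (polys_over S)"
proof -
  assume "countable S"
  have "polys_over S \<subseteq> Poly ` lists S"
  proof
    fix p assume "p \<in> polys_over S"
    then have "coeffs p \<in> lists S" by (auto simp: polys_over_def coeffs_def split: if_splits)
    then show "p \<in> Poly ` lists S" by (metis Poly_coeffs imageI)
  qed
  then show ?thesis using \<open>countable S\<close> by (meson countable_image countable_lists countable_subset)
qed

definition algebraic_over :: "complex set \<Rightarrow> complex set" where
  "algebraic_over B = {a. \<exists>p\<in>polys_over B. p \<noteq> 0 \<and> poly p a = 0}"

lemma countable_algebraic_over: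
  assumes "countable B"
  shows "countable (algebraic_over B)"
proof -
  have "algebraic_over B = (\<Union>p\<in>polys_over B - {0}. {a. poly p a = 0})" by (auto simp: algebraic_over_def)
  moreover have "countable {a. poly p a = 0}" if "p \<in> polys_over B - {0}" for p
    using poly_roots_finite[of p] that by (simp add: countable_finite)
  moreover have "countable (polys_over B - {0})" using countable_polys_over[OF assms] by (rule countable_Diff)
  ultimately show ?thesis by (simp only: countable_UN)
qed

lemma exists_transcendental:
  assumes "countable B" "countable (C::complex set)"
  shows "\<exists>\<alpha>. \<alpha> \<notin> algebraic_over B \<and> \<alpha> \<notin> C \<and> cmod \<alpha> > r"
proof -
  \<comment> \<open>The unit disc around a centre of modulus \<open>\<bar>r\<bar> + 2\<close> lies
    outside the disc of radius \<open>r\<close> and is uncountable.\<close>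
  define c :: complex where "c = of_real (\<bar>r\<bar> + 2)"
  have c: "cmod c = \<bar>r\<bar> + 2" unfolding c_def norm_of_real by simp
  have "uncountable (ball c 1)" by (rule uncountable_ball) simp
  moreover have "countable (algebraic_over B \<union> C)" using assms countable_algebraic_over by simp
  ultimately have "\<not> ball c 1 \<subseteq> algebraic_over B \<union> C" using countable_subset by blast
  then obtain \<alpha> where \<alpha>: "\<alpha> \<in> ball c 1" "\<alpha> \<notin> algebraic_over B \<union> C" by blast
  have "cmod c \<le> cmod (c - \<alpha>) + cmod \<alpha>" using norm_triangle_ineq[of "c - \<alpha>" \<alpha>] by simp
  moreover have "cmod (c - \<alpha>) < 1" using \<alpha>(1) by (simp add: dist_norm)
  ultimately have "cmod \<alpha> > r" using c by linarith
  then show ?thesis using \<alpha>(2) by (intro exI[of _ \<alpha>]) simp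
qed

text \<open>If \<open>M\<close> is zero, any transcendental number will do; otherwise a root of an
  element of least degree, which is not constant.\<close>

lemma realize_prime_polys:
  assumes B: "is_subring B" "countable B" and M: "prime_polys B M"
  shows "\<exists>\<alpha>. \<forall>f\<in>polys_over B. poly f \<alpha> = 0 \<longleftrightarrow> f \<in> M"
proof (cases "\<exists>f. f \<in> M \<and> f \<noteq> 0")
  case False
  obtain \<alpha> where "\<alpha> \<notin> algebraic_over B" using exists_transcendental[OF B(2), of "{}"] by auto
  moreover have "0 \<in> M" using M by (simp add: prime_polys_def)
  ultimately show ?thesis using False by (intro exI[of _ \<alpha>]) (auto simp: algebraic_over_def)
next
  case True
  then obtain m where m: "m \<in> M" "m \<noteq> 0" "\<And>f. f \<in> M \<Longrightarrow> f \<noteq> 0 \<Longrightarrow> degree m \<le> degree f"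
    using min_degree_poly[of M] by blast
  have "degree m > 0"
  proof (rule ccontr)
    assume "\<not> degree m > 0"
    then obtain k where "m = [:k:]" by (metis gr0I degree_eq_zeroE)
    then show False using m(1,2) M by (auto simp: prime_polys_def)
  qed
  then obtain \<alpha> where "poly m \<alpha> = 0"
    by (metis fundamental_theorem_of_algebra constant_degree less_irrefl)
  then show ?thesis using vanishing_of_prime_polys[OF B(1) M m] by blast
qed

text \<open>The assumption says that \<open>a\<close> is outside the fraction field of
  \<open>B\<close>. A transcendental \<open>a\<close> is exchanged for another transcendental
  number; an algebraic one has a minimal polynomial of degree at least 2, which is separable in
  characteristic 0 and so has a second root.\<close>

lemma other_conjugate:
  fixes B :: "complex set"
  assumes B: "is_subring B" "countable B" and a: "\<And>b. b \<in> B \<Longrightarrow> b \<noteq> 0 \<Longrightarrow> b * a \<notin> B"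
  shows "\<exists>\<alpha>. \<alpha> \<noteq> a \<and> (\<forall>f\<in>polys_over B. poly f \<alpha> = 0 \<longleftrightarrow> poly f a = 0)"
proof (cases "a \<in> algebraic_over B")
  case False
  obtain \<alpha> where "\<alpha> \<notin> algebraic_over B" "\<alpha> \<notin> {a}" using exists_transcendental[OF B(2), of "{a}"] by auto
  then show ?thesis using False by (intro exI[of _ \<alpha>]) (auto simp: algebraic_over_def)
next
  case True
  note cl = polys_over_closed[OF B(1)]
  define M where "M = {f \<in> polys_over B. poly f a = 0}"
  have M: "prime_polys B M" using cl by (auto simp: prime_polys_def M_def)
  obtain m where m: "m \<in> M" "m \<noteq> 0" "\<And>f. f \<in> M \<Longrightarrow> f \<noteq> 0 \<Longrightarrow> degree m \<le> degree f"
    using min_degree_poly[of M] True by (auto simp: M_def algebraic_over_def)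
  have mB: "m \<in> polys_over B" and ma: "poly m a = 0" using m by (auto simp: M_def)
  obtain v where v: "m = [:-a, 1:] * v" using ma unfolding poly_eq_0_iff_dvd by (rule dvdE)
  have v0: "v \<noteq> 0" using v m(2) by auto
  have dm: "degree m = Suc (degree v)" using v v0 by (simp add: degree_mult_eq del: mult_pCons_left)
  \<comment> \<open>A constant cofactor would make \<open>m\<close> linear and put \<open>a\<close>
    into the fraction field.\<close>
  have "degree v > 0"
  proof (rule ccontr)
    assume "\<not> degree v > 0"
    then obtain k where k: "v = [:k:]" by (metis gr0I degree_eq_zeroE)
    then have "coeff m 0 = - (k * a)" "coeff m 1 = k" using v by (auto simp: mult.commute)
    moreover have "coeff m 0 \<in> B" "coeff m 1 \<in> B" using mB by (simp_all add: polys_over_def)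
    ultimately have "k \<in> B" "- (- (k * a)) \<in> B" using B(1) unfolding is_subring_def by metis+
    then show False using a[of k] k v0 by auto
  qed
  then obtain \<alpha> where \<alpha>: "poly v \<alpha> = 0"
    by (metis fundamental_theorem_of_algebra constant_degree less_irrefl)
  \<comment> \<open>The derivative has smaller degree than \<open>m\<close>, so it does not vanish
    at \<open>a\<close>. Hence \<open>a\<close> is a simple root, and the root
    \<open>\<alpha>\<close> of the cofactor differs from it.\<close>
  have pd: "pderiv m \<in> polys_over B"
    using mB B(1) is_subring_of_nat[OF B(1)] unfolding polys_over_def is_subring_def
    by (simp add: coeff_pderiv del: of_nat_Suc)
  have "pderiv m \<noteq> 0" using dm by (simp add: pderiv_eq_0_iff)
  moreover have "degree (pderiv m) < degree m" using dm by (simp add: degree_pderiv)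
  ultimately have "poly (pderiv m) a \<noteq> 0" using m(3)[of "pderiv m"] pd by (auto simp: M_def)
  then have "poly v a \<noteq> 0" using ma by (simp only: v pderiv_mult) (simp add: pderiv_pCons del: mult_pCons_left)
  then have "\<alpha> \<noteq> a" using \<alpha> by auto
  moreover have "poly m \<alpha> = 0" by (simp only: v poly_mult \<alpha> mult_zero_right)
  from vanishing_of_prime_polys[OF B(1) M m this]
  have "\<forall>f\<in>polys_over B. poly f \<alpha> = 0 \<longleftrightarrow> poly f a = 0" by (simp add: M_def)
  ultimately show ?thesis by (intro exI[of _ \<alpha>] conjI)
qed

section \<open>Extension of homomorphisms\<close>

definition adjoin :: "'r::comm_ring_1 set \<Rightarrow> 'r \<Rightarrow> 'r set" where
  "adjoin S a = (\<lambda>p. poly p a) ` polys_over S"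

lemma is_subring_adjoin: "is_subring S \<Longrightarrow> is_subring (adjoin S a)"
proof -
  assume S: "is_subring S"
  note cl = polys_over_closed[OF S]
  show ?thesis
    unfolding is_subring_def adjoin_def
  proof (intro conjI ballI)
    show "0 \<in> (\<lambda>p. poly p a) ` polys_over S" by (rule image_eqI[OF _ cl(1)]) simp
    show "1 \<in> (\<lambda>p. poly p a) ` polys_over S" by (rule image_eqI[OF _ cl(2)]) simp
    fix x assume "x \<in> (\<lambda>p. poly p a) ` polys_over S"
    then obtain p where p: "p \<in> polys_over S" "x = poly p a" by blast
    show "- x \<in> (\<lambda>p. poly p a) ` polys_over S" by (rule image_eqI[OF _ cl(4)[OF p(1)]]) (simp add: p)
    fix y assume "y \<in> (\<lambda>p. poly p a) ` polys_over S"
    then obtain q where q: "q \<in> polys_over S" "y = poly q a" by blast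
    show "x + y \<in> (\<lambda>p. poly p a) ` polys_over S" by (rule image_eqI[OF _ cl(3)[OF p(1) q(1)]]) (simp add: p q)
    show "x * y \<in> (\<lambda>p. poly p a) ` polys_over S" by (rule image_eqI[OF _ cl(6)[OF p(1) q(1)]]) (simp add: p q)
  qed
qed

lemma adjoin_superset: "is_subring S \<Longrightarrow> S \<subseteq> adjoin S a"
proof
  fix s assume "is_subring S" "s \<in> S"
  then have "[:s:] \<in> polys_over S" by (rule polys_over_closed(9))
  then show "s \<in> adjoin S a" unfolding adjoin_def by (rule image_eqI[rotated]) simp
qed

lemma adjoin_mem: "is_subring S \<Longrightarrow> a \<in> adjoin S a"
proof -
  assume S: "is_subring S"
  then have "[:0, 1:] \<in> polys_over S"
    by (auto simp: polys_over_def is_subring_def coeff_pCons split: nat.split)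
  then show ?thesis unfolding adjoin_def by (rule image_eqI[rotated]) simp
qed

lemma countable_adjoin: "countable S \<Longrightarrow> countable (adjoin S a)"
  unfolding adjoin_def by (intro countable_image countable_polys_over)

lemma map_poly_hom:
  assumes S: "is_subring S" and h: "is_hom S \<sigma>" and p: "p \<in> polys_over S" and q: "q \<in> polys_over S"
  shows "map_poly \<sigma> (p + q) = map_poly \<sigma> p + map_poly \<sigma> q"
    "map_poly \<sigma> (p * q) = map_poly \<sigma> p * map_poly \<sigma> q"
    "map_poly \<sigma> (p - q) = map_poly \<sigma> p - map_poly \<sigma> q"
    "map_poly \<sigma> p \<in> polys_over (\<sigma> ` S)"
proof -
  have h0: "\<sigma> 0 = 0" using h by (simp add: is_hom_def)
  have pS: "coeff p n \<in> S" and qS: "coeff q n \<in> S" for n using p q by (auto simp: polys_over_def)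
  have add: "\<sigma> (x + y) = \<sigma> x + \<sigma> y" "\<sigma> (x * y) = \<sigma> x * \<sigma> y" if "x \<in> S" "y \<in> S" for x y
    using h that by (auto simp: is_hom_def)
  show "map_poly \<sigma> (p + q) = map_poly \<sigma> p + map_poly \<sigma> q"
    by (rule poly_eqI) (simp add: coeff_map_poly h0 add pS qS)
  have "\<sigma> (x - y) = \<sigma> x - \<sigma> y" if "x \<in> S" "y \<in> S" for x y
    using add(1)[of x "-y"] is_hom_uminus[OF S h, of y] that S by (simp add: is_subring_def)
  then show "map_poly \<sigma> (p - q) = map_poly \<sigma> p - map_poly \<sigma> q"
    by (intro poly_eqI) (simp add: coeff_map_poly h0 pS qS)
  show "map_poly \<sigma> (p * q) = map_poly \<sigma> p * map_poly \<sigma> q"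
  proof (rule poly_eqI)
    fix n
    have "\<sigma> (coeff (p * q) n) = (\<Sum>i\<le>n. \<sigma> (coeff p i * coeff q (n - i)))"
      unfolding coeff_mult using S pS qS by (intro is_hom_sum[OF S h]) (simp add: is_subring_def)
    also have "\<dots> = (\<Sum>i\<le>n. \<sigma> (coeff p i) * \<sigma> (coeff q (n - i)))" using add pS qS by simp
    finally show "coeff (map_poly \<sigma> (p * q)) n = coeff (map_poly \<sigma> p * map_poly \<sigma> q) n"
      by (simp add: coeff_map_poly h0 coeff_mult)
  qed
  show "map_poly \<sigma> p \<in> polys_over (\<sigma> ` S)"
    using pS by (auto simp: polys_over_def coeff_map_poly h0)
qed

lemma is_subring_image:
  assumes S: "is_subring S" and h: "is_hom S \<sigma>"
  shows "is_subring (\<sigma> ` S)"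
  unfolding is_subring_def
proof (intro conjI ballI)
  have S': "0 \<in> S" "1 \<in> S" "\<And>a. a \<in> S \<Longrightarrow> - a \<in> S" "\<And>a b. a \<in> S \<Longrightarrow> b \<in> S \<Longrightarrow> a + b \<in> S"
    "\<And>a b. a \<in> S \<Longrightarrow> b \<in> S \<Longrightarrow> a * b \<in> S"
    using S by (auto simp: is_subring_def)
  show "0 \<in> \<sigma> ` S" by (rule image_eqI[OF _ S'(1)]) (use h in \<open>simp add: is_hom_def\<close>)
  show "1 \<in> \<sigma> ` S" by (rule image_eqI[OF _ S'(2)]) (use h in \<open>simp add: is_hom_def\<close>)
  fix x assume "x \<in> \<sigma> ` S"
  then obtain u where u: "u \<in> S" "x = \<sigma> u" by blast
  show "- x \<in> \<sigma> ` S" by (rule image_eqI[OF _ S'(3)[OF u(1)]]) (simp add: u is_hom_uminus[OF S h])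
  fix y assume "y \<in> \<sigma> ` S"
  then obtain v where v: "v \<in> S" "y = \<sigma> v" by blast
  show "x + y \<in> \<sigma> ` S" by (rule image_eqI[OF _ S'(4)[OF u(1) v(1)]]) (use h u v in \<open>simp add: is_hom_def\<close>)
  show "x * y \<in> \<sigma> ` S" by (rule image_eqI[OF _ S'(5)[OF u(1) v(1)]]) (use h u v in \<open>simp add: is_hom_def\<close>)
qed

text \<open>A homomorphism is determined modulo the ideal, so the kernel condition makes it well defined
  on the adjunction.\<close>

lemma extend_hom:
  assumes S: "is_subring S" and h: "is_hom S \<sigma>" and I0: "0 \<in> I"
    and \<alpha>: "\<And>p. p \<in> polys_over S \<Longrightarrow> poly (map_poly \<sigma> p) \<alpha> = 0 \<longleftrightarrow> poly p a \<in> I"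
  shows "\<exists>\<tau>. is_hom (adjoin S a) \<tau> \<and> (\<forall>s\<in>S. \<tau> s = \<sigma> s) \<and> \<tau> a = \<alpha> \<and>
           (\<forall>s\<in>adjoin S a. \<tau> s = 0 \<longleftrightarrow> s \<in> I)"
proof -
  note cl = polys_over_closed[OF S]
  have h0: "\<sigma> 0 = 0" "\<sigma> 1 = 1" using h unfolding is_hom_def by blast+
  define \<tau> where "\<tau> s = poly (map_poly \<sigma> (SOME p. p \<in> polys_over S \<and> poly p a = s)) \<alpha>" for s
  have \<tau>: "\<tau> (poly p a) = poly (map_poly \<sigma> p) \<alpha>" if p: "p \<in> polys_over S" for p
  proof -
    define q where "q = (SOME q. q \<in> polys_over S \<and> poly q a = poly p a)"
    have q: "q \<in> polys_over S \<and> poly q a = poly p a" unfolding q_def by (rule someI[of _ p]) (simp add: p)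
    have "poly (q - p) a \<in> I" using q I0 by simp
    then have "poly (map_poly \<sigma> (q - p)) \<alpha> = 0" using \<alpha> cl(5) q p by blast
    then have "poly (map_poly \<sigma> q) \<alpha> = poly (map_poly \<sigma> p) \<alpha>" using map_poly_hom(3)[OF S h] q p by simp
    then show ?thesis by (simp add: \<tau>_def q_def)
  qed
  have "\<tau> (poly 0 a) = 0" by (subst \<tau>[OF cl(1)]) simp
  moreover have "\<tau> (poly 1 a) = 1" by (subst \<tau>[OF cl(2)]) (simp add: map_poly_1' h0)
  moreover have "\<tau> (x + y) = \<tau> x + \<tau> y \<and> \<tau> (x * y) = \<tau> x * \<tau> y" if xy: "x \<in> adjoin S a" "y \<in> adjoin S a" for x y
  proof -
    obtain p q where p: "p \<in> polys_over S" "x = poly p a" and q: "q \<in> polys_over S" "y = poly q a"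
      using xy by (auto simp: adjoin_def)
    have "\<tau> (poly (p + q) a) = \<tau> x + \<tau> y" "\<tau> (poly (p * q) a) = \<tau> x * \<tau> y"
      using \<tau>[OF p(1)] \<tau>[OF q(1)] \<tau>[OF cl(3)[OF p(1) q(1)]] \<tau>[OF cl(6)[OF p(1) q(1)]]
        map_poly_hom(1,2)[OF S h p(1) q(1)] p(2) q(2) by simp_all
    then show ?thesis by (simp add: p q)
  qed
  ultimately have "is_hom (adjoin S a) \<tau>" by (simp add: is_hom_def)
  moreover have "\<tau> s = \<sigma> s" if "s \<in> S" for s
    using \<tau>[OF cl(9)[OF that]] by (simp add: map_poly_pCons h0)
  moreover have "\<tau> a = \<alpha>"
  proof -
    have "[:0, 1:] \<in> polys_over S"
      using S by (auto simp: polys_over_def is_subring_def coeff_pCons split: nat.split)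
    from \<tau>[OF this] show ?thesis by (simp add: map_poly_pCons h0)
  qed
  moreover have "\<tau> s = 0 \<longleftrightarrow> s \<in> I" if s: "s \<in> adjoin S a" for s
  proof -
    obtain p where p: "p \<in> polys_over S" "s = poly p a" using s by (auto simp: adjoin_def)
    show ?thesis using \<tau>[OF p(1)] \<alpha>[OF p(1)] p by simp
  qed
  ultimately show ?thesis by (intro exI[of _ \<tau>]) simp
qed

text \<open>The polynomials over \<open>S\<close> whose value at \<open>a\<close> lies in
  \<open>I\<close> are carried by \<open>\<sigma>\<close> to a prime ideal that meets the constants
  in 0. These are the polynomials vanishing at some \<open>\<alpha>\<close>, which is the image
  chosen for \<open>a\<close>.\<close>

lemma extend_hom_exists:
  assumes S: "is_subring S" "countable S" and h: "is_hom S \<sigma>" and I: "prime_ideal I"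
    and ker: "\<forall>s\<in>S. \<sigma> s = 0 \<longleftrightarrow> s \<in> I"
  shows "\<exists>\<tau>. is_hom (adjoin S a) \<tau> \<and> (\<forall>s\<in>S. \<tau> s = \<sigma> s) \<and>
           (\<forall>s\<in>adjoin S a. \<tau> s = 0 \<longleftrightarrow> s \<in> I)"
proof -
  note cl = polys_over_closed[OF S(1)]
  have h0: "\<sigma> 0 = 0" "\<sigma> 1 = 1" using h unfolding is_hom_def by blast+
  have I': "0 \<in> I" "\<And>a b. a \<in> I \<Longrightarrow> b \<in> I \<Longrightarrow> a + b \<in> I" "\<And>a r. a \<in> I \<Longrightarrow> r * a \<in> I"
    "\<And>a b. a * b \<in> I \<Longrightarrow> a \<in> I \<or> b \<in> I"
    using I by (auto simp: prime_ideal_def)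
  have Im: "a - b \<in> I" if "a \<in> I" "b \<in> I" for a b
    using I'(2)[OF that(1) I'(3)[OF that(2), of "-1"]] by simp
  define M where "M = map_poly \<sigma> ` {p \<in> polys_over S. poly p a \<in> I}"
  \<comment> \<open>Polynomials killed by \<open>\<sigma>\<close> have their coefficients in
    \<open>I\<close>, so membership in \<open>M\<close> does not depend on the preimage chosen over
    \<open>S\<close>.\<close>
  have ker0: "poly p a \<in> I" if p: "p \<in> polys_over S" "map_poly \<sigma> p = 0" for p
  proof -
    have "coeff p i \<in> I" for i
    proof -
      have "\<sigma> (coeff p i) = coeff (map_poly \<sigma> p) i" by (simp add: coeff_map_poly h0)
      then show ?thesis using bspec[OF ker, of "coeff p i"] p by (simp add: polys_over_def)
    qed
    then have ci: "coeff p i * a ^ i \<in> I" for i using I'(3)[of "coeff p i" "a ^ i"] by (simp add: mult.commute)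
    have "(\<Sum>i\<le>n. coeff p i * a ^ i) \<in> I" for n
      by (induction n) (use ci[of 0] in simp, use ci I'(2) in \<open>simp only: sum.atMost_Suc\<close>)
    then show ?thesis by (simp add: poly_altdef)
  qed
  have M_iff: "map_poly \<sigma> p \<in> M \<longleftrightarrow> poly p a \<in> I" if p: "p \<in> polys_over S" for p
  proof
    assume "map_poly \<sigma> p \<in> M"
    then obtain q where q: "q \<in> polys_over S" "poly q a \<in> I" "map_poly \<sigma> p = map_poly \<sigma> q" by (auto simp: M_def)
    then have "map_poly \<sigma> (q - p) = 0" using map_poly_hom(3)[OF S(1) h q(1) p] by simp
    then have "poly (q - p) a \<in> I" using ker0 cl(5)[OF q(1) p] by blast
    then show "poly p a \<in> I" using Im[OF q(2)] by fastforce
  qed (use p in \<open>auto simp: M_def\<close>)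
  \<comment> \<open>\<open>map_poly\<close> acts coefficientwise only for functions that preserve 0,
    hence the separate clause for 0 in the section \<open>g\<close> of
    \<open>\<sigma>\<close>.\<close>
  have lift: "\<exists>p\<in>polys_over S. map_poly \<sigma> p = f" if "f \<in> polys_over (\<sigma> ` S)" for f
  proof -
    define g where "g c = (if c = 0 then 0 else (SOME s. s \<in> S \<and> \<sigma> s = c))" for c
    have g: "g c \<in> S \<and> \<sigma> (g c) = c" if "c \<in> \<sigma> ` S" for c
    proof (cases "c = 0")
      case True then show ?thesis using S(1) h0 by (simp add: g_def is_subring_def)
    next
      case False
      then show ?thesis unfolding g_def using that someI_ex[of "\<lambda>s. s \<in> S \<and> \<sigma> s = c"] by auto
    qed
    have "map_poly g f \<in> polys_over S" using that g by (auto simp: polys_over_def coeff_map_poly g_def)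
    moreover have "map_poly \<sigma> (map_poly g f) = f"
      using that g by (intro poly_eqI) (auto simp: polys_over_def coeff_map_poly h0 g_def)
    ultimately show ?thesis by blast
  qed
  note hh = map_poly_hom[OF S(1) h]
  have "prime_polys (\<sigma> ` S) M"
    unfolding prime_polys_def
  proof (intro conjI ballI allI impI)
    show "M \<subseteq> polys_over (\<sigma> ` S)" using hh(4) by (auto simp: M_def)
    show "0 \<in> M" using M_iff[OF cl(1)] I'(1) by simp
    show "f - g \<in> M" if f: "f \<in> M" and g: "g \<in> M" for f g
    proof -
      obtain p q where "p \<in> polys_over S" "poly p a \<in> I" "f = map_poly \<sigma> p" "q \<in> polys_over S" "poly q a \<in> I" "g = map_poly \<sigma> q"
        using f g by (auto simp: M_def)
      then show ?thesis using hh(3)[of p q] M_iff[of "p - q"] cl(5) Im by simp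
    qed
    show "g * f \<in> M" if f: "f \<in> M" and g: "g \<in> polys_over (\<sigma> ` S)" for f g
    proof -
      obtain p q where "p \<in> polys_over S" "poly p a \<in> I" "f = map_poly \<sigma> p" "q \<in> polys_over S" "g = map_poly \<sigma> q"
        using f lift[OF g] by (auto simp: M_def)
      then show ?thesis using hh(2)[of q p] M_iff[of "q * p"] cl(6) I'(3) by simp
    qed
    show "f \<in> M \<or> g \<in> M" if f: "f \<in> polys_over (\<sigma> ` S)" and g: "g \<in> polys_over (\<sigma> ` S)" and fg: "f * g \<in> M" for f g
    proof -
      obtain p q where pq: "p \<in> polys_over S" "f = map_poly \<sigma> p" "q \<in> polys_over S" "g = map_poly \<sigma> q"
        using lift[OF f] lift[OF g] by auto
      then have "poly (p * q) a \<in> I" using hh(2)[of p q] M_iff[of "p * q"] cl(6) fg by simp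
      then show ?thesis using I'(4)[of "poly p a" "poly q a"] M_iff pq by auto
    qed
    show "c = 0" if c: "[:c:] \<in> M" for c
    proof -
      have "[:c:] \<in> polys_over (\<sigma> ` S)" using c hh(4) by (auto simp: M_def)
      then have "coeff [:c:] 0 \<in> \<sigma> ` S" unfolding polys_over_def by blast
      then obtain s where s: "s \<in> S" "\<sigma> s = c" by auto
      then have "map_poly \<sigma> [:s:] = [:c:]" by (simp add: map_poly_pCons h0)
      then have "poly [:s:] a \<in> I" using M_iff[OF cl(9)[OF s(1)]] c by simp
      then show ?thesis using bspec[OF ker s(1)] s by simp
    qed
  qed
  from realize_prime_polys[OF is_subring_image[OF S(1) h] countable_image[OF S(2)] this]
  obtain \<alpha> where \<alpha>: "\<forall>f\<in>polys_over (\<sigma> ` S). poly f \<alpha> = 0 \<longleftrightarrow> f \<in> M" by (rule exE)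
  have "poly (map_poly \<sigma> p) \<alpha> = 0 \<longleftrightarrow> poly p a \<in> I" if "p \<in> polys_over S" for p
    using \<alpha>[rule_format, OF hh(4)[OF that that]] M_iff[OF that] by simp
  from extend_hom[OF S(1) h I'(1) this] obtain \<tau> where
    "is_hom (adjoin S a) \<tau> \<and> (\<forall>s\<in>S. \<tau> s = \<sigma> s) \<and> \<tau> a = \<alpha> \<and> (\<forall>s\<in>adjoin S a. \<tau> s = 0 \<longleftrightarrow> s \<in> I)"
    by (rule exE)
  then show ?thesis by (intro exI[of _ \<tau>]) simp
qed

lemma extend_hom_finite:
  assumes "finite J" and S: "is_subring S" "countable S" and h: "is_hom S \<sigma>" and I: "prime_ideal I"
    and ker: "\<forall>s\<in>S. \<sigma> s = 0 \<longleftrightarrow> s \<in> I"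
  shows "\<exists>T \<tau>. is_subring T \<and> countable T \<and> S \<subseteq> T \<and> J \<subseteq> T \<and> is_hom T \<tau> \<and>
           (\<forall>s\<in>S. \<tau> s = \<sigma> s) \<and> (\<forall>s\<in>T. \<tau> s = 0 \<longleftrightarrow> s \<in> I)"
  using assms(1)
proof (induction J)
  case empty
  then show ?case using S h ker by (intro exI[of _ S] exI[of _ \<sigma>]) simp
next
  case (insert a J)
  then obtain T \<tau> where T: "is_subring T" "countable T" "S \<subseteq> T" "J \<subseteq> T" "is_hom T \<tau>"
     "\<forall>s\<in>S. \<tau> s = \<sigma> s" "\<forall>s\<in>T. \<tau> s = 0 \<longleftrightarrow> s \<in> I" by (elim exE conjE)
  from extend_hom_exists[OF T(1,2,5) I T(7), of a]
  obtain \<rho> where \<rho>: "is_hom (adjoin T a) \<rho>" "\<forall>s\<in>T. \<rho> s = \<tau> s" "\<forall>s\<in>adjoin T a. \<rho> s = 0 \<longleftrightarrow> s \<in> I"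
    by (elim exE conjE)
  show ?case
    using is_subring_adjoin[OF T(1), of a] countable_adjoin[OF T(2), of a] adjoin_superset[OF T(1), of a]
      adjoin_mem[OF T(1), of a] T \<rho>
    by (intro exI[of _ "adjoin T a"] exI[of _ \<rho>]) (auto simp: subset_iff)
qed

text \<open>Polynomial expressions in \<open>X\<close> with coefficients from \<open>K\<close>. The
  coefficients stay visible because a homomorphism commutes only with polynomials whose coefficients
  it fixes.\<close>

inductive_set alg :: "complex set \<Rightarrow> ('a \<Rightarrow> complex) set \<Rightarrow> ('a \<Rightarrow> complex) set" for K X where
  const: "c \<in> K \<Longrightarrow> (\<lambda>_. c) \<in> alg K X"
| gen: "g \<in> X \<Longrightarrow> g \<in> alg K X"
| add: "f \<in> alg K X \<Longrightarrow> g \<in> alg K X \<Longrightarrow> (\<lambda>x. f x + g x) \<in> alg K X"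
| mult: "f \<in> alg K X \<Longrightarrow> g \<in> alg K X \<Longrightarrow> (\<lambda>x. f x * g x) \<in> alg K X"

lemma alg_mono: "K \<subseteq> L \<Longrightarrow> P \<in> alg K X \<Longrightarrow> P \<in> alg L X"
  by (rotate_tac, induction rule: alg.induct) (auto intro: alg.intros)

lemma alg_finite_coeffs: "P \<in> alg UNIV X \<Longrightarrow> \<exists>C. finite C \<and> P \<in> alg C X"
proof (induction rule: alg.induct)
  case (const c)
  then show ?case by (intro exI[of _ "{c}"]) (auto intro: alg.const)
next
  case (gen g)
  then show ?case by (intro exI[of _ "{}"]) (auto intro: alg.gen)
next
  case (add f g)
  then obtain C D where "finite C" "f \<in> alg C X" "finite D" "g \<in> alg D X" by blast
  then show ?case using alg_mono[of C "C \<union> D" f X] alg_mono[of D "C \<union> D" g X] by (intro exI[of _ "C \<union> D"]) (simp add: alg.add)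
next
  case (mult f g)
  then obtain C D where "finite C" "f \<in> alg C X" "finite D" "g \<in> alg D X" by blast
  then show ?case using alg_mono[of C "C \<union> D" f X] alg_mono[of D "C \<union> D" g X] by (intro exI[of _ "C \<union> D"]) (simp add: alg.mult)
qed

lemma countable_subring:
  assumes "countable C"
  shows "\<exists>K. is_subring K \<and> countable K \<and> C \<subseteq> (K::complex set)"
proof -
  define F where "F A = A \<union> uminus ` A \<union> (\<lambda>(a, b). a + b) ` (A \<times> A) \<union> (\<lambda>(a, b). a * b) ` (A \<times> A)" for A :: "complex set"
  define K where "K n = (F ^^ n) (C \<union> {0, 1})" for n
  have step: "K (Suc n) = F (K n)" for n by (simp add: K_def)
  have "countable (K n)" for n
    by (induction n) (use assms in \<open>auto simp: step F_def K_def[of 0] intro!: countable_image countable_SIGMA\<close>)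
  moreover have mono: "K m \<subseteq> K n" if "m \<le> n" for m n
    using that by (induction rule: dec_induct) (auto simp: step F_def)
  have "is_subring (\<Union>n. K n)"
    unfolding is_subring_def
  proof (intro conjI ballI)
    have "C \<union> {0,1} = K 0" by (simp add: K_def)
    then show "0 \<in> (\<Union>n. K n)" "1 \<in> (\<Union>n. K n)" by blast+
    fix a assume "a \<in> (\<Union>n. K n)"
    then obtain m where m: "a \<in> K m" by blast
    then have "- a \<in> K (Suc m)" by (auto simp: step F_def)
    then show "- a \<in> (\<Union>n. K n)" by blast
    fix b assume "b \<in> (\<Union>n. K n)"
    then obtain n where n: "b \<in> K n" by blast
    have "a \<in> K (max m n)" "b \<in> K (max m n)" using m n mono[of m "max m n"] mono[of n "max m n"] by auto
    then have "a + b \<in> K (Suc (max m n))" "a * b \<in> K (Suc (max m n))" by (auto simp: step F_def)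
    then show "a + b \<in> (\<Union>n. K n)" "a * b \<in> (\<Union>n. K n)" by blast+
  qed
  moreover have "C \<subseteq> K 0" by (auto simp: K_def)
  ultimately show ?thesis by (intro exI[of _ "\<Union>n. K n"] conjI) (simp, simp, blast)
qed

text \<open>Each polynomial function involves finitely many coefficients, so countably many
  functions are defined over one countable ring.\<close>

lemma countable_subring_alg:
  assumes "countable \<P>" "\<P> \<subseteq> alg UNIV X"
  shows "\<exists>K. is_subring K \<and> countable K \<and> \<P> \<subseteq> alg K X"
proof -
  have "\<forall>P\<in>\<P>. \<exists>C. finite C \<and> P \<in> alg C X" by (intro ballI alg_finite_coeffs subsetD[OF assms(2)])
  then obtain C where C: "\<And>P. P \<in> \<P> \<Longrightarrow> finite (C P) \<and> P \<in> alg (C P) X" by metis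
  have "countable (\<Union>P\<in>\<P>. C P)" using C assms(1) by (intro countable_UN) (auto intro: countable_finite)
  then obtain K where K: "is_subring K" "countable K" "(\<Union>P\<in>\<P>. C P) \<subseteq> K" using countable_subring[of "\<Union>P\<in>\<P>. C P"] by blast
  have "P \<in> alg K X" if "P \<in> \<P>" for P
    by (rule alg_mono[of "C P"]) (use C K(3) that in blast)+
  then show ?thesis using K by (intro exI[of _ K]) (simp add: subsetI)
qed

text \<open>Solutions go to solutions: if \<open>\<sigma>\<close> maps the generators along the
  family \<open>y\<close> to their values at \<open>y'\<close>, it does the same for every
  polynomial in them whose coefficients it fixes.\<close>

lemma alg_hom:
  assumes S: "is_subring S" and h: "is_hom S \<sigma>"
    and K: "\<And>c. c \<in> K \<Longrightarrow> (\<lambda>_. c) \<in> S \<and> \<sigma> (\<lambda>_. c) = c"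
    and X: "\<And>g. g \<in> X \<Longrightarrow> (\<lambda>s. g (y s)) \<in> S \<and> \<sigma> (\<lambda>s. g (y s)) = g y'"
    and P: "P \<in> alg K X"
  shows "(\<lambda>s. P (y s)) \<in> S \<and> \<sigma> (\<lambda>s. P (y s)) = P y'"
  using P
proof (induction rule: alg.induct)
  case (const c)
  then show ?case by (rule K)
next
  case (gen g)
  then show ?case by (rule X)
next
  case (add f g)
  define F G where "F = (\<lambda>s. f (y s))" and "G = (\<lambda>s. g (y s))"
  have FG: "F \<in> S" "G \<in> S" "\<sigma> F = f y'" "\<sigma> G = g y'" using add.IH unfolding F_def G_def by simp_all
  have "F + G \<in> S" "\<sigma> (F + G) = \<sigma> F + \<sigma> G"
    using S h FG(1,2) unfolding is_subring_def is_hom_def by blast+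
  moreover have "F + G = (\<lambda>s. f (y s) + g (y s))" by (simp add: F_def G_def plus_fun_def)
  ultimately show ?case using FG by simp
next
  case (mult f g)
  define F G where "F = (\<lambda>s. f (y s))" and "G = (\<lambda>s. g (y s))"
  have FG: "F \<in> S" "G \<in> S" "\<sigma> F = f y'" "\<sigma> G = g y'" using mult.IH unfolding F_def G_def by simp_all
  have "F * G \<in> S" "\<sigma> (F * G) = \<sigma> F * \<sigma> G"
    using S h FG(1,2) unfolding is_subring_def is_hom_def by blast+
  moreover have "F * G = (\<lambda>s. f (y s) * g (y s))" by (simp add: F_def G_def times_fun_def)
  ultimately show ?case using FG by simp
qed

section \<open>Specialization of families of points\<close>

definition const_fun :: "complex \<Rightarrow> 's \<Rightarrow> complex" where "const_fun c = (\<lambda>_. c)"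

lemma const_fun_simps:
  "const_fun a + const_fun b = const_fun (a + b)" "const_fun a * const_fun b = const_fun (a * b)"
  "- const_fun a = const_fun (- a)" "const_fun 0 = 0" "const_fun 1 = 1"
  by (simp_all add: const_fun_def fun_eq_iff)

lemma const_fun_subring: "is_subring K \<Longrightarrow> is_subring (const_fun ` K :: ('s \<Rightarrow> complex) set)"
  unfolding is_subring_def
  by (force simp: const_fun_simps const_fun_simps(4,5)[symmetric] simp del: const_fun_simps(4,5))

lemma const_fun_hom: "is_hom (const_fun ` K) (\<lambda>f. f s)"
  by (auto simp: is_hom_def const_fun_def)

lemma poly_fun_apply: "poly p a s = poly (map_poly (\<lambda>f. f s) p) (a s)"
  for p :: "('s \<Rightarrow> complex) poly"
proof (induction p)
  case (pCons c p)
  then show ?case by (simp add: map_poly_pCons)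
qed simp

lemma const_fun_poly:
  assumes "p \<in> polys_over (const_fun ` K)"
  shows "map_poly (\<lambda>f. f s) p = map_poly (\<lambda>f. f s') p" "map_poly (\<lambda>f. f s) p \<in> polys_over K"
proof -
  have c: "coeff p n \<in> const_fun ` K" for n using assms by (simp add: polys_over_def)
  have "coeff p n s = coeff p n s'" "coeff p n s \<in> K" for n using c[of n] by (auto simp: const_fun_def)
  then show "map_poly (\<lambda>f. f s) p = map_poly (\<lambda>f. f s') p" "map_poly (\<lambda>f. f s) p \<in> polys_over K"
    by (auto intro!: poly_eqI simp: coeff_map_poly polys_over_def)
qed

text \<open>Functions on a one-point type are a copy of \<open>\<complex>\<close>; with this ideal a
  family is a single point.\<close>

lemma prime_ideal_zero: "prime_ideal {0 :: unit \<Rightarrow> complex}"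
  by (auto simp: prime_ideal_def fun_eq_iff)

text \<open>Modulo such an ideal a sequence of distinct numbers is transcendental over the constants.\<close>

lemma exists_nonprincipal_prime_ideal:
  "\<exists>I::(nat \<Rightarrow> complex) set. prime_ideal I \<and> (\<forall>f\<in>I. infinite {n. f n = 0})"
proof -
  define Ids where "Ids = {I::(nat \<Rightarrow> complex) set. 0 \<in> I \<and> (\<forall>a\<in>I. \<forall>b\<in>I. a + b \<in> I) \<and> (\<forall>a\<in>I. \<forall>r. r * a \<in> I) \<and>
     (\<forall>f\<in>I. infinite {n. f n = 0})}"
  \<comment> \<open>Zorn's lemma applies because the condition on zeros concerns one element of the
    ideal at a time and so passes to unions of chains.\<close>
  have "\<exists>M\<in>Ids. \<forall>X\<in>Ids. M \<subseteq> X \<longrightarrow> X = M"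
  proof (rule subset_Zorn_nonempty)
    have "{0} \<in> Ids" by (auto simp: Ids_def)
    then show "Ids \<noteq> {}" by blast
    fix C assume C: "C \<noteq> {}" "subset.chain Ids C"
    have sub: "I \<in> Ids" if "I \<in> C" for I using C(2) that by (auto simp: subset.chain_def)
    show "\<Union>C \<in> Ids"
      unfolding Ids_def
    proof (intro CollectI conjI ballI allI)
      show "0 \<in> \<Union>C" using C(1) sub by (auto simp: Ids_def)
      fix a assume "a \<in> \<Union>C"
      then obtain I where I: "I \<in> C" "a \<in> I" by blast
      show "infinite {n. a n = 0}" using sub[OF I(1)] I(2) by (simp add: Ids_def)
      show "r * a \<in> \<Union>C" for r
      proof
        show "r * a \<in> I" using sub[OF I(1)] I(2) unfolding Ids_def by blast
      qed (rule I(1))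
      fix b assume "b \<in> \<Union>C"
      then obtain J where J: "J \<in> C" "b \<in> J" by blast
      have "I \<subseteq> J \<or> J \<subseteq> I" using C(2) I J by (auto simp: subset.chain_def)
      then obtain L where L: "L \<in> C" "a \<in> L" "b \<in> L" using I J by blast
      show "a + b \<in> \<Union>C"
      proof
        show "a + b \<in> L" using sub[OF L(1)] L(2,3) unfolding Ids_def by blast
      qed (rule L(1))
    qed
  qed
  then obtain M where M: "M \<in> Ids" "\<And>X. X \<in> Ids \<Longrightarrow> M \<subseteq> X \<Longrightarrow> X = M" by blast
  have M0: "0 \<in> M" and Madd: "\<And>a b. a \<in> M \<Longrightarrow> b \<in> M \<Longrightarrow> a + b \<in> M" and Mmul: "\<And>a r. a \<in> M \<Longrightarrow> r * a \<in> M"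
    and Minf: "\<And>f. f \<in> M \<Longrightarrow> infinite {n. f n = 0}"
    using M(1) by (auto simp: Ids_def)
  \<comment> \<open>Maximality: adjoining \<open>f\<close> to \<open>M\<close> must produce a
    function with only finitely many zeros.\<close>
  have big: "\<exists>j\<in>M. \<exists>r. finite {n. (j + r * f) n = 0}" if "f \<notin> M" for f
  proof (rule ccontr)
    assume neg: "\<not> ?thesis"
    define X where "X = {j + r * f | j r. j \<in> M}"
    have "X \<in> Ids"
      unfolding Ids_def
    proof (intro CollectI conjI ballI allI)
      show "0 \<in> X" unfolding X_def using M0 by (auto intro!: exI[of _ 0])
      fix a assume "a \<in> X"
      then obtain j r where a: "a = j + r * f" "j \<in> M" by (auto simp: X_def)
      show "infinite {n. a n = 0}" using neg a by auto
      have "s * a = s * j + (s * r) * f" for s using a(1) by (simp add: algebra_simps)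
      then show "s * a \<in> X" for s unfolding X_def using Mmul[OF a(2)] by blast
      fix b assume "b \<in> X"
      then obtain k s where b: "b = k + s * f" "k \<in> M" by (auto simp: X_def)
      have "a + b = (j + k) + (r + s) * f" using a(1) b(1) by (simp add: algebra_simps)
      then show "a + b \<in> X" unfolding X_def using Madd[OF a(2) b(2)] by blast
    qed
    moreover have "M \<subseteq> X"
    proof
      fix j assume "j \<in> M"
      moreover have "j = j + 0 * f" by simp
      ultimately show "j \<in> X" unfolding X_def by blast
    qed
    ultimately have "X = M" by (rule M(2))
    moreover have "f = 0 + 1 * f" by simp
    then have "f \<in> X" unfolding X_def using M0 by blast
    ultimately show False using that by simp
  qed
  have "prime_ideal M"
    unfolding prime_ideal_def
  proof (intro conjI ballI allI impI)
    show "1 \<notin> M" using Minf[of 1] by auto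
    fix a b assume ab: "a * b \<in> M"
    show "a \<in> M \<or> b \<in> M"
    proof (rule ccontr)
      assume "\<not> (a \<in> M \<or> b \<in> M)"
      then obtain j r k s where jr: "j \<in> M" "finite {n. (j + r * a) n = 0}" "k \<in> M" "finite {n. (k + s * b) n = 0}"
        using big[of a] big[of b] by blast
      \<comment> \<open>A product of two functions with finitely many zeros has finitely many zeros,
        yet this one lies in \<open>M\<close>.\<close>
      have "(j + r * a) * (k + s * b) = (k + s * b) * j + ((r * a) * k + (r * s) * (a * b))"
        by (simp add: algebra_simps)
      also have "\<dots> \<in> M" using Madd Mmul jr ab by presburger
      finally have "infinite {n. ((j + r * a) * (k + s * b)) n = 0}" by (rule Minf)
      moreover have "{n. ((j + r * a) * (k + s * b)) n = 0} = {n. (j + r * a) n = 0} \<union> {n. (k + s * b) n = 0}" by auto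
      ultimately show False using jr by simp
    qed
  qed (use M0 Madd Mmul in auto)
  then show ?thesis using Minf by blast
qed

text \<open>A family of points \<open>y\<close> with parameter \<open>a\<close> is specialized to
  one point \<open>y'\<close> with parameter \<open>\<alpha>\<close>. A homomorphism that fixes
  \<open>K\<close> and sends \<open>a\<close> to \<open>\<alpha>\<close> is extended to the
  coordinate functions of the family; their images are the coordinates of a point by assumption
  \<open>all\<close>. The form \<open>p P - q Q\<close> expresses both the vanishing of
  \<open>P\<close> (\<open>p = 1\<close>, \<open>q = 0\<close>) and an equation for the quotient
  \<open>P / Q\<close>; the equivalence also transfers the nonvanishing of denominators.\<close>

lemma specialize:
  fixes y :: "'s \<Rightarrow> 'a" and coords :: "'b::finite \<Rightarrow> 'a \<Rightarrow> complex"
  assumes K: "is_subring K" "countable K" and I: "prime_ideal I"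
    and \<alpha>: "\<And>p. p \<in> polys_over K \<Longrightarrow> poly p \<alpha> = 0 \<longleftrightarrow> (\<lambda>s. poly p (a s)) \<in> I"
    and all: "\<And>g. \<exists>y. \<forall>b. coords b y = g b"
  shows "\<exists>y'. \<forall>P\<in>alg K (range coords). \<forall>p\<in>polys_over K. \<forall>q\<in>polys_over K. \<forall>Q\<in>alg K (range coords).
           poly p \<alpha> * P y' - poly q \<alpha> * Q y' = 0 \<longleftrightarrow> (\<lambda>s. poly p (a s) * P (y s) - poly q (a s) * Q (y s)) \<in> I"
proof -
  define S :: "('s \<Rightarrow> complex) set" where "S = const_fun ` K"
  define s0 :: 's where "s0 = undefined"
  define \<sigma> where "\<sigma> = (\<lambda>f :: 's \<Rightarrow> complex. f s0)"
  have S: "is_subring S" "countable S" using K by (auto simp: S_def const_fun_subring)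
  have h: "is_hom S \<sigma>" unfolding S_def \<sigma>_def by (rule const_fun_hom)
  have I0: "0 \<in> I" using I by (simp add: prime_ideal_def)
  \<comment> \<open>Coefficients in \<open>S\<close> are constant functions, so evaluating them at
    the single index \<open>s0\<close> loses nothing.\<close>
  have pe: "poly p a = (\<lambda>s. poly (map_poly \<sigma> p) (a s))" if "p \<in> polys_over S" for p
    using const_fun_poly(1)[of p K] that unfolding S_def \<sigma>_def by (metis poly_fun_apply ext)
  have "poly (map_poly \<sigma> p) \<alpha> = 0 \<longleftrightarrow> poly p a \<in> I" if p: "p \<in> polys_over S" for p
    unfolding pe[OF p] using const_fun_poly(2)[of p K s0] p \<alpha> unfolding S_def \<sigma>_def by blast
  from extend_hom[OF S(1) h I0 this]
  obtain \<sigma>1 where "is_hom (adjoin S a) \<sigma>1 \<and> (\<forall>s\<in>S. \<sigma>1 s = \<sigma> s) \<and> \<sigma>1 a = \<alpha> \<and> (\<forall>s\<in>adjoin S a. \<sigma>1 s = 0 \<longleftrightarrow> s \<in> I)"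
    by (rule exE)
  then have \<sigma>1: "is_hom (adjoin S a) \<sigma>1" "\<forall>s\<in>S. \<sigma>1 s = \<sigma> s" "\<sigma>1 a = \<alpha>" "\<forall>s\<in>adjoin S a. \<sigma>1 s = 0 \<longleftrightarrow> s \<in> I"
    by simp_all
  have fin: "finite (range (\<lambda>b s. coords b (y s)))" by simp
  from extend_hom_finite[OF fin is_subring_adjoin[OF S(1)] countable_adjoin[OF S(2)] \<sigma>1(1) I \<sigma>1(4)]
  obtain T \<tau> where T: "is_subring T" "adjoin S a \<subseteq> T" "range (\<lambda>b s. coords b (y s)) \<subseteq> T" "is_hom T \<tau>"
    "\<forall>s\<in>adjoin S a. \<tau> s = \<sigma>1 s" "\<forall>s\<in>T. \<tau> s = 0 \<longleftrightarrow> s \<in> I"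
    by (elim exE conjE)
  obtain y' where y': "\<And>b. coords b y' = \<tau> (\<lambda>s. coords b (y s))" using all[of "\<lambda>b. \<tau> (\<lambda>s. coords b (y s))"] by blast
  have KT: "(\<lambda>_. c) \<in> T \<and> \<tau> (\<lambda>_. c) = c" if "c \<in> K" for c
  proof -
    have "const_fun c \<in> S" using that by (simp add: S_def)
    moreover from this have "const_fun c \<in> adjoin S a" using adjoin_superset[OF S(1), of a] by blast
    ultimately have "const_fun c \<in> T" "\<tau> (const_fun c) = c"
      using T(2) T(5)[rule_format, of "const_fun c"] \<sigma>1(2)[rule_format, of "const_fun c"]
      by (auto simp: \<sigma>_def const_fun_def)
    then show ?thesis by (simp add: const_fun_def)
  qed
  have ev: "(\<lambda>s. P (y s)) \<in> T \<and> \<tau> (\<lambda>s. P (y s)) = P y'" if "P \<in> alg K (range coords)" for P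
    by (rule alg_hom[OF T(1,4) KT _ that]) (use T(3) y' in auto)
  have aT: "a \<in> T \<and> \<tau> a = \<alpha>" using adjoin_mem[OF S(1)] T(2,5) \<sigma>1(3) by auto
  have evp: "(\<lambda>s. poly p (a s)) \<in> T \<and> \<tau> (\<lambda>s. poly p (a s)) = poly p \<alpha>" if "p \<in> polys_over K" for p
  proof -
    \<comment> \<open>One-variable polynomials are generated by the identity, so
      \<open>alg_hom\<close> applies with the parameter \<open>a\<close> as the family.\<close>
    have "p \<in> polys_over K \<Longrightarrow> (\<lambda>z. poly p z) \<in> alg K {\<lambda>z. z}"
    proof (induction p)
      case 0
      then have "0 \<in> K" using K by (simp add: is_subring_def)
      then show ?case by (simp add: alg.const)
    next
      case (pCons c p)
      have "c \<in> K" using pCons.prems by (auto simp: polys_over_def dest: spec[of _ 0])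
      moreover have "p \<in> polys_over K" using pCons.prems by (auto simp: polys_over_def coeff_pCons dest: spec[of _ "Suc _"])
      ultimately have "(\<lambda>x. c + (x::complex) * poly p x) \<in> alg K {\<lambda>z. z}" using pCons.IH
        by (intro alg.add alg.mult) (auto intro: alg.const alg.gen)
      then show ?case by simp
    qed
    from alg_hom[OF T(1,4) KT _ this[OF that], of a \<alpha>] aT show ?thesis by simp
  qed
  show ?thesis
  proof (intro exI[of _ y'] ballI)
    fix P p q Q assume P: "P \<in> alg K (range coords)" "p \<in> polys_over K" "q \<in> polys_over K" "Q \<in> alg K (range coords)"
    define f1 f2 f3 f4 where f: "f1 = (\<lambda>s. poly p (a s))" "f2 = (\<lambda>s. P (y s))" "f3 = (\<lambda>s. poly q (a s))" "f4 = (\<lambda>s. Q (y s))"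
    have m: "f1 \<in> T" "f2 \<in> T" "f3 \<in> T" "f4 \<in> T" and v: "\<tau> f1 = poly p \<alpha>" "\<tau> f2 = P y'" "\<tau> f3 = poly q \<alpha>" "\<tau> f4 = Q y'"
      using ev[OF P(1)] evp[OF P(2)] evp[OF P(3)] ev[OF P(4)] by (simp_all add: f)
    have m12: "f1 * f2 \<in> T" and m34: "f3 * f4 \<in> T" using T(1) m unfolding is_subring_def by metis+
    then have m34': "- (f3 * f4) \<in> T" using T(1) unfolding is_subring_def by metis
    have t: "\<tau> (f1 * f2) = \<tau> f1 * \<tau> f2" "\<tau> (f3 * f4) = \<tau> f3 * \<tau> f4" using T(4) m unfolding is_hom_def by metis+
    have "\<tau> (f1 * f2 + - (f3 * f4)) = \<tau> (f1 * f2) + \<tau> (- (f3 * f4))" using T(4) m12 m34' unfolding is_hom_def by metis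
    also have "\<dots> = \<tau> f1 * \<tau> f2 - \<tau> f3 * \<tau> f4" using is_hom_uminus[OF T(1,4) m34] t by simp
    finally have "\<tau> (f1 * f2 + - (f3 * f4)) = poly p \<alpha> * P y' - poly q \<alpha> * Q y'" using v by simp
    moreover have "f1 * f2 + - (f3 * f4) \<in> T" using T(1) m12 m34' unfolding is_subring_def by metis
    moreover have "f1 * f2 + - (f3 * f4) = (\<lambda>s. poly p (a s) * P (y s) - poly q (a s) * Q (y s))"
      by (simp add: f fun_eq_iff)
    ultimately show "poly p \<alpha> * P y' - poly q \<alpha> * Q y' = 0 \<longleftrightarrow> (\<lambda>s. poly p (a s) * P (y s) - poly q (a s) * Q (y s)) \<in> I"
      using T(6) by metis
  qed
qed

text \<open>Infinitely many values would give a sequence of distinct ones, which modulo a suitable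
  prime ideal is transcendental over the countable ring of coefficients. It could be specialized to
  a transcendental number beyond the bound, which would then be a value too.\<close>

lemma bounded_values_finite:
  fixes coords :: "'b::finite \<Rightarrow> 'a \<Rightarrow> complex"
  assumes all: "\<And>g. \<exists>y. \<forall>b. coords b y = g b"
    and E: "countable E" "E \<subseteq> alg UNIV (range coords)" and N: "N \<in> alg UNIV (range coords)" and D: "D \<in> alg UNIV (range coords)"
    and bd: "bounded {N x / D x | x. D x \<noteq> 0 \<and> (\<forall>e\<in>E. e x = 0)}"
  shows "finite {N x / D x | x. D x \<noteq> 0 \<and> (\<forall>e\<in>E. e x = 0)}"
proof (rule ccontr)
  define V where "V = {N x / D x | x. D x \<noteq> 0 \<and> (\<forall>e\<in>E. e x = 0)}"
  assume "infinite {N x / D x | x. D x \<noteq> 0 \<and> (\<forall>e\<in>E. e x = 0)}"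
  then have "infinite V" by (simp add: V_def)
  then obtain v :: "nat \<Rightarrow> complex" where v: "inj v" "range v \<subseteq> V" using infinite_countable_subset by blast
  then have "\<forall>j. \<exists>x. v j = N x / D x \<and> D x \<noteq> 0 \<and> (\<forall>e\<in>E. e x = 0)" by (auto simp: V_def)
  then obtain y where y: "\<And>j. v j = N (y j) / D (y j)" "\<And>j. D (y j) \<noteq> 0" "\<And>j e. e \<in> E \<Longrightarrow> e (y j) = 0" by metis
  obtain r where r: "\<And>z. z \<in> V \<Longrightarrow> cmod z \<le> r" using bd unfolding bounded_iff V_def by blast
  obtain K where K: "is_subring K" "countable K" "insert N (insert D E) \<subseteq> alg K (range coords)"
    using countable_subring_alg[of "insert N (insert D E)" "range coords"] E N D by auto
  obtain \<alpha> where \<alpha>: "\<alpha> \<notin> algebraic_over K" "cmod \<alpha> > r" using exists_transcendental[OF K(2), of "{}"] by blast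
  obtain I :: "(nat \<Rightarrow> complex) set" where I: "prime_ideal I" "\<And>f. f \<in> I \<Longrightarrow> infinite {n. f n = 0}"
    using exists_nonprincipal_prime_ideal by blast
  have I0: "0 \<in> I" using I(1) by (simp add: prime_ideal_def)
  have "poly p \<alpha> = 0 \<longleftrightarrow> (\<lambda>s. poly p (v s)) \<in> I" if p: "p \<in> polys_over K" for p
  proof (cases "p = 0")
    case True
    then have "(\<lambda>s. poly p (v s)) = 0" by (simp add: fun_eq_iff)
    then show ?thesis using True I0 by simp
  next
    case False
    \<comment> \<open>The values are distinct, so a nonzero polynomial vanishes at only finitely
      many of them.\<close>
    have "finite (v -` {z. poly p z = 0})" using poly_roots_finite[OF False] v(1) by (rule finite_vimageI)
    then have "(\<lambda>s. poly p (v s)) \<notin> I" using I(2)[of "\<lambda>s. poly p (v s)"] by (auto simp: vimage_def)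
    then show ?thesis using \<alpha>(1) p False by (auto simp: algebraic_over_def)
  qed
  from specialize[OF K(1,2) I(1) this all, of y]
  obtain y' where y': "\<forall>P\<in>alg K (range coords). \<forall>p\<in>polys_over K. \<forall>q\<in>polys_over K. \<forall>Q\<in>alg K (range coords).
           poly p \<alpha> * P y' - poly q \<alpha> * Q y' = 0 \<longleftrightarrow> (\<lambda>s. poly p (v s) * P (y s) - poly q (v s) * Q (y s)) \<in> I" by blast
  note pc = polys_over_closed[OF K(1)]
  have x: "[:0, 1:] \<in> polys_over K"
    using K(1) by (auto simp: polys_over_def is_subring_def coeff_pCons split: nat.split)
  have vals: "P y' = 0 \<longleftrightarrow> (\<lambda>s. P (y s)) \<in> I" if "P \<in> alg K (range coords)" for P
    using y'[rule_format, OF that pc(2) pc(1) that] by simp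
  have "D y' \<noteq> 0"
  proof
    assume "D y' = 0"
    then have "(\<lambda>s. D (y s)) \<in> I" using vals K(3) by simp
    from I(2)[OF this] show False using y(2) by simp
  qed
  moreover have "e y' = 0" if "e \<in> E" for e
  proof -
    have "(\<lambda>s. e (y s)) = 0" using y(3) that by (simp add: fun_eq_iff)
    then show ?thesis using vals[of e] K(3) that I0 by auto
  qed
  \<comment> \<open>The parameter of the family is the value itself, hence the polynomials 1 and x
    in the relation.\<close>
  moreover have "N y' - \<alpha> * D y' = 0"
  proof -
    have "(\<lambda>s. N (y s) - v s * D (y s)) = 0" using y(1,2) by (simp add: fun_eq_iff)
    then show ?thesis using y'[rule_format, of N 1 "[:0,1:]" D] K(3) pc(2) x I0 by simp
  qed
  ultimately have "\<alpha> \<in> V" unfolding V_def by (auto intro!: exI[of _ y'])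
  then show False using r \<alpha>(2) by fastforce
qed

text \<open>The value at a transcendental \<open>t\<close> is rational over \<open>K(t)\<close>, as otherwise a homomorphism fixing
  \<open>K(t)\<close> moves it; homomorphisms sending \<open>t\<close> to other transcendental numbers show that the
  rational function does not depend on \<open>t\<close>.\<close>

lemma algebraic_family_rational:
  fixes coords :: "'b::finite \<Rightarrow> 'a \<Rightarrow> complex" and G :: "complex \<Rightarrow> complex"
  assumes all: "\<And>g. \<exists>y. \<forall>b. coords b y = g b"
    and C: "countable C"
    and E: "\<And>c. c \<in> C \<Longrightarrow> countable (E c) \<and> E c \<subseteq> alg UNIV (range coords) \<and> N c \<in> alg UNIV (range coords) \<and> D c \<in> alg UNIV (range coords)"
    and val: "\<And>c x. c \<in> C \<Longrightarrow> D c x \<noteq> 0 \<Longrightarrow> (\<forall>e\<in>E c. e x = 0) \<Longrightarrow> N c x = G (coords b0 x) * D c x"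
    and sur: "\<And>t. \<exists>c\<in>C. \<exists>x. D c x \<noteq> 0 \<and> (\<forall>e\<in>E c. e x = 0) \<and> coords b0 x = t"
  shows "\<exists>T p q. countable T \<and> q \<noteq> 0 \<and> (\<forall>t. t \<notin> T \<longrightarrow> G t * poly q t = poly p t)"
proof -
  obtain K where K: "is_subring K" "countable K" "(\<Union>c\<in>C. insert (N c) (insert (D c) (E c))) \<subseteq> alg K (range coords)"
  proof -
    have "countable (\<Union>c\<in>C. insert (N c) (insert (D c) (E c)))" using C E by (intro countable_UN) auto
    moreover have "(\<Union>c\<in>C. insert (N c) (insert (D c) (E c))) \<subseteq> alg UNIV (range coords)" using E by blast
    ultimately show ?thesis using countable_subring_alg that by meson
  qed
  define I where "I = {0 :: unit \<Rightarrow> complex}"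
  have I: "prime_ideal I" unfolding I_def by (rule prime_ideal_zero)
  have II: "(\<lambda>s::unit. z) \<in> I \<longleftrightarrow> z = 0" for z by (simp add: I_def fun_eq_iff)
  define T where "T = algebraic_over K"
  have T: "countable T" unfolding T_def by (rule countable_algebraic_over[OF K(2)])
  have sp: "\<exists>y'. \<forall>P\<in>alg L (range coords). \<forall>p\<in>polys_over L. \<forall>q\<in>polys_over L. \<forall>Q\<in>alg L (range coords).
           poly p \<alpha> * P y' - poly q \<alpha> * Q y' = 0 \<longleftrightarrow> poly p a * P y - poly q a * Q y = 0"
    if "is_subring L" "countable L" "\<And>p. p \<in> polys_over L \<Longrightarrow> poly p \<alpha> = 0 \<longleftrightarrow> poly p a = 0" for L a \<alpha> y
    using specialize[OF that(1,2) I _ all, of \<alpha> "\<lambda>_. a" "\<lambda>_. y"] that(3) by (simp add: II)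
  have coordsK: "coords b0 \<in> alg L (range coords)" for L by (rule alg.gen) simp
  have Ks: "P \<in> alg K (range coords)" if "c \<in> C" "P \<in> insert (N c) (insert (D c) (E c))" for c P using K(3) that by blast
  obtain t0 where t0: "t0 \<notin> T" using exists_transcendental[OF K(2), of "{}"] by (auto simp: T_def)
  obtain c x where cx: "c \<in> C" "D c x \<noteq> 0" "\<And>e. e \<in> E c \<Longrightarrow> e x = 0" "coords b0 x = t0" using sur by blast
  \<comment> \<open>\<open>L\<close> is \<open>K[t0]\<close>. If \<open>G t0\<close> were outside
    its fraction field, it could be exchanged for a conjugate \<open>\<alpha>\<close>; the
    specialized point keeps the coordinate \<open>t0\<close>, so \<open>\<alpha>\<close> would again
    have to be \<open>G t0\<close>.\<close>
  have "\<exists>p q. p \<in> polys_over K \<and> q \<in> polys_over K \<and> poly q t0 \<noteq> 0 \<and> poly q t0 * G t0 = poly p t0"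
  proof (rule ccontr)
    assume neg: "\<not> ?thesis"
    define L where "L = (\<lambda>p. poly p t0) ` polys_over K"
    have "L = adjoin K t0" by (simp add: L_def adjoin_def)
    then have L: "is_subring L" "countable L" "K \<subseteq> L" "t0 \<in> L"
      using is_subring_adjoin[OF K(1)] countable_adjoin[OF K(2)] adjoin_superset[OF K(1)] adjoin_mem[OF K(1)] by auto
    have "b * G t0 \<notin> L" if "b \<in> L" "b \<noteq> 0" for b using neg that by (auto simp: L_def)
    from other_conjugate[OF L(1,2) this] obtain \<alpha> where \<alpha>: "\<alpha> \<noteq> G t0" "\<And>f. f \<in> polys_over L \<Longrightarrow> poly f \<alpha> = 0 \<longleftrightarrow> poly f (G t0) = 0" by blast
    from sp[OF L(1,2) \<alpha>(2)] obtain x' where x': "\<forall>P\<in>alg L (range coords). \<forall>p\<in>polys_over L. \<forall>q\<in>polys_over L. \<forall>Q\<in>alg L (range coords).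
           poly p \<alpha> * P x' - poly q \<alpha> * Q x' = 0 \<longleftrightarrow> poly p (G t0) * P x - poly q (G t0) * Q x = 0" by blast
    note pc = polys_over_closed[OF L(1)]
    have xp: "[:0, 1:] \<in> polys_over L"
      using L(1) by (auto simp: polys_over_def is_subring_def coeff_pCons split: nat.split)
    have LP: "P \<in> alg L (range coords)" if "P \<in> insert (N c) (insert (D c) (E c))" for P
      by (rule alg_mono[OF L(3) Ks[OF cx(1) that]])
    have vals: "P x' = 0 \<longleftrightarrow> P x = 0" if "P \<in> alg L (range coords)" for P
      using x'[rule_format, OF that pc(2) pc(1) that] by simp
    have D': "D c x' \<noteq> 0" using vals LP cx(2) by simp
    have E': "\<forall>e\<in>E c. e x' = 0" using vals LP cx(3) by simp
    have "coords b0 x' - t0 * 1 = 0"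
      using x'[rule_format, OF coordsK pc(2) pc(9)[OF L(4)], of "\<lambda>_. 1"] cx(4) L(1) by (simp add: alg.const is_subring_def)
    then have t': "coords b0 x' = t0" by simp
    have "N c x' - \<alpha> * D c x' = 0"
      using x'[rule_format, OF LP pc(2) xp LP, of "N c" "D c"] val[OF cx(1,2)] cx(3,4) by simp
    then have "\<alpha> = G t0" using val[OF cx(1) D' E'] D' t' by simp
    then show False using \<alpha>(1) by simp
  qed
  then obtain p q where pq: "p \<in> polys_over K" "q \<in> polys_over K" "poly q t0 \<noteq> 0" "poly q t0 * G t0 = poly p t0" by blast
  have "G t * poly q t = poly p t" if t: "t \<notin> T" for t
  proof -
    \<comment> \<open>Numbers transcendental over \<open>K\<close> are indistinguishable over
      \<open>K\<close>, so the relation found at \<open>t0\<close> is transported to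
      \<open>t\<close>.\<close>
    have "poly f t = 0 \<longleftrightarrow> poly f t0 = 0" if "f \<in> polys_over K" for f
      using t t0 that by (auto simp: T_def algebraic_over_def)
    from sp[OF K(1,2) this] obtain x' where x': "\<forall>P\<in>alg K (range coords). \<forall>p\<in>polys_over K. \<forall>q\<in>polys_over K. \<forall>Q\<in>alg K (range coords).
           poly p t * P x' - poly q t * Q x' = 0 \<longleftrightarrow> poly p t0 * P x - poly q t0 * Q x = 0" by blast
    note pc = polys_over_closed[OF K(1)]
    have xp: "[:0, 1:] \<in> polys_over K"
      using K(1) by (auto simp: polys_over_def is_subring_def coeff_pCons split: nat.split)
    have vals: "P x' = 0 \<longleftrightarrow> P x = 0" if "P \<in> alg K (range coords)" for P
      using x'[rule_format, OF that pc(2) pc(1) that] by simp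
    have D': "D c x' \<noteq> 0" using vals Ks[OF cx(1)] cx(2) by simp
    have E': "\<forall>e\<in>E c. e x' = 0" using vals Ks[OF cx(1)] cx(3) by simp
    have "coords b0 x' - t * 1 = 0"
      using x'[rule_format, OF coordsK pc(2) xp, of "\<lambda>_. 1"] cx(4) K(1) by (simp add: alg.const is_subring_def)
    then have t': "coords b0 x' = t" by simp
    have "N c x * poly q t0 = G t0 * D c x * poly q t0" using val[OF cx(1,2)] cx(3,4) by simp
    also have "\<dots> = poly p t0 * D c x" using pq(4) by (simp add: mult_ac)
    finally have "poly q t0 * N c x - poly p t0 * D c x = 0" by (simp add: mult.commute)
    then have "poly q t * N c x' - poly p t * D c x' = 0"
      using x'[rule_format, of "N c" q p "D c"] Ks[OF cx(1)] pq(1,2) by simp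
    then have "poly q t * (G t * D c x') = poly p t * D c x'" using val[OF cx(1) D' E'] t' by simp
    then show ?thesis using D' by (simp add: mult.commute)
  qed
  moreover have "q \<noteq> 0" using pq(3) by auto
  ultimately show ?thesis using T by blast
qed

section \<open>Polynomial functions\<close>

lemma alg_uminus: "f \<in> alg UNIV X \<Longrightarrow> (\<lambda>x. - f x) \<in> alg UNIV X"
  using alg.mult[OF alg.const[of "-1" UNIV X], of f] by simp

lemma alg_diff: "f \<in> alg UNIV X \<Longrightarrow> g \<in> alg UNIV X \<Longrightarrow> (\<lambda>x. f x - g x) \<in> alg UNIV X"
  using alg.add[of f UNIV X "\<lambda>x. - g x"] alg_uminus[of g X] by simp

lemma alg_sum: "(\<And>i. i \<in> I \<Longrightarrow> f i \<in> alg UNIV X) \<Longrightarrow> (\<lambda>x. \<Sum>i\<in>I. f i x) \<in> alg UNIV X"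
  by (induction I rule: infinite_finite_induct) (auto intro: alg.const alg.add)

lemma alg_prod: "(\<And>i. i \<in> I \<Longrightarrow> f i \<in> alg UNIV X) \<Longrightarrow> (\<lambda>x. \<Prod>i\<in>I. f i x) \<in> alg UNIV X"
  by (induction I rule: infinite_finite_induct) (auto intro: alg.const alg.mult)

lemma alg_power: "f \<in> alg UNIV X \<Longrightarrow> (\<lambda>x. f x ^ n) \<in> alg UNIV X"
  by (induction n) (auto intro: alg.const alg.mult)

lemma alg_comp:
  assumes "P \<in> alg UNIV X" "\<And>g. g \<in> X \<Longrightarrow> (\<lambda>z. g (f z)) \<in> alg UNIV Y"
  shows "(\<lambda>z. P (f z)) \<in> alg UNIV Y"
  using assms(1) by (induction rule: alg.induct) (auto intro: alg.intros assms(2))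

lemma alg_continuous:
  fixes X :: "('a::topological_space \<Rightarrow> complex) set"
  assumes "P \<in> alg UNIV X" "\<And>g. g \<in> X \<Longrightarrow> continuous_on UNIV g"
  shows "continuous_on UNIV P"
  using assms(1) by (induction rule: alg.induct) (auto intro: continuous_intros assms(2))

abbreviation polyf :: "(complex ^ 'i::finite \<Rightarrow> complex) set" where
  "polyf \<equiv> alg UNIV (range (\<lambda>i v. v $ i))"

definition pair_coord :: "'i + 'j \<Rightarrow> (complex ^ 'i::finite) \<times> (complex ^ 'j::finite) \<Rightarrow> complex" where
  "pair_coord b z = (case b of Inl i \<Rightarrow> fst z $ i | Inr j \<Rightarrow> snd z $ j)"

abbreviation polyp :: "((complex ^ 'i::finite) \<times> (complex ^ 'j::finite) \<Rightarrow> complex) set" where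
  "polyp \<equiv> alg UNIV (range pair_coord)"

lemma polyf_coord: "(\<lambda>v. v $ i) \<in> polyf"
  by (rule alg.gen) auto

lemma polyp_fst: "(\<lambda>z :: (complex ^ 'i::finite) \<times> (complex ^ 'j::finite). fst z $ i) \<in> polyp"
proof -
  have "pair_coord (Inl i :: 'i + 'j) \<in> polyp" by (rule alg.gen[OF rangeI])
  then show ?thesis by (simp add: pair_coord_def[abs_def])
qed

lemma polyp_snd: "(\<lambda>z :: (complex ^ 'i::finite) \<times> (complex ^ 'j::finite). snd z $ j) \<in> polyp"
proof -
  have "pair_coord (Inr j :: 'i + 'j) \<in> polyp" by (rule alg.gen[OF rangeI])
  then show ?thesis by (simp add: pair_coord_def[abs_def])
qed

lemma polyf_comp:
  assumes "P \<in> polyf" "\<And>i. (\<lambda>z. f z $ i) \<in> alg UNIV Y"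
  shows "(\<lambda>z. P (f z)) \<in> alg UNIV Y"
  by (rule alg_comp[OF assms(1)]) (use assms(2) in auto)

lemma polyp_comp:
  fixes f :: "'a \<Rightarrow> complex ^ 'i::finite" and g :: "'a \<Rightarrow> complex ^ 'j::finite"
  assumes "P \<in> polyp" "\<And>i. (\<lambda>z. f z $ i) \<in> alg UNIV Y" "\<And>i. (\<lambda>z. g z $ i) \<in> alg UNIV Y"
  shows "(\<lambda>z. P (f z, g z)) \<in> alg UNIV Y"
proof (rule alg_comp[OF assms(1)])
  fix h assume "h \<in> range (pair_coord :: 'i + 'j \<Rightarrow> _)"
  then obtain b :: "'i + 'j" where "h = pair_coord b" by blast
  then show "(\<lambda>z. h (f z, g z)) \<in> alg UNIV Y"
    using assms(2,3) by (cases b) (simp_all add: pair_coord_def)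
qed

lemma polyf_continuous: "P \<in> polyf \<Longrightarrow> continuous_on UNIV P"
  by (rule alg_continuous) (auto intro!: continuous_intros)

lemma polyp_continuous:
  fixes P :: "(complex ^ 'i::finite) \<times> (complex ^ 'j::finite) \<Rightarrow> complex"
  assumes "P \<in> polyp"
  shows "continuous_on UNIV P"
proof (rule alg_continuous[OF assms])
  fix g assume "g \<in> range (pair_coord :: 'i + 'j \<Rightarrow> _)"
  then obtain b :: "'i + 'j" where "g = pair_coord b" by blast
  then show "continuous_on UNIV g"
    by (cases b) (auto simp: pair_coord_def[abs_def] intro!: continuous_intros)
qed

lemma monomial_at_polyf: "monomial_at k \<in> polyf"
  unfolding monomial_at_def[abs_def] by (intro alg_prod alg_power polyf_coord)

lemma monomial_at_scale: "monomial_at k (c *s v) = c ^ sum k UNIV * monomial_at k v"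
  by (simp add: monomial_at_def power_mult_distrib prod.distrib power_sum)

lemma monomial_at_mult: "monomial_at k v * monomial_at l v = monomial_at (\<lambda>i. k i + l i) v"
  by (simp add: monomial_at_def prod.distrib power_add)

lemma hom_poly_polyf: "hom_poly d P \<Longrightarrow> P \<in> polyf"
  unfolding hom_poly_def by (auto intro!: alg_sum alg.mult alg.const monomial_at_polyf)

lemma hom_poly_scale: "hom_poly d P \<Longrightarrow> P (c *s v) = c ^ d * P v"
  unfolding hom_poly_def by (auto simp: monomial_at_scale sum_distrib_left mult_ac)

text \<open>With a list of terms instead of a coefficient function, sums and products need no
  collection of like terms.\<close>

lemma polyf_monomials:
  assumes "P \<in> polyf"
  shows "\<exists>xs. \<forall>v. P v = (\<Sum>(c, k)\<leftarrow>xs. c * monomial_at k v)"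
  using assms
proof (induction rule: alg.induct)
  case (const c)
  show ?case by (intro exI[of _ "[(c, \<lambda>_. 0)]"]) (simp add: monomial_at_def)
next
  case (gen g)
  then obtain i where "g = (\<lambda>v. v $ i)" by blast
  moreover have "monomial_at (\<lambda>j. if j = i then 1 else 0) v = v $ i" for v :: "complex ^ 'a"
  proof -
    have "monomial_at (\<lambda>j. if j = i then 1 else 0) v = (\<Prod>j\<in>UNIV. if j = i then v $ j else 1)"
      unfolding monomial_at_def by (rule prod.cong) auto
    then show ?thesis by simp
  qed
  ultimately show ?case by (intro exI[of _ "[(1, \<lambda>j. if j = i then 1 else 0)]"]) simp
next
  case (add f g)
  then obtain xs ys where "\<forall>v. f v = (\<Sum>(c, k)\<leftarrow>xs. c * monomial_at k v)" "\<forall>v. g v = (\<Sum>(c, k)\<leftarrow>ys. c * monomial_at k v)"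
    by blast
  then show ?case by (intro exI[of _ "xs @ ys"]) simp
next
  case (mult f g)
  then obtain xs ys where f: "\<forall>v. f v = (\<Sum>(c, k)\<leftarrow>xs. c * monomial_at k v)" and g: "\<forall>v. g v = (\<Sum>(c, k)\<leftarrow>ys. c * monomial_at k v)"
    by blast
  define m :: "complex \<times> ('a \<Rightarrow> nat) \<Rightarrow> complex \<times> ('a \<Rightarrow> nat) \<Rightarrow> _" where
    "m = (\<lambda>(c, k) (d, l). (c * d, \<lambda>i. k i + l i))"
  have one: "sum_list (map ((\<lambda>(c, k). c * monomial_at k v) \<circ> m x) ys) = (fst x * monomial_at (snd x) v) * (\<Sum>(c, k)\<leftarrow>ys. c * monomial_at k v)" for x v ys
    by (induction ys) (auto simp: m_def monomial_at_mult[symmetric] algebra_simps case_prod_beta)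
  have "(\<Sum>(c, k)\<leftarrow>concat (map (\<lambda>x. map (m x) ys) xs). c * monomial_at k v) = (\<Sum>(c, k)\<leftarrow>xs. c * monomial_at k v) * (\<Sum>(c, k)\<leftarrow>ys. c * monomial_at k v)" for v
    by (induction xs) (simp_all add: one[unfolded case_prod_beta] distrib_right case_prod_beta)
  then show ?case using f g by (intro exI[of _ "concat (map (\<lambda>x. map (m x) ys) xs)"]) simp
qed

lemma finite_exponents: "finite {k :: 'i::finite \<Rightarrow> nat. sum k UNIV = d}"
proof (rule finite_subset)
  show "{k :: 'i \<Rightarrow> nat. sum k UNIV = d} \<subseteq> UNIV \<rightarrow>\<^sub>E {..d}"
    by (auto simp: member_le_sum)
qed (simp add: finite_PiE)

text \<open>Comparing coefficients of \<open>t ^ d\<close> in \<open>P (t *s v)\<close> discards the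
  terms of every other degree; those that remain are collected by exponent.\<close>

lemma hom_polyI:
  assumes P: "P \<in> polyf" and h: "\<And>c v. P (c *s v) = c ^ d * P v"
  shows "hom_poly d P"
proof -
  obtain xs where xs: "\<And>v. P v = (\<Sum>(c, k)\<leftarrow>xs. c * monomial_at k v)" using polyf_monomials[OF P] by blast
  define ys where "ys = filter (\<lambda>(c, k). sum k UNIV = d) xs"
  have "P v = (\<Sum>(c, k)\<leftarrow>ys. c * monomial_at k v)" for v
  proof -
    \<comment> \<open>\<open>q\<close> is \<open>P (t *s v)\<close> as a polynomial in
      \<open>t\<close>; by the scaling assumption it is a single monomial.\<close>
    define q where "q = (\<Sum>(c, k)\<leftarrow>xs. monom (c * monomial_at k v) (sum k UNIV))"
    have "poly (\<Sum>(c, k)\<leftarrow>xs. monom (c * monomial_at k v) (sum k UNIV)) t = (\<Sum>(c, k)\<leftarrow>xs. c * monomial_at k (t *s v))" for t xs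
      by (induction xs) (auto simp: poly_monom monomial_at_scale)
    then have "poly q t = poly (monom (P v) d) t" for t
      using h[of t v] xs[of "t *s v"] by (simp add: q_def poly_monom mult.commute)
    then have "poly q = poly (monom (P v) d)" by (rule ext)
    then have "q = monom (P v) d" by (simp only: poly_eq_poly_eq_iff)
    then have "P v = coeff q d" by simp
    also have "coeff (\<Sum>(c, k)\<leftarrow>xs. monom (c * monomial_at k v) (sum k UNIV)) d
        = (\<Sum>(c, k)\<leftarrow>filter (\<lambda>(c, k). sum k UNIV = d) xs. c * monomial_at k v)" for xs
      by (induction xs) auto
    then have "coeff q d = (\<Sum>(c, k)\<leftarrow>ys. c * monomial_at k v)" unfolding q_def ys_def .
    finally show ?thesis .
  qed
  moreover have "(\<Sum>(c, k)\<leftarrow>ys. c * monomial_at k v) =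
      (\<Sum>k | sum k UNIV = d. (\<Sum>(c, l)\<leftarrow>ys. if l = k then c else 0) * monomial_at k v)" for v
  proof -
    have "\<forall>x\<in>set ys. sum (snd x) UNIV = d" by (auto simp: ys_def)
    then show ?thesis
    proof (induction ys)
      case (Cons x ys)
      have "(\<Sum>k | sum k UNIV = d. (if snd x = k then fst x else 0) * monomial_at k v)
          = (\<Sum>k | sum k UNIV = d. if snd x = k then fst x * monomial_at (snd x) v else 0)"
        by (rule sum.cong) auto
      also have "\<dots> = fst x * monomial_at (snd x) v"
        using Cons.prems by (subst sum.delta'[OF finite_exponents]) simp
      finally have "(\<Sum>k | sum k UNIV = d. (if snd x = k then fst x else 0) * monomial_at k v) = fst x * monomial_at (snd x) v" .
      then show ?case using Cons by (simp add: case_prod_beta distrib_right sum.distrib)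
    qed simp
  qed
  ultimately show ?thesis unfolding hom_poly_def
    by (intro exI[of _ "\<lambda>k. \<Sum>(c, l)\<leftarrow>ys. if l = k then c else 0"]) (simp add: fun_eq_iff)
qed

text \<open>The working form of homogeneity: closure properties follow from those of
  \<open>polyf\<close> and of scaling, without touching coefficients.\<close>

lemma hom_poly_iff: "hom_poly d P \<longleftrightarrow> P \<in> polyf \<and> (\<forall>c v. P (c *s v) = c ^ d * P v)"
  using hom_polyI hom_poly_polyf hom_poly_scale by blast

lemma hom_poly_mult: "hom_poly d P \<Longrightarrow> hom_poly e Q \<Longrightarrow> hom_poly (d + e) (\<lambda>v. P v * Q v)"
  unfolding hom_poly_iff by (auto intro: alg.mult simp: power_add)

lemma hom_poly_add: "hom_poly d P \<Longrightarrow> hom_poly d Q \<Longrightarrow> hom_poly d (\<lambda>v. P v + Q v)"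
  unfolding hom_poly_iff by (auto intro: alg.add simp: algebra_simps)

lemma hom_poly_diff: "hom_poly d P \<Longrightarrow> hom_poly d Q \<Longrightarrow> hom_poly d (\<lambda>v. P v - Q v)"
  unfolding hom_poly_iff by (auto intro: alg_diff simp: algebra_simps)

lemma hom_poly_cmult: "hom_poly d P \<Longrightarrow> hom_poly d (\<lambda>v. c * P v)"
  unfolding hom_poly_iff by (auto intro: alg.mult[OF alg.const] simp: algebra_simps)

lemma hom_poly_const: "hom_poly 0 (\<lambda>_. c)"
  unfolding hom_poly_iff by (auto intro: alg.const)

lemma hom_poly_coord: "hom_poly 1 (\<lambda>v. v $ i)"
  unfolding hom_poly_iff by (auto intro: polyf_coord)

lemma hom_poly_comp:
  assumes "hom_poly d P" "\<And>i. hom_poly e (\<lambda>v. f v $ i)"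
  shows "hom_poly (e * d) (\<lambda>v. P (f v))"
proof -
  have "f (c *s v) = c ^ e *s f v" for c v
    using assms(2) by (simp add: hom_poly_iff vec_eq_iff)
  then show ?thesis using assms
    unfolding hom_poly_iff by (auto intro!: polyf_comp[of P f] simp: power_mult)
qed

lemma bihom_poly_polyp: "bihom_poly d e P \<Longrightarrow> (\<lambda>z. P (fst z) (snd z)) \<in> polyp"
proof -
  assume "bihom_poly d e P"
  then obtain c where P: "P = (\<lambda>v w. \<Sum>k | sum k UNIV = d. \<Sum>l | sum l UNIV = e. c k l * monomial_at k v * monomial_at l w)"
    unfolding bihom_poly_def by blast
  show ?thesis unfolding P
    by (intro alg_sum alg.mult alg.const polyf_comp[OF monomial_at_polyf] polyp_fst polyp_snd) simp_all
qed

lemma bihom_poly_scale: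
  assumes "bihom_poly d e P"
  shows "P (a *s v) (b *s w) = a ^ d * b ^ e * P v w"
proof -
  obtain c where P: "P = (\<lambda>v w. \<Sum>k | sum k UNIV = d. \<Sum>l | sum l UNIV = e. c k l * monomial_at k v * monomial_at l w)"
    using assms unfolding bihom_poly_def by blast
  show ?thesis unfolding P sum_distrib_left
    by (intro sum.cong refl) (simp add: monomial_at_scale mult_ac)
qed

lemma bihom_poly_of_hom: "hom_poly d P \<Longrightarrow> bihom_poly d 0 (\<lambda>v (w :: complex ^ 'j::finite). P v)"
proof -
  assume "hom_poly d P"
  then obtain c where P: "P = (\<lambda>v. \<Sum>k | sum k UNIV = d. c k * monomial_at k v)" unfolding hom_poly_def by blast
  have l: "{l :: 'j \<Rightarrow> nat. sum l UNIV = 0} = {\<lambda>_. 0}" by (auto simp: fun_eq_iff)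
  show ?thesis unfolding bihom_poly_def P l
    by (intro exI[of _ "\<lambda>k l. c k"] ext) (simp add: monomial_at_def)
qed

section \<open>Directional derivatives\<close>

text \<open>The algebraic derivative of a polynomial, defined analytically so that the rules of
  calculus supply its properties.\<close>

definition dder :: "(complex ^ 'i::finite \<Rightarrow> complex) \<Rightarrow> complex ^ 'i \<Rightarrow> complex ^ 'i \<Rightarrow> complex" where
  "dder P v w = deriv (\<lambda>s. P (v + s *s w)) 0"

lemma dder_eqI: "((\<lambda>s. P (v + s *s w)) has_field_derivative D) (at 0) \<Longrightarrow> dder P v w = D"
  unfolding dder_def by (rule DERIV_imp_deriv)

lemma polyf_has_dder: "P \<in> polyf \<Longrightarrow> ((\<lambda>s. P (v + s *s w)) has_field_derivative dder P v w) (at 0)"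
proof -
  assume "P \<in> polyf"
  then have "\<exists>D. ((\<lambda>s. P (v + s *s w)) has_field_derivative D) (at 0)"
  proof (induction rule: alg.induct)
    case (gen g)
    then obtain i where g: "g = (\<lambda>v. v $ i)" by blast
    show ?case unfolding g by (intro exI[of _ "w $ i"]) (auto intro!: derivative_eq_intros)
  next
    case (add f g)
    then show ?case by (elim exE) (rule exI, rule DERIV_add)
  next
    case (mult f g)
    then show ?case by (elim exE) (rule exI, rule DERIV_mult)
  qed (rule exI, rule DERIV_const)
  then obtain D where D: "((\<lambda>s. P (v + s *s w)) has_field_derivative D) (at 0)" by (rule exE)
  show ?thesis unfolding dder_eqI[OF D] by (rule D)
qed

lemma dder_const: "dder (\<lambda>_. c) v w = 0"
  by (rule dder_eqI) simp

lemma dder_coord: "dder (\<lambda>v. v $ i) v w = w $ i"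
  by (rule dder_eqI) (auto intro!: derivative_eq_intros)

lemma dder_add: "P \<in> polyf \<Longrightarrow> Q \<in> polyf \<Longrightarrow> dder (\<lambda>v. P v + Q v) v w = dder P v w + dder Q v w"
  by (rule dder_eqI) (intro DERIV_add polyf_has_dder)

lemma dder_diff: "P \<in> polyf \<Longrightarrow> Q \<in> polyf \<Longrightarrow> dder (\<lambda>v. P v - Q v) v w = dder P v w - dder Q v w"
  by (rule dder_eqI) (intro DERIV_diff polyf_has_dder)

lemma dder_cmult: "P \<in> polyf \<Longrightarrow> dder (\<lambda>v. c * P v) v w = c * dder P v w"
  by (rule dder_eqI) (intro DERIV_cmult polyf_has_dder)

lemma dder_mult: "P \<in> polyf \<Longrightarrow> Q \<in> polyf \<Longrightarrow> dder (\<lambda>v. P v * Q v) v w = dder P v w * Q v + P v * dder Q v w"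
  by (rule dder_eqI) (use DERIV_mult[OF polyf_has_dder[of P v w] polyf_has_dder[of Q v w]] in \<open>simp add: mult.commute\<close>)

definition dvec :: "(complex ^ 'i::finite \<Rightarrow> complex ^ 'j::finite) \<Rightarrow> complex ^ 'i \<Rightarrow> complex ^ 'i \<Rightarrow> complex ^ 'j" where
  "dvec f v w = (\<chi> j. dder (\<lambda>v. f v $ j) v w)"

lemma dder_comp:
  assumes P: "P \<in> polyf" and f: "\<And>i. (\<lambda>v. f v $ i) \<in> polyf"
  shows "dder (\<lambda>v. P (f v)) v w = dder P (f v) (dvec f v w)"
  using P
proof (induction rule: alg.induct)
  case (gen g)
  then show ?case by (auto simp: dder_coord dvec_def)
next
  case (add g h)
  then show ?case using polyf_comp[OF _ f, of g] polyf_comp[OF _ f, of h] by (simp add: dder_add)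
next
  case (mult g h)
  then show ?case using polyf_comp[OF _ f, of g] polyf_comp[OF _ f, of h] by (simp add: dder_mult)
qed (simp add: dder_const)

lemma dder_linear:
  assumes "P \<in> polyf"
  shows "dder P v (w + w') = dder P v w + dder P v w'" "dder P v (c *s w) = c * dder P v w"
proof -
  show "dder P v (w + w') = dder P v w + dder P v w'" using assms
    by (induction rule: alg.induct) (auto simp: dder_const dder_coord dder_add dder_mult algebra_simps)
  show "dder P v (c *s w) = c * dder P v w" using assms
    by (induction rule: alg.induct) (auto simp: dder_const dder_coord dder_add dder_mult algebra_simps)
qed

lemma dder_linear_sum:
  assumes "P \<in> polyf" "finite I"
  shows "dder P v (\<Sum>i\<in>I. c i *s w i) = (\<Sum>i\<in>I. c i * dder P v (w i))"
proof -
  have z: "dder P v 0 = 0" using dder_linear(2)[OF assms(1), of v 0 0] by simp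
  show ?thesis using assms(2) by (induction I rule: finite_induct) (simp_all add: z dder_linear[OF assms(1)])
qed

lemma dder_polyp: "P \<in> polyf \<Longrightarrow> (\<lambda>z. dder P (fst z) (snd z)) \<in> polyp"
proof (induction rule: alg.induct)
  case (gen g)
  then obtain i where "g = (\<lambda>v. v $ i)" by blast
  then show ?case by (simp add: dder_coord polyp_snd)
next
  case (add g h)
  then show ?case by (simp add: dder_add alg.add)
next
  case (mult g h)
  show ?case unfolding dder_mult[OF mult.hyps]
    by (intro alg.add alg.mult mult.IH polyf_comp[OF mult.hyps(1), of fst] polyf_comp[OF mult.hyps(2), of fst] polyp_fst)
qed (simp add: dder_const alg.const)

lemma dder_polyp_comp:
  assumes "P \<in> polyf" "\<And>i. (\<lambda>z. f z $ i) \<in> alg UNIV Y" "\<And>i. (\<lambda>z. g z $ i) \<in> alg UNIV Y"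
  shows "(\<lambda>z. dder P (f z) (g z)) \<in> alg UNIV Y"
  using polyp_comp[OF dder_polyp[OF assms(1)] assms(2,3)] by simp

text \<open>Scaling point and direction together keeps the degree of \<open>P\<close>, so suitable
  quotients of such derivatives descend to projective points.\<close>

lemma dder_scale:
  assumes "hom_poly d P"
  shows "dder P (c *s v) (c *s w) = c ^ d * dder P v w"
proof (rule dder_eqI)
  have e: "P (c *s v + s *s (c *s w)) = c ^ d * P (v + s *s w)" for s
  proof -
    have e: "c *s v + s *s (c *s w) = c *s (v + s *s w)" by (simp add: vec_eq_iff algebra_simps)
    show ?thesis unfolding e by (rule hom_poly_scale[OF assms])
  qed
  show "((\<lambda>s. P (c *s v + s *s (c *s w))) has_field_derivative c ^ d * dder P v w) (at 0)"
    unfolding e by (rule DERIV_cmult[OF polyf_has_dder[OF hom_poly_polyf[OF assms]]])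
qed

text \<open>Euler's identity, from \<open>P ((1 + s) *s v) = (1 + s) ^ d * P v\<close>.\<close>

lemma dder_euler:
  assumes "hom_poly d P"
  shows "dder P v v = of_nat d * P v"
proof (rule dder_eqI)
  have "P (v + s *s v) = (1 + s) ^ d * P v" for s
  proof -
    have e: "v + s *s v = (1 + s) *s v" by (simp add: vec_eq_iff algebra_simps)
    show ?thesis unfolding e by (rule hom_poly_scale[OF assms])
  qed
  then show "((\<lambda>s. P (v + s *s v)) has_field_derivative of_nat d * P v) (at 0)"
    by (auto intro!: derivative_eq_intros)
qed

section \<open>Recognizing polynomials\<close>

text \<open>Interpolation at the nodes \<open>0, ..., m\<close>: the difference of both sides has
  degree at most \<open>m\<close> and \<open>m + 1\<close> roots.\<close>

lemma lagrange:
  fixes p :: "complex poly"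
  assumes "degree p \<le> m"
  shows "poly p t = (\<Sum>s\<le>m. poly p (of_nat s) * (\<Prod>r\<in>{..m} - {s}. (t - of_nat r) / (of_nat s - of_nat r)))"
proof -
  define L where "L s = (\<Prod>r\<in>{..m} - {s}. smult (1 / (of_nat s - of_nat r)) [:- of_nat r, 1 :: complex:])" for s
  have Lp: "poly (L s) t = (\<Prod>r\<in>{..m} - {s}. (t - of_nat r) / (of_nat s - of_nat r))" for s t
    by (simp add: L_def poly_prod diff_divide_distrib)
  have degL: "degree (L s) \<le> m" if "s \<le> m" for s
  proof -
    have "degree (L s) \<le> (\<Sum>r\<in>{..m} - {s}. degree (smult (1 / (of_nat s - of_nat r)) [:- of_nat r, 1 :: complex:]))"
      unfolding L_def by (rule degree_prod_sum_le[unfolded o_def]) simp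
    also have "\<dots> \<le> (\<Sum>r\<in>{..m} - {s}. 1)"
      by (intro sum_mono order_trans[OF degree_smult_le]) simp
    also have "\<dots> = m" using that by simp
    finally show ?thesis .
  qed
  define q where "q = p - (\<Sum>s\<le>m. smult (poly p (of_nat s)) (L s))"
  have dq: "degree q \<le> m" unfolding q_def
    using assms degL by (intro degree_diff_le degree_sum_le) (auto intro: order_trans[OF degree_smult_le])
  have "poly q (of_nat k) = 0" if "k \<le> m" for k
  proof -
    have Lk: "poly (L s) (of_nat k) = (if s = k then 1 else 0)" if "s \<le> m" for s
    proof (cases "s = k")
      case True
      then show ?thesis unfolding Lp by (auto intro!: prod.neutral)
    next
      case False
      then show ?thesis unfolding Lp using \<open>k \<le> m\<close> by (auto intro!: prod_zero)
    qed
    have "(\<Sum>s\<le>m. poly p (of_nat s) * poly (L s) (of_nat k)) = (\<Sum>s\<le>m. if s = k then poly p (of_nat s) else 0)"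
      by (rule sum.cong) (auto simp: Lk)
    then show ?thesis using that by (simp add: q_def poly_sum)
  qed
  then have sub: "of_nat ` {..m} \<subseteq> {x. poly q x = 0}" by auto
  have card: "card (of_nat ` {..m} :: complex set) = Suc m" by (subst card_image) (auto simp: inj_on_def)
  have "q = 0"
  proof (rule ccontr)
    assume q: "q \<noteq> 0"
    have "Suc m \<le> card {x. poly q x = 0}" using card_mono[OF poly_roots_finite[OF q] sub] card by simp
    then show False using dq card_poly_roots_bound[OF q] by simp
  qed
  then have "poly p t = poly (\<Sum>s\<le>m. smult (poly p (of_nat s)) (L s)) t" by (simp add: q_def)
  then show ?thesis by (simp add: poly_sum Lp)
qed

text \<open>Coordinates are freed one at a time. Interpolation in the new coordinate at the fixed
  nodes \<open>0, ..., m\<close> has coefficients that are polynomial in the other coordinates by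
  induction; the nodes can be fixed because the bound \<open>m\<close> is the same on all
  lines.\<close>

lemma separately_polynomial:
  fixes G :: "complex ^ 'n::finite \<Rightarrow> complex"
  assumes sep: "\<And>v j. \<exists>p. degree p \<le> m \<and> (\<forall>t. G (\<chi> i. if i = j then t else v $ i) = poly p t)"
  shows "G \<in> polyf"
proof -
  have "(\<lambda>v. G (\<chi> i. if i \<in> J then v $ i else a $ i)) \<in> polyf" if "finite J" for J a
    using that
  proof (induction J arbitrary: a)
    case empty
    then show ?case by (simp add: alg.const)
  next
    case (insert j J)
    define b where "b s = (\<chi> i. if i = j then of_nat s else a $ i)" for s :: nat
    have "G (\<chi> i. if i \<in> insert j J then v $ i else a $ i) =
      (\<Sum>s\<le>m. G (\<chi> i. if i \<in> J then v $ i else b s $ i) * (\<Prod>r\<in>{..m} - {s}. (v $ j - of_nat r) / (of_nat s - of_nat r)))" for v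
    proof -
      define w where "w = (\<chi> i. if i \<in> J then v $ i else a $ i)"
      obtain p where p: "degree p \<le> m" "\<And>t. G (\<chi> i. if i = j then t else w $ i) = poly p t"
        using sep[of j w] by blast
      have e1: "(\<chi> i. if i \<in> insert j J then v $ i else a $ i) = (\<chi> i. if i = j then v $ j else w $ i)"
        by (auto simp: vec_eq_iff w_def)
      have e2: "(\<chi> i. if i \<in> J then v $ i else b s $ i) = (\<chi> i. if i = j then of_nat s else w $ i)" for s
        using insert.hyps by (auto simp: vec_eq_iff b_def w_def)
      show ?thesis unfolding e1 e2 p(2) by (rule lagrange[OF p(1)])
    qed
    moreover have "(\<lambda>v. \<Sum>s\<le>m. G (\<chi> i. if i \<in> J then v $ i else b s $ i) * (\<Prod>r\<in>{..m} - {s}. (v $ j - of_nat r) / (of_nat s - of_nat r))) \<in> polyf"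
      unfolding divide_inverse
      by (intro alg_sum alg.mult alg_prod alg_diff polyf_coord alg.const insert.IH) simp_all
    ultimately show ?case by simp
  qed
  from this[of UNIV undefined] show ?thesis by simp
qed

lemma countable_complement_dense:
  assumes "countable T" shows "closure (- T) = (UNIV :: complex set)"
proof -
  have "x \<in> closure (- T)" for x
    unfolding closure_approachable
  proof (intro allI impI)
    fix e :: real assume "e > 0"
    then have "uncountable (ball x e)" by (rule uncountable_ball)
    then have "\<not> ball x e \<subseteq> T" using assms countable_subset by blast
    then show "\<exists>y\<in>- T. dist y x < e" by (auto simp: dist_commute)
  qed
  then show ?thesis by blast
qed

text \<open>By density and continuity a zero of the denominator is a zero of the numerator, and the
  common factor cancels; induction on the degree of \<open>q\<close>.\<close>

lemma continuous_rational_polynomial: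
  fixes G :: "complex \<Rightarrow> complex"
  assumes G: "continuous_on UNIV G" and T: "countable T" and q: "q \<noteq> 0"
    and eq: "\<And>t. t \<notin> T \<Longrightarrow> G t * poly q t = poly p t"
  shows "\<exists>p. \<forall>t. G t = poly p t"
proof -
  \<comment> \<open>Generalized over \<open>q\<close>, \<open>p\<close> and \<open>T\<close>, since
    all three change in the induction.\<close>
  have all: "G t * poly q t = poly p t" if "\<And>t. t \<notin> T \<Longrightarrow> G t * poly q t = poly p t" "countable T" for q p T t
  proof -
    have "closed {t. G t * poly q t = poly p t}"
      by (intro closed_Collect_eq continuous_intros G) 
    then have "closure (- T) \<subseteq> {t. G t * poly q t = poly p t}" using that by (intro closure_minimal) auto
    then show ?thesis using countable_complement_dense[OF that(2)] by blast
  qed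
  show ?thesis using q eq T
  proof (induction "degree q" arbitrary: p q T)
    case 0
    then obtain c where "q = [:c:]" "c \<noteq> 0" by (metis degree_eq_zeroE pCons_0_0)
    then have "G t = poly (smult (inverse c) p) t" for t using all[OF 0(3,4), of t] by (simp add: field_simps)
    then show ?case by blast
  next
    case (Suc n)
    obtain a where a: "poly q a = 0" using Suc.hyps(2) by (metis fundamental_theorem_of_algebra constant_degree nat.distinct(1))
    then have "poly p a = 0" using all[OF Suc.prems(2,3), of a] by simp
    then obtain p' where p': "p = [:-a, 1:] * p'" unfolding poly_eq_0_iff_dvd by (rule dvdE)
    obtain q' where q': "q = [:-a, 1:] * q'" using a unfolding poly_eq_0_iff_dvd by (rule dvdE)
    have "q' \<noteq> 0" using q' Suc.prems(1) by auto
    then have n: "n = degree q'" using q' Suc.hyps(2) by (simp add: degree_mult_eq del: mult_pCons_left)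
    \<comment> \<open>Dividing by \<open>t - a\<close> loses the equation at \<open>a\<close>, which
      therefore joins the exceptional set.\<close>
    have eq: "G t * poly q' t = poly p' t" if "t \<notin> insert a T" for t
    proof -
      have "(t - a) * (G t * poly q' t) = (t - a) * poly p' t"
        using Suc.prems(2)[of t] that by (simp add: p' q' algebra_simps)
      then show ?thesis using that by simp
    qed
    have "countable (insert a T)" using Suc.prems(3) by simp
    from Suc.hyps(1)[OF n \<open>q' \<noteq> 0\<close> eq this] show ?case by simp
  qed
qed

section \<open>Projective points and the Zariski topology\<close>

abbreviation cls :: "complex ^ 'i::finite \<Rightarrow> 'i point" where
  "cls v \<equiv> proj_class (*s) v"

lemma cls_mem: "v \<in> cls v"
  unfolding proj_class_def by (auto intro!: exI[of _ 1])

lemma cls_scale: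
  assumes c: "c \<noteq> 0"
  shows "cls (c *s v) = cls v"
proof
  show "cls (c *s v) \<subseteq> cls v"
  proof
    fix u assume "u \<in> cls (c *s v)"
    then obtain d where d: "d \<noteq> 0" "u = d *s (c *s v)" by (auto simp: proj_class_def)
    then have "u = (d * c) *s v" "d * c \<noteq> 0" using c by (auto simp: vec_eq_iff)
    then show "u \<in> cls v" unfolding proj_class_def by blast
  qed
  show "cls v \<subseteq> cls (c *s v)"
  proof
    fix u assume "u \<in> cls v"
    then obtain d where d: "d \<noteq> 0" "u = d *s v" by (auto simp: proj_class_def)
    then have "u = (d / c) *s (c *s v)" "d / c \<noteq> 0" using c by (auto simp: vec_eq_iff)
    then show "u \<in> cls (c *s v)" unfolding proj_class_def by blast
  qed
qed

lemma proj_point: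
  assumes "x \<in> proj_space" "v \<in> x"
  shows "x = cls v" "v \<noteq> 0"
proof -
  obtain u where u: "x = cls u" "u \<noteq> 0" using assms(1) by (auto simp: proj_space_def projectivization_def)
  then obtain c where c: "c \<noteq> 0" "v = c *s u" using assms(2) by (auto simp: proj_class_def)
  show "x = cls v" unfolding c(2) u(1) by (rule cls_scale[OF c(1), symmetric])
  show "v \<noteq> 0" using c u by (auto simp: vec_eq_iff)
qed

lemma proj_space_nonempty: "x \<in> proj_space \<Longrightarrow> \<exists>v. v \<in> x"
  using cls_mem by (auto simp: proj_space_def projectivization_def)

lemma cls_in_proj_space: "v \<noteq> 0 \<Longrightarrow> cls v \<in> proj_space"
  by (auto simp: proj_space_def projectivization_def)

lemma hom_poly_nonzero_class:
  assumes "hom_poly d P" "w \<in> cls v"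
  shows "P w \<noteq> 0 \<longleftrightarrow> P v \<noteq> 0"
  using assms hom_poly_scale[OF assms(1)] by (auto simp: proj_class_def)

definition basic_open :: "(complex ^ 'i::finite \<Rightarrow> complex) \<Rightarrow> 'i point set" where
  "basic_open P = {p \<in> proj_space. \<forall>v\<in>p. P v \<noteq> 0}"

text \<open>By homogeneity one representative of the point decides.\<close>

lemma basic_open_iff:
  assumes "hom_poly d P" "x \<in> proj_space" "v \<in> x"
  shows "x \<in> basic_open P \<longleftrightarrow> P v \<noteq> 0"
  using proj_point[OF assms(2,3)] hom_poly_nonzero_class[OF assms(1)] assms(2,3)
  unfolding basic_open_def by blast

lemma openin_basic_open: "hom_poly d P \<Longrightarrow> openin zariski (basic_open P)"
  unfolding zariski_def basic_open_def by (rule topology_generated_by_Basis) blast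

lemma basic_open_mult: "basic_open (\<lambda>v. P v * Q v) = basic_open P \<inter> basic_open Q"
  by (auto simp: basic_open_def)

lemma topspace_zariski: "topspace zariski = (proj_space :: 'i::finite point set)"
proof -
  have "basic_open (\<lambda>_ :: complex ^ 'i. 1) = proj_space" by (auto simp: basic_open_def)
  then have "proj_space \<subseteq> \<Union>{basic_open P | d (P :: complex ^ 'i \<Rightarrow> complex). hom_poly d P}"
    using hom_poly_const[of 1] by blast
  then show ?thesis unfolding zariski_def topology_generated_by_topspace by (auto simp: basic_open_def)
qed

text \<open>The generating open sets form a basis: an intersection of two of them is given by the
  product of the polynomials.\<close>

lemma zariski_basis:
  assumes "openin zariski U" "x \<in> U"
  shows "\<exists>d P. hom_poly d P \<and> x \<in> basic_open P \<and> basic_open P \<subseteq> U"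
proof -
  have "generate_topology_on {basic_open P | d P. hom_poly d P} U"
    using assms(1) unfolding zariski_def openin_topology_generated_by_iff basic_open_def .
  then show ?thesis using assms(2)
  proof (induction arbitrary: x rule: generate_topology_on.induct)
    case (Int a b)
    obtain d P e Q where "hom_poly d P" "x \<in> basic_open P" "basic_open P \<subseteq> a" "hom_poly e Q" "x \<in> basic_open Q" "basic_open Q \<subseteq> b"
      using Int.IH(1)[of x] Int.IH(2)[of x] Int.prems by blast
    then show ?case using hom_poly_mult[of d P e Q] basic_open_mult[of P Q]
      by (intro exI[of _ "d + e"] exI[of _ "\<lambda>v. P v * Q v"]) auto
  next
    case (UN K)
    then obtain k where "k \<in> K" "x \<in> k" by blast
    then show ?case using UN.IH[of k x] by blast
  qed blast+
qed

lemma zariski_of_basis: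
  assumes "openin (zariski_of X) U" "x \<in> U"
  shows "\<exists>d P. hom_poly d P \<and> x \<in> basic_open P \<and> X \<inter> basic_open P \<subseteq> U"
proof -
  obtain V where V: "openin zariski V" "U = V \<inter> X" using assms(1) by (auto simp: openin_subtopology)
  then show ?thesis using zariski_basis[of V x] assms(2) by blast
qed

lemma openin_basic_open_of: "hom_poly d P \<Longrightarrow> openin (zariski_of X) (X \<inter> basic_open P)"
  using openin_basic_open by (auto simp: openin_subtopology)

section \<open>Regular functions\<close>

text \<open>The quotient is valid at every point of \<open>X\<close> where \<open>Q\<close> does not
  vanish, so \<open>Q\<close> itself records the neighbourhood. The point enters only through a
  representative \<open>v\<close>.\<close>

definition fraction_rep ::
  "'i::finite point set \<Rightarrow> complex ^ 'i \<Rightarrow> ('i point \<Rightarrow> complex) \<Rightarrow> nat \<Rightarrow> (complex ^ 'i \<Rightarrow> complex) \<Rightarrow> (complex ^ 'i \<Rightarrow> complex) \<Rightarrow> bool" where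
  "fraction_rep X v h d P Q \<longleftrightarrow> hom_poly d P \<and> hom_poly d Q \<and> Q v \<noteq> 0 \<and>
     (\<forall>y\<in>X. \<forall>w\<in>y. Q w \<noteq> 0 \<longrightarrow> h y = P w / Q w)"

text \<open>Multiplying numerator and denominator by a polynomial whose nonvanishing set on
  \<open>X\<close> lies in the given neighbourhood turns that neighbourhood into a condition on the
  denominator.\<close>

lemma regular_at_iff:
  assumes X: "X \<subseteq> proj_space" and x: "x \<in> X" "v \<in> x"
  shows "regular_at X x h \<longleftrightarrow> (\<exists>d P Q. fraction_rep X v h d P Q)"
proof
  assume "regular_at X x h"
  then obtain U d P Q where U: "openin (zariski_of X) U" "x \<in> U" "hom_poly d P" "hom_poly d Q"
    "\<forall>y\<in>U. \<forall>v\<in>y. Q v \<noteq> 0 \<and> h y = P v / Q v" unfolding regular_at_def by blast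
  obtain e R where R: "hom_poly e R" "x \<in> basic_open R" "X \<inter> basic_open R \<subseteq> U" using zariski_of_basis[OF U(1,2)] by blast
  have "fraction_rep X v h (d + e) (\<lambda>v. P v * R v) (\<lambda>v. Q v * R v)"
    unfolding fraction_rep_def
  proof (intro conjI ballI impI)
    show "Q v * R v \<noteq> 0" using U(2,5) x R(2) by (auto simp: basic_open_def)
    fix y w assume y: "y \<in> X" "w \<in> y" "Q w * R w \<noteq> 0"
    then have "y \<in> basic_open R" using basic_open_iff[OF R(1), of y w] X by auto
    then show "h y = P w * R w / (Q w * R w)" using R(3) y U(5) by auto
  qed (intro hom_poly_mult U R)+
  then show "\<exists>d P Q. fraction_rep X v h d P Q" by blast
next
  assume "\<exists>d P Q. fraction_rep X v h d P Q"
  then obtain d P Q where r: "fraction_rep X v h d P Q" by blast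
  have "x \<in> basic_open Q" using basic_open_iff[of d Q x v] r X x by (auto simp: fraction_rep_def)
  then show "regular_at X x h"
    unfolding regular_at_def using r x openin_basic_open_of[of d Q X]
    by (intro exI[of _ "X \<inter> basic_open Q"] exI[of _ d] exI[of _ P] exI[of _ Q])
       (auto simp: fraction_rep_def basic_open_def)
qed

lemma same_germ_iff:
  assumes X: "X \<subseteq> proj_space" and x: "x \<in> X" "v \<in> x"
  shows "same_germ X x h h' \<longleftrightarrow> (\<exists>d R. hom_poly d R \<and> R v \<noteq> 0 \<and> (\<forall>y\<in>X. \<forall>w\<in>y. R w \<noteq> 0 \<longrightarrow> h y = h' y))"
proof
  assume "same_germ X x h h'"
  then obtain U where U: "openin (zariski_of X) U" "x \<in> U" "\<forall>y\<in>U. h y = h' y" unfolding same_germ_def by blast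
  obtain e R where R: "hom_poly e R" "x \<in> basic_open R" "X \<inter> basic_open R \<subseteq> U" using zariski_of_basis[OF U(1,2)] by blast
  have "h y = h' y" if "y \<in> X" "w \<in> y" "R w \<noteq> 0" for y w
    using basic_open_iff[OF R(1), of y w] X that R(3) U(3) by auto
  then show "\<exists>d R. hom_poly d R \<and> R v \<noteq> 0 \<and> (\<forall>y\<in>X. \<forall>w\<in>y. R w \<noteq> 0 \<longrightarrow> h y = h' y)"
    using R x by (intro exI[of _ e] exI[of _ R]) (auto simp: basic_open_def)
next
  assume "\<exists>d R. hom_poly d R \<and> R v \<noteq> 0 \<and> (\<forall>y\<in>X. \<forall>w\<in>y. R w \<noteq> 0 \<longrightarrow> h y = h' y)"
  then obtain d R where R: "hom_poly d R" "R v \<noteq> 0" "\<forall>y\<in>X. \<forall>w\<in>y. R w \<noteq> 0 \<longrightarrow> h y = h' y" by blast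
  have "x \<in> basic_open R" using basic_open_iff[of d R x v] R X x by auto
  moreover have "h y = h' y" if yR: "y \<in> X \<inter> basic_open R" for y
  proof -
    obtain w where "w \<in> y" using yR X proj_space_nonempty by blast
    then show ?thesis using yR R(3) by (auto simp: basic_open_def)
  qed
  ultimately show "same_germ X x h h'"
    unfolding same_germ_def using x openin_basic_open_of[OF R(1), of X] by (intro exI[of _ "X \<inter> basic_open R"]) auto
qed

lemma fraction_rep_add:
  assumes "fraction_rep X v h d P Q" "fraction_rep X v h' d' P' Q'"
  shows "fraction_rep X v (\<lambda>y. h y + h' y) (d + d') (\<lambda>u. P u * Q' u + Q u * P' u) (\<lambda>u. Q u * Q' u)"
proof -
  have "hom_poly (d + d') (\<lambda>u. P' u * Q u)"
    using hom_poly_mult[of d' P' d Q] assms by (simp add: fraction_rep_def add.commute)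
  then have "hom_poly (d + d') (\<lambda>u. P u * Q' u + Q u * P' u)"
    using hom_poly_mult[of d P d' Q'] assms by (intro hom_poly_add) (simp_all add: fraction_rep_def mult.commute)
  then show ?thesis using assms hom_poly_mult[of d Q d' Q'] unfolding fraction_rep_def
    by (auto simp: add_frac_eq mult.commute)
qed

lemma fraction_rep_mult:
  assumes "fraction_rep X v h d P Q" "fraction_rep X v h' d' P' Q'"
  shows "fraction_rep X v (\<lambda>y. h y * h' y) (d + d') (\<lambda>u. P u * P' u) (\<lambda>u. Q u * Q' u)"
  using assms unfolding fraction_rep_def by (auto intro!: hom_poly_mult)

lemma fraction_rep_cmult:
  assumes "fraction_rep X v h d P Q"
  shows "fraction_rep X v (\<lambda>y. c * h y) d (\<lambda>u. c * P u) Q"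
  using assms unfolding fraction_rep_def by (auto intro!: hom_poly_cmult)

lemma fraction_rep_const: "fraction_rep X v (\<lambda>_. c) 0 (\<lambda>_. c) (\<lambda>_. 1)"
  unfolding fraction_rep_def by (auto intro: hom_poly_const)

text \<open>An affine coordinate on the chart \<open>i0\<close>; as a ratio of degree 0 it does not
  depend on the representative.\<close>

definition coord_ratio :: "'i \<Rightarrow> 'i \<Rightarrow> 'i::finite point \<Rightarrow> complex" where
  "coord_ratio i0 i y = (SOME w. w \<in> y) $ i / (SOME w. w \<in> y) $ i0"

lemma coord_ratio:
  assumes "y \<in> proj_space" "w \<in> y"
  shows "coord_ratio i0 i y = w $ i / w $ i0"
proof -
  have "(SOME w. w \<in> y) \<in> y" using assms(2) by (rule someI)
  then obtain c where "c \<noteq> 0" "(SOME w. w \<in> y) = c *s w"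
    using proj_point(1)[OF assms] by (auto simp: proj_class_def)
  then show ?thesis by (simp add: coord_ratio_def)
qed

lemma fraction_rep_coord_ratio:
  assumes "X \<subseteq> proj_space" "v $ i0 \<noteq> 0"
  shows "fraction_rep X v (coord_ratio i0 i) 1 (\<lambda>u. u $ i) (\<lambda>u. u $ i0)"
  using assms unfolding fraction_rep_def by (auto intro: hom_poly_coord[unfolded One_nat_def] coord_ratio)

section \<open>Tangent vectors\<close>

text \<open>The quotient rule for \<open>P / Q\<close>, kept as a formula in \<open>P\<close> and
  \<open>Q\<close> so that it is visibly rational in point and direction.\<close>

definition qder :: "(complex ^ 'i::finite \<Rightarrow> complex) \<Rightarrow> (complex ^ 'i \<Rightarrow> complex) \<Rightarrow> complex ^ 'i \<Rightarrow> complex ^ 'i \<Rightarrow> complex" where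
  "qder P Q v w = (dder P v w * Q v - P v * dder Q v w) / (Q v)\<^sup>2"

text \<open>For \<open>v\<close> on the affine cone over \<open>X\<close>, the tangent space of that
  cone at \<open>v\<close>. It contains the line of \<open>v\<close> itself, which becomes 0 in the
  tangent space of \<open>X\<close>.\<close>

definition tancone :: "'i::finite point set \<Rightarrow> complex ^ 'i \<Rightarrow> (complex ^ 'i) set" where
  "tancone X v = {w. \<forall>d F. hom_poly d F \<and> (\<forall>u\<in>\<Union>X. F u = 0) \<longrightarrow> dder F v w = 0}"

text \<open>The tangent vector at the class of \<open>v\<close> obtained by moving \<open>v\<close> in the direction \<open>w\<close>.\<close>

definition der :: "'i::finite point set \<Rightarrow> complex ^ 'i \<Rightarrow> complex ^ 'i \<Rightarrow> 'i tangent" where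
  "der X v w h = (if regular_at X (cls v) h
     then THE z. \<exists>d P Q. fraction_rep X v h d P Q \<and> z = qder P Q v w else 0)"

text \<open>Clearing denominators, \<open>G\<close> times \<open>R Q Q'\<close> vanishes on the
  whole cone, so its derivative along \<open>w\<close> is 0. As \<open>G\<close> vanishes at
  \<open>v\<close> and the other factor does not, the derivative of \<open>G\<close> is 0, which is
  the equality of the two quotient rules.\<close>

lemma qder_germ:
  assumes r: "fraction_rep X v h d P Q" "fraction_rep X v h' d' P' Q'"
    and R: "hom_poly e R" "R v \<noteq> 0" "\<forall>y\<in>X. \<forall>w\<in>y. R w \<noteq> 0 \<longrightarrow> h y = h' y"
    and v: "v \<in> \<Union>X" and w: "w \<in> tancone X v"
  shows "qder P Q v w = qder P' Q' v w"
proof -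
  have h: "hom_poly d P" "hom_poly d Q" "hom_poly d' P'" "hom_poly d' Q'" and nz: "Q v \<noteq> 0" "Q' v \<noteq> 0"
    using r by (auto simp: fraction_rep_def)
  note pf = h[THEN hom_poly_polyf] R(1)[THEN hom_poly_polyf]
  define G where "G = (\<lambda>u. P u * Q' u - P' u * Q u)"
  have "hom_poly (d + d') (\<lambda>u. P' u * Q u)" using hom_poly_mult[OF h(3,2)] by (simp add: add.commute)
  then have hG: "hom_poly (d + d') G" unfolding G_def by (intro hom_poly_diff hom_poly_mult[OF h(1,4)])
  have van: "R u * (Q u * Q' u) * G u = 0" if u: "u \<in> \<Union>X" for u
  proof (cases "R u = 0 \<or> Q u = 0 \<or> Q' u = 0")
    case False
    obtain y where y: "y \<in> X" "u \<in> y" using u by blast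
    have "P u / Q u = P' u / Q' u" using r R(3) y False unfolding fraction_rep_def by metis
    then show ?thesis using False by (simp add: G_def frac_eq_eq)
  qed auto
  have "hom_poly (e + (d + d') + (d + d')) (\<lambda>u. R u * (Q u * Q' u) * G u)"
    by (intro hom_poly_mult R h hG)
  then have "dder (\<lambda>u. R u * (Q u * Q' u) * G u) v w = 0" using w van unfolding tancone_def by blast
  moreover have "G v = 0" using van[OF v] nz R(2) by simp
  moreover have "dder (\<lambda>u. R u * (Q u * Q' u) * G u) v w
    = dder (\<lambda>u. R u * (Q u * Q' u)) v w * G v + R v * (Q v * Q' v) * dder G v w"
    by (rule dder_mult) (intro alg.mult pf hG[THEN hom_poly_polyf])+
  ultimately have dG: "dder G v w = 0" and G0: "P v * Q' v = P' v * Q v" using nz R(2) by (auto simp: G_def)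
  have "dder G v w = dder P v w * Q' v + P v * dder Q' v w - (dder P' v w * Q v + P' v * dder Q v w)"
    unfolding G_def using pf by (simp add: dder_diff dder_mult alg.mult)
  then have e: "dder P v w * Q' v + P v * dder Q' v w = dder P' v w * Q v + P' v * dder Q v w" using dG by simp
  have "(dder P v w * Q v - P v * dder Q v w) * (Q' v)\<^sup>2 = (dder P' v w * Q' v - P' v * dder Q' v w) * (Q v)\<^sup>2"
    using e G0 by algebra
  then show ?thesis using nz by (simp add: qder_def frac_eq_eq)
qed

lemma der_eq:
  assumes X: "X \<subseteq> proj_space" and v: "v \<in> \<Union>X" and w: "w \<in> tancone X v" and r: "fraction_rep X v h d P Q"
  shows "der X v w h = qder P Q v w"
proof -
  obtain x where x: "x \<in> X" "v \<in> x" using v by blast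
  then have xc: "x = cls v" using proj_point X by blast
  have "regular_at X (cls v) h" using regular_at_iff[OF X x] r xc by blast
  moreover have "(THE z. \<exists>d P Q. fraction_rep X v h d P Q \<and> z = qder P Q v w) = qder P Q v w"
  proof (rule the_equality)
    fix z assume "\<exists>d P Q. fraction_rep X v h d P Q \<and> z = qder P Q v w"
    then obtain d' P' Q' where "fraction_rep X v h d' P' Q'" "z = qder P' Q' v w" by blast
    then show "z = qder P Q v w" using qder_germ[OF _ r hom_poly_const[of 1] _ _ v w] by simp
  qed (use r in blast)
  ultimately show ?thesis by (simp add: der_def)
qed

lemma der_not_regular: "\<not> regular_at X (cls v) h \<Longrightarrow> der X v w h = 0"
  by (simp add: der_def)

lemma der_in_tangent_space:
  assumes X: "X \<subseteq> proj_space" and v: "v \<in> \<Union>X" and w: "w \<in> tancone X v"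
  shows "der X v w \<in> tangent_space X (cls v)"
proof -
  obtain x where x: "x \<in> X" "v \<in> x" using v by blast
  then have xc: "x = cls v" using proj_point X by blast
  note reg = regular_at_iff[OF X x, unfolded xc]
  note de = der_eq[OF X v w]
  have hx: "h (cls v) = P v / Q v" if "fraction_rep X v h d P Q" for h d P Q
    using that x xc by (auto simp: fraction_rep_def)
  show ?thesis
    unfolding tangent_space_def
  proof (intro CollectI conjI allI impI)
    fix h assume "\<not> regular_at X (cls v) h"
    then show "der X v w h = 0" by (rule der_not_regular)
  next
    fix h h' assume "regular_at X (cls v) h \<and> regular_at X (cls v) h'"
    then obtain d P Q d' P' Q' where r: "fraction_rep X v h d P Q" "fraction_rep X v h' d' P' Q'" using reg by blast
    have nz: "Q v \<noteq> 0" "Q' v \<noteq> 0" using r by (auto simp: fraction_rep_def)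
    have pf: "P \<in> polyf" "Q \<in> polyf" "P' \<in> polyf" "Q' \<in> polyf"
      using r by (auto simp: fraction_rep_def intro: hom_poly_polyf)
    show "der X v w h = der X v w h'" if g: "same_germ X (cls v) h h'"
    proof -
      obtain e R where "hom_poly e R" "R v \<noteq> 0" "\<forall>y\<in>X. \<forall>w\<in>y. R w \<noteq> 0 \<longrightarrow> h y = h' y"
        using g same_germ_iff[OF X x] xc by blast
      then show ?thesis using qder_germ[OF r _ _ _ v w] de[OF r(1)] de[OF r(2)] by simp
    qed
    show "der X v w (\<lambda>y. h y + h' y) = der X v w h + der X v w h'"
      unfolding de[OF fraction_rep_add[OF r]] de[OF r(1)] de[OF r(2)] using pf nz
      by (simp add: qder_def dder_add dder_mult alg.mult alg.add power2_eq_square divide_simps) (simp add: algebra_simps)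
    show "der X v w (\<lambda>y. h y * h' y) = h (cls v) * der X v w h' + h' (cls v) * der X v w h"
      unfolding de[OF fraction_rep_mult[OF r]] de[OF r(1)] de[OF r(2)] hx[OF r(1)] hx[OF r(2)] using pf nz
      by (simp add: qder_def dder_mult alg.mult power2_eq_square divide_simps) (simp add: algebra_simps)
  next
    fix c h assume "regular_at X (cls v) h"
    then obtain d P Q where r: "fraction_rep X v h d P Q" using reg by blast
    then have pf: "P \<in> polyf" by (auto simp: fraction_rep_def intro: hom_poly_polyf)
    show "der X v w (\<lambda>y. c * h y) = c * der X v w h"
      unfolding de[OF fraction_rep_cmult[OF r]] de[OF r] using pf
      by (simp add: qder_def dder_cmult algebra_simps)
  qed
qed

text \<open>A derivation is determined by its values on the affine coordinates
  \<open>coord_ratio i0 i\<close>. These values form a vector \<open>\<omega>\<close>, and scaling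
  it back to the representative \<open>v\<close> gives the direction \<open>w\<close>.\<close>

lemma tangent_space_der:
  assumes X: "X \<subseteq> proj_space" and v: "v \<in> \<Union>X" and D: "D \<in> tangent_space X (cls v)"
  shows "\<exists>w\<in>tancone X v. D = der X v w"
proof -
  obtain x where x: "x \<in> X" "v \<in> x" using v by blast
  then have xc: "x = cls v" and v0: "v \<noteq> 0" using proj_point X by blast+
  note reg = regular_at_iff[OF X x, unfolded xc]
  note sg = same_germ_iff[OF X x, unfolded xc]
  have Dn: "D h = 0" if "\<not> regular_at X (cls v) h" for h using D that by (simp add: tangent_space_def)
  have Dg: "D h = D h'" if "regular_at X (cls v) h" "regular_at X (cls v) h'" "same_germ X (cls v) h h'" for h h'
    using D that unfolding tangent_space_def by blast
  have Da: "D (\<lambda>y. h y + h' y) = D h + D h'" and Dm: "D (\<lambda>y. h y * h' y) = h (cls v) * D h' + h' (cls v) * D h"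
    if "regular_at X (cls v) h" "regular_at X (cls v) h'" for h h'
    using D that unfolding tangent_space_def by blast+
  have Dc: "D (\<lambda>y. c * h y) = c * D h" if "regular_at X (cls v) h" for h c
    using D that unfolding tangent_space_def by blast
  obtain i0 where i0: "v $ i0 \<noteq> 0" using v0 by (auto simp: vec_eq_iff)
  \<comment> \<open>\<open>u y\<close> represents \<open>y\<close> with \<open>i0\<close>-th
    coordinate 1, wherever that coordinate is nonzero.\<close>
  define u where "u y = (\<chi> i. coord_ratio i0 i y)" for y
  define \<omega> where "\<omega> = (\<chi> i. D (coord_ratio i0 i))"
  have rc: "regular_at X (cls v) (\<lambda>_. c)" for c using reg fraction_rep_const by blast
  have D0: "D (\<lambda>_. c) = 0" for c
  proof -
    have "D (\<lambda>y. 1 * 1) = 1 * D (\<lambda>_. 1) + 1 * D (\<lambda>_. 1)" using Dm[OF rc[of 1] rc[of 1]] .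
    then have "D (\<lambda>_. 1) = 0" by simp
    then show ?thesis using Dc[OF rc[of 1], of c] by simp
  qed
  \<comment> \<open>Chain rule for polynomials in the affine coordinates, from linearity and the
    Leibniz rule of \<open>D\<close>.\<close>
  have c1: "regular_at X (cls v) (\<lambda>y. P (u y)) \<and> D (\<lambda>y. P (u y)) = dder P (u (cls v)) \<omega>" if "P \<in> polyf" for P
    using that
  proof (induction rule: alg.induct)
    case (const c)
    then show ?case using rc D0 by (simp add: dder_const)
  next
    case (gen g)
    then obtain i where g: "g = (\<lambda>v. v $ i)" by blast
    have "regular_at X (cls v) (coord_ratio i0 i)" using reg fraction_rep_coord_ratio[OF X i0] by blast
    then show ?case unfolding g dder_coord by (simp add: u_def \<omega>_def)
  next
    case (add f g)
    obtain d P Q d' P' Q' where r: "fraction_rep X v (\<lambda>y. f (u y)) d P Q" "fraction_rep X v (\<lambda>y. g (u y)) d' P' Q'"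
      using add.IH reg by blast
    have "regular_at X (cls v) (\<lambda>y. f (u y) + g (u y))" using fraction_rep_add[OF r] reg by blast
    then show ?case using add Da[of "\<lambda>y. f (u y)" "\<lambda>y. g (u y)"] by (simp add: dder_add)
  next
    case (mult f g)
    obtain d P Q d' P' Q' where r: "fraction_rep X v (\<lambda>y. f (u y)) d P Q" "fraction_rep X v (\<lambda>y. g (u y)) d' P' Q'"
      using mult.IH reg by blast
    have "regular_at X (cls v) (\<lambda>y. f (u y) * g (u y))" using fraction_rep_mult[OF r] reg by blast
    then show ?case using mult Dm[of "\<lambda>y. f (u y)" "\<lambda>y. g (u y)"] by (simp add: dder_mult mult.commute)
  qed
  define w where "w = v $ i0 *s \<omega>"
  have uy: "w = w $ i0 *s u y" if "y \<in> X" "w \<in> y" "w $ i0 \<noteq> 0" for y w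
    using coord_ratio[of y w i0] that X by (auto simp: u_def vec_eq_iff)
  have uv: "v = v $ i0 *s u (cls v)" using uy x xc i0 by blast
  have Pu: "P w = (w $ i0) ^ d * P (u y)" if "hom_poly d P" "y \<in> X" "w \<in> y" "w $ i0 \<noteq> 0" for P d w y
    using hom_poly_scale[OF that(1), of "w $ i0" "u y"] uy[OF that(2-4)] by simp
  have dPu: "dder P v w = (v $ i0) ^ d * dder P (u (cls v)) \<omega>" if "hom_poly d P" for P d
    using dder_scale[OF that, of "v $ i0" "u (cls v)" \<omega>] uv unfolding w_def by simp
  have wt: "w \<in> tancone X v"
    unfolding tancone_def
  proof (intro CollectI allI impI)
    fix d F assume F: "hom_poly d F \<and> (\<forall>u\<in>\<Union>X. F u = 0)"
    \<comment> \<open>An equation of \<open>X\<close> is the zero germ in affine coordinates, so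
      \<open>D\<close> kills it and \<open>w\<close> is tangent to the cone.\<close>
    have "same_germ X (cls v) (\<lambda>y. F (u y)) (\<lambda>_. 0)"
      unfolding sg
    proof (intro exI conjI ballI impI)
      show "hom_poly 1 (\<lambda>u. u $ i0)" by (rule hom_poly_coord)
      show "v $ i0 \<noteq> 0" by (rule i0)
      fix y w assume y: "y \<in> X" "w \<in> y" "w $ i0 \<noteq> 0"
      then have "F w = 0" using F by blast
      then show "F (u y) = 0" using Pu[OF conjunct1[OF F] y] y(3) by simp
    qed
    then have "D (\<lambda>y. F (u y)) = D (\<lambda>_. 0)" using Dg c1[OF hom_poly_polyf] F rc by blast
    then show "dder F v w = 0" using dPu[OF conjunct1[OF F]] D0 c1[OF hom_poly_polyf[OF conjunct1[OF F]]] by simp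
  qed
  have "D h = der X v w h" for h
  proof (cases "regular_at X (cls v) h")
    case False
    then show ?thesis using Dn der_not_regular by metis
  next
    case True
    then obtain d P Q where r: "fraction_rep X v h d P Q" using reg by blast
    have h: "hom_poly d P" "hom_poly d Q" and nz: "Q v \<noteq> 0" and hx: "h (cls v) = P v / Q v"
      using r x xc by (auto simp: fraction_rep_def)
    note cP = c1[OF h(1)[THEN hom_poly_polyf]] and cQ = c1[OF h(2)[THEN hom_poly_polyf]]
    have rhQ: "regular_at X (cls v) (\<lambda>y. h y * Q (u y))"
    proof -
      obtain d' P' Q' where "fraction_rep X v (\<lambda>y. Q (u y)) d' P' Q'" using cQ reg by blast
      then show ?thesis using fraction_rep_mult[OF r] reg by blast
    qed
    \<comment> \<open>The Leibniz rule applied to \<open>h Q = P\<close> yields the quotient rule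
      for \<open>D h\<close>.\<close>
    have "same_germ X (cls v) (\<lambda>y. h y * Q (u y)) (\<lambda>y. P (u y))"
      unfolding sg
    proof (intro exI conjI ballI impI)
      show "hom_poly (d + 1) (\<lambda>u. Q u * u $ i0)" by (intro hom_poly_mult h hom_poly_coord)
      show "Q v * v $ i0 \<noteq> 0" using nz i0 by simp
      fix y w assume y: "y \<in> X" "w \<in> y" "Q w * w $ i0 \<noteq> 0"
      then have "h y = P w / Q w" using r by (auto simp: fraction_rep_def)
      then show "h y * Q (u y) = P (u y)" using Pu[OF h(1) y(1,2)] Pu[OF h(2) y(1,2)] y(3) by auto
    qed
    then have "D (\<lambda>y. h y * Q (u y)) = D (\<lambda>y. P (u y))" using Dg rhQ cP by blast
    then have e: "h (cls v) * dder Q (u (cls v)) \<omega> + Q (u (cls v)) * D h = dder P (u (cls v)) \<omega>"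
      using Dm[OF True, of "\<lambda>y. Q (u y)"] cP cQ by simp
    define l where "l = (v $ i0) ^ d"
    have l: "l \<noteq> 0" using i0 by (simp add: l_def)
    have dP: "dder P v w = l * dder P (u (cls v)) \<omega>" and dQ: "dder Q v w = l * dder Q (u (cls v)) \<omega>"
      using dPu h by (simp_all add: l_def)
    have Qv: "Q v = l * Q (u (cls v))" using Pu[OF h(2), of "cls v" v] x xc i0 by (simp add: l_def)
    have "l * (h (cls v) * dder Q (u (cls v)) \<omega> + Q (u (cls v)) * D h) = l * dder P (u (cls v)) \<omega>" using e by simp
    then have "h (cls v) * dder Q v w + Q v * D h = dder P v w" unfolding dP dQ Qv by (simp add: algebra_simps)
    then have "D h = qder P Q v w" using nz hx by (simp add: qder_def power2_eq_square divide_simps) (simp add: algebra_simps)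
    then show ?thesis using der_eq[OF X v wt r] by simp
  qed
  then show ?thesis using wt by blast
qed

section \<open>The tangent cone modulo its radial direction\<close>

lemma tanconeI:
  "(\<And>d F. hom_poly d F \<Longrightarrow> \<forall>u\<in>\<Union>X. F u = 0 \<Longrightarrow> dder F v w = 0) \<Longrightarrow> w \<in> tancone X v"
  unfolding tancone_def by blast

lemma tanconeD: "w \<in> tancone X v \<Longrightarrow> hom_poly d F \<Longrightarrow> \<forall>u\<in>\<Union>X. F u = 0 \<Longrightarrow> dder F v w = 0"
  unfolding tancone_def by blast

lemma tancone_add:
  assumes "w \<in> tancone X v" "w' \<in> tancone X v"
  shows "w + w' \<in> tancone X v"
proof (rule tanconeI)
  fix d F assume F: "hom_poly d F" "\<forall>u\<in>\<Union>X. F u = 0"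
  show "dder F v (w + w') = 0"
    unfolding dder_linear(1)[OF hom_poly_polyf[OF F(1)]] tanconeD[OF assms(1) F] tanconeD[OF assms(2) F] by simp
qed

lemma tancone_scale:
  assumes "w \<in> tancone X v"
  shows "c *s w \<in> tancone X v"
proof (rule tanconeI)
  fix d F assume F: "hom_poly d F" "\<forall>u\<in>\<Union>X. F u = 0"
  show "dder F v (c *s w) = 0"
    unfolding dder_linear(2)[OF hom_poly_polyf[OF F(1)]] tanconeD[OF assms F] by simp
qed

text \<open>By Euler's identity the derivative in the direction \<open>v\<close> is a multiple of
  the value at \<open>v\<close>.\<close>

lemma tancone_self: "v \<in> \<Union>X \<Longrightarrow> v \<in> tancone X v"
  by (rule tanconeI) (use dder_euler in fastforce)

lemma tancone_0: "0 \<in> tancone X v"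
proof (rule tanconeI)
  fix d F assume F: "hom_poly d F" "\<forall>u\<in>\<Union>X. F u = 0"
  show "dder F v 0 = 0" using dder_linear(2)[OF hom_poly_polyf[OF F(1)], of v 0 0] by simp
qed

lemma tancone_mono:
  assumes "X \<subseteq> Y"
  shows "tancone X v \<subseteq> tancone Y v"
proof (intro subsetI tanconeI)
  fix w d F assume w: "w \<in> tancone X v" "hom_poly d F" and F: "\<forall>u\<in>\<Union>Y. F u = 0"
  have "\<forall>u\<in>\<Union>X. F u = 0" using F assms by blast
  then show "dder F v w = 0" by (rule tanconeD[OF w])
qed

lemma tancone_rescale:
  assumes "w \<in> tancone X v"
  shows "c *s w \<in> tancone X (c *s v)"
proof (rule tanconeI)
  fix d F assume F: "hom_poly d F" "\<forall>u\<in>\<Union>X. F u = 0"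
  show "dder F (c *s v) (c *s w) = 0"
    unfolding dder_scale[OF F(1)] tanconeD[OF assms F] by simp
qed

lemma tancone_sum: "(\<And>i. i \<in> I \<Longrightarrow> w i \<in> tancone X v) \<Longrightarrow> (\<Sum>i\<in>I. w i) \<in> tancone X v"
  by (induction I rule: infinite_finite_induct) (auto intro: tancone_0 tancone_add)

lemma fraction_rep_polyf: "fraction_rep X v h d P Q \<Longrightarrow> P \<in> polyf \<and> Q \<in> polyf"
  by (auto simp: fraction_rep_def intro: hom_poly_polyf)

lemma der_eqI:
  assumes X: "X \<subseteq> proj_space" and v: "v \<in> \<Union>X"
    and eq: "\<And>h d P Q. fraction_rep X v h d P Q \<Longrightarrow> D h = E h"
    and D: "\<And>h. \<not> regular_at X (cls v) h \<Longrightarrow> D h = E h"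
  shows "D = E"
proof
  fix h
  obtain x where x: "x \<in> X" "v \<in> x" using v by blast
  then have "x = cls v" using proj_point X by blast
  then show "D h = E h" using regular_at_iff[OF X x, of h] eq D by blast
qed

lemma der_add:
  assumes X: "X \<subseteq> proj_space" and v: "v \<in> \<Union>X" and w: "w \<in> tancone X v" "w' \<in> tancone X v"
  shows "der X v (w + w') = der X v w + der X v w'"
proof (rule der_eqI[OF X v])
  fix h d P Q assume r: "fraction_rep X v h d P Q"
  show "der X v (w + w') h = (der X v w + der X v w') h"
    using der_eq[OF X v _ r] w tancone_add[OF w] fraction_rep_polyf[OF r]
    by (simp add: qder_def dder_linear add_divide_distrib[symmetric] algebra_simps)
qed (simp add: der_not_regular)

lemma der_scale:
  assumes X: "X \<subseteq> proj_space" and v: "v \<in> \<Union>X" and w: "w \<in> tancone X v"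
  shows "der X v (c *s w) = tangent_scale c (der X v w)"
proof (rule der_eqI[OF X v])
  fix h d P Q assume r: "fraction_rep X v h d P Q"
  show "der X v (c *s w) h = tangent_scale c (der X v w) h"
    using der_eq[OF X v _ r] w tancone_scale[OF w] fraction_rep_polyf[OF r]
    by (simp add: qder_def dder_linear tangent_scale_def algebra_simps)
qed (simp add: der_not_regular tangent_scale_def)

lemma qder_rescale:
  assumes h: "hom_poly d P" "hom_poly d Q" and c: "c \<noteq> 0"
  shows "qder P Q (c *s v) (c *s w) = qder P Q v w"
  using c by (simp add: qder_def dder_scale[OF h(1)] dder_scale[OF h(2)] hom_poly_scale[OF h(1)] hom_poly_scale[OF h(2)]
      power2_eq_square divide_simps)
     (simp add: algebra_simps)

lemma mem_Union_scale:
  assumes X: "X \<subseteq> proj_space" and v: "v \<in> \<Union>X" and c: "c \<noteq> 0"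
  shows "c *s v \<in> \<Union>X"
proof -
  obtain x where x: "x \<in> X" "v \<in> x" using v by blast
  then have "x = cls v" using proj_point X by blast
  then have "c *s v \<in> x" using c by (auto simp: proj_class_def)
  then show ?thesis using x by blast
qed

lemma mem_Union_cls: "X \<subseteq> proj_space \<Longrightarrow> v \<in> \<Union>X \<longleftrightarrow> cls v \<in> X"
proof
  assume "X \<subseteq> proj_space" "v \<in> \<Union>X"
  then obtain x where "x \<in> X" "v \<in> x" "x \<in> proj_space" by blast
  then show "cls v \<in> X" using proj_point(1)[of x v] by simp
qed (use cls_mem in blast)

lemma der_rescale:
  assumes X: "X \<subseteq> proj_space" and v: "v \<in> \<Union>X" and w: "w \<in> tancone X v" and c: "c \<noteq> 0"
  shows "der X (c *s v) (c *s w) = der X v w"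
proof (rule der_eqI[OF X v])
  fix h d P Q assume r: "fraction_rep X v h d P Q"
  then have h: "hom_poly d P" "hom_poly d Q" by (auto simp: fraction_rep_def)
  have r': "fraction_rep X (c *s v) h d P Q" using r c by (auto simp: fraction_rep_def hom_poly_scale)
  show "der X (c *s v) (c *s w) h = der X v w h"
    unfolding der_eq[OF X v w r] der_eq[OF X mem_Union_scale[OF X v c] tancone_rescale[OF w] r']
    by (rule qder_rescale[OF h c])
qed (simp add: der_def cls_scale[OF c])

text \<open>Numerator and denominator have the same degree, so Euler's identity makes the quotient
  rule vanish.\<close>

lemma der_self:
  assumes X: "X \<subseteq> proj_space" and v: "v \<in> \<Union>X"
  shows "der X v v = 0"
proof (rule der_eqI[OF X v])
  fix h d P Q assume r: "fraction_rep X v h d P Q"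
  then have h: "hom_poly d P" "hom_poly d Q" by (auto simp: fraction_rep_def)
  show "der X v v h = 0 h"
    unfolding der_eq[OF X v tancone_self[OF v] r] by (simp add: qder_def dder_euler[OF h(1)] dder_euler[OF h(2)])
qed (simp add: der_not_regular)

text \<open>Tested on the affine coordinates, whose derivatives determine \<open>w\<close> up to a
  multiple of \<open>v\<close>.\<close>

lemma der_eq_0:
  assumes X: "X \<subseteq> proj_space" and v: "v \<in> \<Union>X" and w: "w \<in> tancone X v" and z: "der X v w = 0"
  shows "\<exists>c. w = c *s v"
proof -
  have "v \<noteq> 0" using X v proj_point(2) by blast
  then obtain i0 where i0: "v $ i0 \<noteq> 0" by (auto simp: vec_eq_iff)
  have "qder (\<lambda>u. u $ i) (\<lambda>u. u $ i0) v w = 0" for i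
    using der_eq[OF X v w fraction_rep_coord_ratio[OF X i0, of i]] z by simp
  then have "\<forall>i. w $ i = (w $ i0 / v $ i0) * v $ i" using i0
    by (simp add: qder_def dder_coord field_simps)
  then have "w = (w $ i0 / v $ i0) *s v" unfolding vec_eq_iff vector_smult_component .
  then show ?thesis by blast
qed

text \<open>The tangent space of \<open>X\<close> is the tangent space of the cone modulo the radial
  line; this is how tangent vectors are compared below.\<close>

lemma der_eq_iff:
  assumes X: "X \<subseteq> proj_space" and v: "v \<in> \<Union>X" and w: "w \<in> tancone X v" "w' \<in> tancone X v"
  shows "der X v w = der X v w' \<longleftrightarrow> (\<exists>c. w = w' + c *s v)"
proof
  assume e: "der X v w = der X v w'"
  have m: "- 1 *s w' \<in> tancone X v" by (rule tancone_scale[OF w(2)])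
  have "der X v (w + - 1 *s w') = der X v w + tangent_scale (- 1) (der X v w')"
    unfolding der_add[OF X v w(1) m] der_scale[OF X v w(2)] ..
  also have "\<dots> = 0" by (simp add: e tangent_scale_def fun_eq_iff)
  finally obtain c where "w + - 1 *s w' = c *s v" using der_eq_0[OF X v tancone_add[OF w(1) m]] by blast
  then have "w = w' + c *s v" by (simp add: vec_eq_iff algebra_simps)
  then show "\<exists>c. w = w' + c *s v" by blast
next
  assume "\<exists>c. w = w' + c *s v"
  then obtain c where c: "w = w' + c *s v" by blast
  show "der X v w = der X v w'"
    unfolding c der_add[OF X v w(2) tancone_scale[OF tancone_self[OF v]]] der_scale[OF X v tancone_self[OF v]] der_self[OF X v]
    by (simp add: tangent_scale_def fun_eq_iff)
qed

lemma qder_cancel: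
  assumes "P \<in> polyf" "Q \<in> polyf" "R \<in> polyf" "R v \<noteq> 0"
  shows "qder (\<lambda>u. P u * R u) (\<lambda>u. Q u * R u) v w = qder P Q v w"
proof (cases "Q v = 0")
  case False
  then show ?thesis using assms
    by (simp add: qder_def dder_mult power2_eq_square divide_simps) (simp add: algebra_simps)
qed (simp add: qder_def)

text \<open>Lets differentials of morphisms be computed as Jacobians of homogeneous lifts: composing
  a fraction with \<open>f\<close> and applying the chain rule gives the quotient rule at
  \<open>f v\<close>.\<close>

lemma differential_der:
  fixes F :: "'i::finite point \<Rightarrow> 'j::finite point" and f :: "complex ^ 'i \<Rightarrow> complex ^ 'j"
  assumes X: "X \<subseteq> proj_space" and Y: "Y \<subseteq> proj_space" and v: "v \<in> \<Union>X" and w: "w \<in> tancone X v"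
    and F: "\<And>y. y \<in> X \<Longrightarrow> F y \<in> Y"
    and f: "\<And>j. hom_poly e (\<lambda>u. f u $ j)" "f v \<noteq> 0" "\<And>y u. y \<in> X \<Longrightarrow> u \<in> y \<Longrightarrow> f u \<noteq> 0 \<Longrightarrow> F y = cls (f u)"
  shows "f v \<in> \<Union>Y" "dvec f v w \<in> tancone Y (f v)" "F (cls v) = cls (f v)"
    "regular_at Y (cls (f v)) h \<Longrightarrow> regular_at X (cls v) (h \<circ> F)"
    "differential Y F (cls v) (der X v w) = der Y (f v) (dvec f v w)"
proof -
  obtain x where x: "x \<in> X" "v \<in> x" using v by blast
  then have xc: "x = cls v" using proj_point X by blast
  show Fv: "F (cls v) = cls (f v)" using f(2,3) x xc by blast
  have fY: "f u \<in> \<Union>Y" if "u \<in> \<Union>X" "f u \<noteq> 0" for u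
    using that f(3) F cls_mem[of "f u"] by force
  show fv: "f v \<in> \<Union>Y" using fY v f(2) by blast
  note fp = f(1)[THEN hom_poly_polyf]
  show dt: "dvec f v w \<in> tancone Y (f v)"
  proof (rule tanconeI)
    fix d G assume G: "hom_poly d G" "\<forall>u\<in>\<Union>Y. G u = 0"
    have "G (f u) = 0" if uX: "u \<in> \<Union>X" for u
    proof (cases "f u = 0")
      \<comment> \<open>At a common zero of the lift, \<open>G\<close> is evaluated at the vertex;
        the value is 0 even for \<open>d = 0\<close>, because \<open>G\<close> vanishes at
        \<open>f v\<close>.\<close>
      case True
      then have "f u = 0 *s f v" by simp
      then have "G (f u) = 0 ^ d * G (f v)" using hom_poly_scale[OF G(1), of 0 "f v"] by simp
      then show ?thesis using bspec[OF G(2) fv] by simp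
    qed (rule bspec[OF G(2) fY[OF uX]])
    then have "\<forall>u\<in>\<Union>X. G (f u) = 0" by blast
    from tanconeD[OF w hom_poly_comp[OF G(1) f(1)] this]
    show "dder G (f v) (dvec f v w) = 0" unfolding dder_comp[OF hom_poly_polyf[OF G(1)] fp] .
  qed
  obtain j where j: "f v $ j \<noteq> 0" using f(2) by (auto simp: vec_eq_iff)
  \<comment> \<open>The factor \<open>f u $ j\<close> keeps the denominator away from the common
    zeros of \<open>f\<close>, where the lift says nothing about \<open>F\<close>.\<close>
  have rep: "fraction_rep X v (h \<circ> F) (e * d + e) (\<lambda>u. P (f u) * f u $ j) (\<lambda>u. Q (f u) * f u $ j)"
    if r: "fraction_rep Y (f v) h d P Q" for h d P Q
    unfolding fraction_rep_def
  proof (intro conjI ballI impI)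
    show "hom_poly (e * d + e) (\<lambda>u. P (f u) * f u $ j)" "hom_poly (e * d + e) (\<lambda>u. Q (f u) * f u $ j)"
      using r f(1) by (auto simp: fraction_rep_def intro!: hom_poly_mult hom_poly_comp)
    show "Q (f v) * f v $ j \<noteq> 0" using r j by (simp add: fraction_rep_def)
    fix y u assume y: "y \<in> X" "u \<in> y" "Q (f u) * f u $ j \<noteq> 0"
    then have "f u \<noteq> 0" by auto
    then have Fy: "F y = cls (f u)" by (rule f(3)[OF y(1,2)])
    have "F y \<in> Y" "f u \<in> F y" using F[OF y(1)] cls_mem[of "f u"] Fy by simp_all
    then have "h (F y) = P (f u) / Q (f u)" using r y(3) unfolding fraction_rep_def by auto
    then show "(h \<circ> F) y = P (f u) * f u $ j / (Q (f u) * f u $ j)" using y(3) by simp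
  qed
  note regX = regular_at_iff[OF X x, unfolded xc]
  obtain y where y: "y \<in> Y" "f v \<in> y" using fv by blast
  have yc: "y = cls (f v)" using proj_point(1) Y y by blast
  note regY = regular_at_iff[OF Y y, unfolded yc]
  show reg: "regular_at X (cls v) (h \<circ> F)" if "regular_at Y (cls (f v)) h" for h
    using that rep regX regY by blast
  show "differential Y F (cls v) (der X v w) = der Y (f v) (dvec f v w)"
  proof (rule der_eqI[OF Y fv])
    fix h d P Q assume r: "fraction_rep Y (f v) h d P Q"
    have PQ: "P \<in> polyf" "Q \<in> polyf" using fraction_rep_polyf[OF r] by auto
    have "differential Y F (cls v) (der X v w) h = der X v w (h \<circ> F)"
      using regY r by (auto simp: differential_def Fv)
    also have "\<dots> = qder (\<lambda>u. P (f u) * f u $ j) (\<lambda>u. Q (f u) * f u $ j) v w"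
      by (rule der_eq[OF X v w rep[OF r]])
    also have "\<dots> = qder (\<lambda>u. P (f u)) (\<lambda>u. Q (f u)) v w"
      by (rule qder_cancel[OF polyf_comp[OF PQ(1) fp] polyf_comp[OF PQ(2) fp] fp j])
    also have "\<dots> = qder P Q (f v) (dvec f v w)"
      unfolding qder_def dder_comp[OF PQ(1) fp] dder_comp[OF PQ(2) fp] ..
    also have "\<dots> = der Y (f v) (dvec f v w) h" using der_eq[OF Y fv dt r] by simp
    finally show "differential Y F (cls v) (der X v w) h = der Y (f v) (dvec f v w) h" .
  qed (simp add: differential_def Fv der_not_regular)
qed

lemma differential_inclusion:
  assumes XY: "X \<subseteq> Y" and Y: "Y \<subseteq> proj_space" and v: "v \<in> \<Union>X" and w: "w \<in> tancone X v"
  shows "differential Y (\<lambda>y. y) (cls v) (der X v w) = der Y v w"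
proof -
  have X: "X \<subseteq> proj_space" using XY Y by blast
  have v0: "v \<noteq> 0" using X v proj_point(2) by blast
  have "dvec (\<lambda>v. v) v w = w" by (simp add: dvec_def dder_coord vec_eq_iff)
  moreover have "differential Y (\<lambda>y. y) (cls v) (der X v w) = der Y v (dvec (\<lambda>v. v) v w)"
  proof (rule differential_der(5)[OF X Y v w, where f = "\<lambda>v. v" and e = 1])
    show "y = cls u" if "y \<in> X" "u \<in> y" for y u using that X proj_point(1) by blast
  qed (use XY v0 hom_poly_coord in auto)
  ultimately show ?thesis by simp
qed

lemma dder_sum:
  assumes "\<And>k. k \<in> I \<Longrightarrow> f k \<in> polyf" "finite I"
  shows "dder (\<lambda>u. \<Sum>k\<in>I. f k u) v w = (\<Sum>k\<in>I. dder (f k) v w)"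
  using assms(2,1) by (induction I rule: finite_induct) (simp_all add: dder_const dder_add alg_sum)

lemma bihom_poly_dder_alg:
  assumes P: "bihom_poly d e (P :: complex ^ 'i::finite \<Rightarrow> complex ^ 'j::finite \<Rightarrow> complex)"
    and f: "\<And>i. (\<lambda>s. f s $ i) \<in> alg UNIV Y" and g: "\<And>i. (\<lambda>s. g s $ i) \<in> alg UNIV Y" and h: "\<And>i. (\<lambda>s. h s $ i) \<in> alg UNIV Y"
  shows "(\<lambda>s. dder (P (f s)) (g s) (h s)) \<in> alg UNIV Y"
proof -
  obtain c where c: "P = (\<lambda>v w. \<Sum>k | sum k UNIV = d. \<Sum>l | sum l UNIV = e. c k l * monomial_at k v * monomial_at l w)"
    using P unfolding bihom_poly_def by blast
  have "dder (P v) w z = (\<Sum>k | sum k UNIV = d. \<Sum>l | sum l UNIV = e. c k l * monomial_at k v * dder (monomial_at l) w z)" for v w z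
    unfolding c
    by (simp add: dder_sum finite_exponents alg_sum alg.mult[OF alg.const] monomial_at_polyf dder_cmult)
  then show ?thesis
    by (simp, intro alg_sum alg.mult alg.const polyf_comp[OF monomial_at_polyf] dder_polyp_comp[OF monomial_at_polyf] f g h) simp_all
qed

lemma bihom_poly_dder:
  assumes "bihom_poly d e (P :: complex ^ 'i::finite \<Rightarrow> complex ^ 'j::finite \<Rightarrow> complex)"
  shows "(\<lambda>z. dder (P (fst z)) w (snd z)) \<in> polyp" "dder (P (c *s v)) w z = c ^ d * dder (P v) w z"
    "P v \<in> polyf" "hom_poly e (P v)" "hom_poly d (\<lambda>v. P v w)"
proof -
  show P: "P v \<in> polyf" for v
    using polyp_comp[OF bihom_poly_polyp[OF assms], where f = "\<lambda>_. v" and g = "\<lambda>w. w"] by (simp add: alg.const polyf_coord)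
  have "(\<lambda>v. P v w) \<in> polyf"
    using polyp_comp[OF bihom_poly_polyp[OF assms], where f = "\<lambda>w. w" and g = "\<lambda>_. w"] by (simp add: alg.const polyf_coord)
  then show "hom_poly d (\<lambda>v. P v w)"
    by (rule hom_polyI) (use bihom_poly_scale[OF assms, of _ _ 1 w] in simp)
  show "hom_poly e (P v)"
    by (rule hom_polyI[OF P]) (use bihom_poly_scale[OF assms, of 1 v] in simp)
  have "P (c *s v) = (\<lambda>u. c ^ d * P v u)" using bihom_poly_scale[OF assms, of c v 1] by (simp add: fun_eq_iff)
  then show "dder (P (c *s v)) w z = c ^ d * dder (P v) w z" by (simp add: dder_cmult P)
  show "(\<lambda>z. dder (P (fst z)) w (snd z)) \<in> polyp"
    by (rule bihom_poly_dder_alg[OF assms]) (simp_all add: polyp_fst polyp_snd alg.const)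
qed

section \<open>Invariant vector fields\<close>

locale abelian_coordinates =
  fixes A :: "'i::finite point monoid" and \<phi> :: "'i tangent \<Rightarrow> complex ^ 'n::finite"
  assumes abelian: "abelian_variety A"
    and coords: "linear_coordinates (tangent_space (carrier A) \<one>\<^bsub>A\<^esub>) \<phi>"
begin

abbreviation "C \<equiv> carrier A"

definition to_origin :: "'i point \<Rightarrow> 'i tangent \<Rightarrow> 'i tangent" where
  "to_origin x = differential C (\<lambda>y. inv\<^bsub>A\<^esub> x \<otimes>\<^bsub>A\<^esub> y) x"

definition from_origin :: "'i point \<Rightarrow> 'i tangent \<Rightarrow> 'i tangent" where
  "from_origin x = differential C (\<lambda>y. x \<otimes>\<^bsub>A\<^esub> y) \<one>\<^bsub>A\<^esub>"

lemma grp: "comm_group A" "group A" "monoid A"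
  using abelian by (auto simp: abelian_variety_def comm_group_def comm_monoid_def group_def)

lemma C_proj: "C \<subseteq> proj_space"
  using abelian closedin_subset topspace_zariski unfolding abelian_variety_def projective_variety_def by blast

lemma one_C: "\<one>\<^bsub>A\<^esub> \<in> C"
  using grp(3) by (rule monoid.one_closed)

lemma mult_C: "x \<in> C \<Longrightarrow> y \<in> C \<Longrightarrow> x \<otimes>\<^bsub>A\<^esub> y \<in> C"
  using grp(3) by (rule monoid.m_closed)

lemma inv_C: "x \<in> C \<Longrightarrow> inv\<^bsub>A\<^esub> x \<in> C"
  using grp(2) by (rule group.inv_closed)

lemma inv_mult_cancel: "x \<in> C \<Longrightarrow> y \<in> C \<Longrightarrow> inv\<^bsub>A\<^esub> x \<otimes>\<^bsub>A\<^esub> (x \<otimes>\<^bsub>A\<^esub> y) = y"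
  "x \<in> C \<Longrightarrow> y \<in> C \<Longrightarrow> x \<otimes>\<^bsub>A\<^esub> (inv\<^bsub>A\<^esub> x \<otimes>\<^bsub>A\<^esub> y) = y"
  "x \<in> C \<Longrightarrow> inv\<^bsub>A\<^esub> x \<otimes>\<^bsub>A\<^esub> x = \<one>\<^bsub>A\<^esub>" "x \<in> C \<Longrightarrow> x \<otimes>\<^bsub>A\<^esub> inv\<^bsub>A\<^esub> x = \<one>\<^bsub>A\<^esub>"
  "x \<in> C \<Longrightarrow> x \<otimes>\<^bsub>A\<^esub> \<one>\<^bsub>A\<^esub> = x"
  using grp(2) group.inv_closed monoid.one_closed[OF grp(3)]
  by (auto simp: group.inv_solve_left' monoid.m_assoc[OF grp(3), symmetric] group.l_inv group.r_inv monoid.l_one[OF grp(3)] monoid.r_one[OF grp(3)])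

lemma mult_chart:
  assumes "v \<in> \<Union>C" "w \<in> \<Union>C"
  shows "\<exists>d e f. (\<forall>j. bihom_poly d e (\<lambda>v w. f v w $ j)) \<and> f v w \<noteq> 0 \<and>
    (\<forall>v'\<in>\<Union>C. \<forall>w'\<in>\<Union>C. f v' w' \<noteq> (0 :: complex ^ 'i) \<longrightarrow> cls v' \<otimes>\<^bsub>A\<^esub> cls w' = cls (f v' w'))"
proof -
  obtain x y where x: "x \<in> C" "v \<in> x" "y \<in> C" "w \<in> y" using assms by blast
  have "morphism_prod_to_proj C C (\<lambda>x y. x \<otimes>\<^bsub>A\<^esub> y)" using abelian by (simp add: abelian_variety_def)
  from bspec[OF bspec[OF this[unfolded morphism_prod_to_proj_def] x(1)] x(3)]
  obtain d e f where f: "\<forall>j. bihom_poly d e (\<lambda>v w. f v w $ j)" "\<forall>v\<in>x. \<forall>w\<in>y. f v w \<noteq> 0"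
     "\<forall>x'\<in>C. \<forall>y'\<in>C. \<forall>v\<in>x'. \<forall>w\<in>y'. f v w \<noteq> (0 :: complex ^ 'i) \<longrightarrow> x' \<otimes>\<^bsub>A\<^esub> y' = cls (f v w)"
    by (elim exE conjE)
  have "cls v' \<otimes>\<^bsub>A\<^esub> cls w' = cls (f v' w')" if vw: "v' \<in> \<Union>C" "w' \<in> \<Union>C" "f v' w' \<noteq> 0" for v' w'
  proof -
    have c: "cls v' \<in> C" "cls w' \<in> C" using vw mem_Union_cls[OF C_proj] by simp_all
    show ?thesis using f(3)[rule_format, OF c cls_mem cls_mem vw(3)] .
  qed
  then show ?thesis using f(1) f(2)[rule_format, OF x(2) x(4)]
    by (intro exI[of _ d] exI[of _ e] exI[of _ f]) simp
qed

text \<open>With its first argument fixed, a bihomogeneous chart of the group law is a homogeneous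
  lift of a translation.\<close>

lemma translation_der:
  assumes v: "v \<in> \<Union>C" and w: "w \<in> \<Union>C" and z: "z \<in> tancone C w"
    and f: "\<forall>j. bihom_poly d e (\<lambda>v w. f v w $ j)" "f v w \<noteq> 0"
      "\<forall>v'\<in>\<Union>C. \<forall>w'\<in>\<Union>C. f v' w' \<noteq> (0 :: complex ^ 'i) \<longrightarrow> cls v' \<otimes>\<^bsub>A\<^esub> cls w' = cls (f v' w')"
  shows "f v w \<in> \<Union>C" "dvec (f v) w z \<in> tancone C (f v w)" "cls v \<otimes>\<^bsub>A\<^esub> cls w = cls (f v w)"
    "regular_at C (cls (f v w)) h \<Longrightarrow> regular_at C (cls w) (h \<circ> (\<lambda>y. cls v \<otimes>\<^bsub>A\<^esub> y))"
    "differential C (\<lambda>y. cls v \<otimes>\<^bsub>A\<^esub> y) (cls w) (der C w z) = der C (f v w) (dvec (f v) w z)"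
proof -
  have vC: "cls v \<in> C" using v mem_Union_cls[OF C_proj] by blast
  have F: "cls v \<otimes>\<^bsub>A\<^esub> y \<in> C" if "y \<in> C" for y using mult_C[OF vC that] .
  have h: "hom_poly e (\<lambda>u. f v u $ j)" for j using bihom_poly_dder(4)[OF spec[OF f(1)]] .
  have eq: "cls v \<otimes>\<^bsub>A\<^esub> y = cls (f v u)" if "y \<in> C" "u \<in> y" "f v u \<noteq> 0" for y u
  proof -
    have u: "u \<in> \<Union>C" using that by blast
    have y: "y = cls u" using that(1,2) proj_point(1)[of y u] C_proj by auto
    show ?thesis unfolding y by (rule f(3)[rule_format, OF v u that(3)])
  qed
  note D = differential_der[OF C_proj C_proj w z, where F = "\<lambda>y. cls v \<otimes>\<^bsub>A\<^esub> y" and f = "f v" and e = e, OF F h f(2) eq]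
  show "f v w \<in> \<Union>C" using D(1) .
  show "dvec (f v) w z \<in> tancone C (f v w)" using D(2) .
  show "cls v \<otimes>\<^bsub>A\<^esub> cls w = cls (f v w)" using D(3) .
  show "regular_at C (cls (f v w)) h \<Longrightarrow> regular_at C (cls w) (h \<circ> (\<lambda>y. cls v \<otimes>\<^bsub>A\<^esub> y))" using D(4) .
  show "differential C (\<lambda>y. cls v \<otimes>\<^bsub>A\<^esub> y) (cls w) (der C w z) = der C (f v w) (dvec (f v) w z)" using D(5) .
qed

lemma point_rep: "x \<in> C \<Longrightarrow> \<exists>v. v \<in> x \<and> v \<in> \<Union>C \<and> x = cls v"
  using C_proj proj_space_nonempty proj_point(1) by blast

lemma translation_tangent:
  assumes a: "a \<in> C" and y: "y \<in> C"
  shows "regular_at C (a \<otimes>\<^bsub>A\<^esub> y) h \<Longrightarrow> regular_at C y (h \<circ> (\<lambda>y. a \<otimes>\<^bsub>A\<^esub> y))"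
    "D \<in> tangent_space C y \<Longrightarrow> differential C (\<lambda>y. a \<otimes>\<^bsub>A\<^esub> y) y D \<in> tangent_space C (a \<otimes>\<^bsub>A\<^esub> y)"
proof -
  obtain v where v: "v \<in> \<Union>C" "a = cls v" using point_rep[OF a] by blast
  obtain w where w: "w \<in> \<Union>C" "y = cls w" using point_rep[OF y] by blast
  obtain d e f where f: "\<forall>j. bihom_poly d e (\<lambda>v w. f v w $ j)" "f v w \<noteq> 0"
    "\<forall>v'\<in>\<Union>C. \<forall>w'\<in>\<Union>C. f v' w' \<noteq> (0 :: complex ^ 'i) \<longrightarrow> cls v' \<otimes>\<^bsub>A\<^esub> cls w' = cls (f v' w')"
    using mult_chart[OF v(1) w(1)] by (elim exE conjE)
  note T = translation_der[OF v(1) w(1) _ f]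
  show "regular_at C (a \<otimes>\<^bsub>A\<^esub> y) h \<Longrightarrow> regular_at C y (h \<circ> (\<lambda>y. a \<otimes>\<^bsub>A\<^esub> y))"
    using T(3,4)[OF tancone_0] v(2) w(2) by simp
  assume "D \<in> tangent_space C y"
  then obtain z where z: "z \<in> tancone C w" "D = der C w z" using tangent_space_der[OF C_proj w(1)] w(2) by blast
  show "differential C (\<lambda>y. a \<otimes>\<^bsub>A\<^esub> y) y D \<in> tangent_space C (a \<otimes>\<^bsub>A\<^esub> y)"
    unfolding v(2) w(2) z(2) T(3)[OF z(1)] T(5)[OF z(1)]
    by (rule der_in_tangent_space[OF C_proj T(1,2)[OF z(1)]])
qed

lemma translation_inverse:
  assumes a: "a \<in> C" and b: "b \<in> C" and y: "y \<in> C" and ab: "\<And>z. z \<in> C \<Longrightarrow> b \<otimes>\<^bsub>A\<^esub> (a \<otimes>\<^bsub>A\<^esub> z) = z"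
    and D: "D \<in> tangent_space C y"
  shows "differential C (\<lambda>y. b \<otimes>\<^bsub>A\<^esub> y) (a \<otimes>\<^bsub>A\<^esub> y) (differential C (\<lambda>y. a \<otimes>\<^bsub>A\<^esub> y) y D) = D"
proof
  fix h :: "'i point \<Rightarrow> complex"
  let ?g = "(h \<circ> (\<lambda>y. b \<otimes>\<^bsub>A\<^esub> y)) \<circ> (\<lambda>y. a \<otimes>\<^bsub>A\<^esub> y)"
  show "differential C (\<lambda>y. b \<otimes>\<^bsub>A\<^esub> y) (a \<otimes>\<^bsub>A\<^esub> y) (differential C (\<lambda>y. a \<otimes>\<^bsub>A\<^esub> y) y D) h = D h"
  proof (cases "regular_at C y h")
    case False
    then have "D h = 0" using D by (simp add: tangent_space_def)
    then show ?thesis using False by (simp add: differential_def ab[OF y])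
  next
    case True
    have r1: "regular_at C (a \<otimes>\<^bsub>A\<^esub> y) (h \<circ> (\<lambda>y. b \<otimes>\<^bsub>A\<^esub> y))"
      by (rule translation_tangent(1)[OF b mult_C[OF a y]]) (simp add: ab[OF y] True)
    have r2: "regular_at C y ?g" by (rule translation_tangent(1)[OF a y r1])
    \<comment> \<open>The composite of the two translations is the identity on the variety only, so
      the functions are compared as germs there.\<close>
    have t: "openin (zariski_of C) C"
      using openin_topspace[of "zariski_of C"] C_proj by (simp add: topspace_zariski Int_absorb1)
    have "same_germ C y ?g h" unfolding same_germ_def using t y ab by (intro exI[of _ C]) auto
    then have "D ?g = D h" using D r2 True unfolding tangent_space_def by blast
    then show ?thesis using True r1 by (simp add: differential_def ab[OF y])
  qed
qed

lemma to_origin_tangent: "x \<in> C \<Longrightarrow> D \<in> tangent_space C x \<Longrightarrow> to_origin x D \<in> tangent_space C \<one>\<^bsub>A\<^esub>"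
  unfolding to_origin_def using translation_tangent(2)[OF inv_C, of x x D] inv_mult_cancel(3)[of x] by simp

lemma from_origin_tangent: "x \<in> C \<Longrightarrow> D \<in> tangent_space C \<one>\<^bsub>A\<^esub> \<Longrightarrow> from_origin x D \<in> tangent_space C x"
  unfolding from_origin_def using translation_tangent(2)[of x "\<one>\<^bsub>A\<^esub>" D] one_C inv_mult_cancel(5)[of x] by simp

lemma to_from_origin: "x \<in> C \<Longrightarrow> D \<in> tangent_space C \<one>\<^bsub>A\<^esub> \<Longrightarrow> to_origin x (from_origin x D) = D"
  unfolding to_origin_def from_origin_def
  using translation_inverse[of x "inv\<^bsub>A\<^esub> x" "\<one>\<^bsub>A\<^esub>" D] inv_C one_C inv_mult_cancel(1,5)[of x] by simp

lemma from_to_origin: "x \<in> C \<Longrightarrow> D \<in> tangent_space C x \<Longrightarrow> from_origin x (to_origin x D) = D"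
  unfolding to_origin_def from_origin_def
  using translation_inverse[of "inv\<^bsub>A\<^esub> x" x x D] inv_C inv_mult_cancel(2,3)[of x] by simp

definition origin :: "complex ^ 'i" where "origin = (SOME v. v \<in> \<one>\<^bsub>A\<^esub>)"

lemma origin: "origin \<in> \<Union>C" "cls origin = \<one>\<^bsub>A\<^esub>"
proof -
  obtain v where "v \<in> \<one>\<^bsub>A\<^esub>" using point_rep[OF one_C] by blast
  then have o: "origin \<in> \<one>\<^bsub>A\<^esub>" unfolding origin_def by (rule someI)
  then show "origin \<in> \<Union>C" using one_C by blast
  show "cls origin = \<one>\<^bsub>A\<^esub>" using proj_point(1)[of "\<one>\<^bsub>A\<^esub>" origin] o one_C C_proj by auto
qed

abbreviation "T0 \<equiv> tangent_space C \<one>\<^bsub>A\<^esub>"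

lemma phi_add: "D \<in> T0 \<Longrightarrow> E \<in> T0 \<Longrightarrow> \<phi> (D + E) = \<phi> D + \<phi> E"
  and phi_scale: "D \<in> T0 \<Longrightarrow> \<phi> (tangent_scale c D) = c *s \<phi> D"
  and phi_inj: "D \<in> T0 \<Longrightarrow> E \<in> T0 \<Longrightarrow> \<phi> D = \<phi> E \<Longrightarrow> D = E"
  and phi_surj: "\<exists>D\<in>T0. \<phi> D = v"
proof -
  show "D \<in> T0 \<Longrightarrow> E \<in> T0 \<Longrightarrow> \<phi> (D + E) = \<phi> D + \<phi> E" "D \<in> T0 \<Longrightarrow> \<phi> (tangent_scale c D) = c *s \<phi> D"
    using coords by (auto simp: linear_coordinates_def)
  have b: "bij_betw \<phi> T0 UNIV" using coords by (auto simp: linear_coordinates_def)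
  show "D \<in> T0 \<Longrightarrow> E \<in> T0 \<Longrightarrow> \<phi> D = \<phi> E \<Longrightarrow> D = E" using b by (auto simp: bij_betw_def inj_on_def)
  show "\<exists>D\<in>T0. \<phi> D = v" using b by (auto simp: bij_betw_def) (metis UNIV_I imageE)
qed

text \<open>Directions of the cone at \<open>origin\<close> over the coordinate basis, chosen once
  so that the section \<open>lift\<close> becomes linear.\<close>

definition basis_lift :: "'n \<Rightarrow> complex ^ 'i" where
  "basis_lift j = (SOME w. w \<in> tancone C origin \<and> \<phi> (der C origin w) = axis j 1)"

lemma basis_lift: "basis_lift j \<in> tancone C origin" "\<phi> (der C origin (basis_lift j)) = axis j 1"
proof -
  obtain D where D: "D \<in> T0" "\<phi> D = axis j 1" using phi_surj by blast
  then obtain w where "w \<in> tancone C origin" "D = der C origin w"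
    using tangent_space_der[OF C_proj origin(1)] origin(2) by auto
  then have "\<exists>w. w \<in> tancone C origin \<and> \<phi> (der C origin w) = axis j 1" using D by blast
  then have "basis_lift j \<in> tancone C origin \<and> \<phi> (der C origin (basis_lift j)) = axis j 1"
    unfolding basis_lift_def by (rule someI_ex)
  then show "basis_lift j \<in> tancone C origin" "\<phi> (der C origin (basis_lift j)) = axis j 1" by auto
qed

definition lift :: "complex ^ 'n \<Rightarrow> complex ^ 'i" where
  "lift v = (\<Sum>j\<in>UNIV. v $ j *s basis_lift j)"

lemma der_origin_T0: "w \<in> tancone C origin \<Longrightarrow> der C origin w \<in> T0"
  using der_in_tangent_space[OF C_proj origin(1)] origin(2) by simp

lemma lift: "lift v \<in> tancone C origin" "\<phi> (der C origin (lift v)) = v"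
proof -
  have t: "(\<Sum>j\<in>J. v $ j *s basis_lift j) \<in> tancone C origin" for J
    by (intro tancone_sum tancone_scale basis_lift)
  then show "lift v \<in> tancone C origin" by (simp add: lift_def)
  have p0: "\<phi> 0 = 0"
  proof -
    have z: "0 \<in> T0" using der_origin_T0[OF tancone_self[OF origin(1)]] der_self[OF C_proj origin(1)] by simp
    show ?thesis using phi_scale[OF z, of 0] by (simp add: tangent_scale_def zero_fun_def)
  qed
  have d0: "der C origin 0 = 0"
    using der_scale[OF C_proj origin(1) tancone_0, of 0] by (simp add: tangent_scale_def zero_fun_def)
  have "finite J \<Longrightarrow> \<phi> (der C origin (\<Sum>j\<in>J. v $ j *s basis_lift j)) = (\<Sum>j\<in>J. v $ j *s axis j 1)" for J
  proof (induction J rule: finite_induct)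
    case (insert j J)
    note b = basis_lift[of j]
    have e: "der C origin (v $ j *s basis_lift j + (\<Sum>j\<in>J. v $ j *s basis_lift j))
       = tangent_scale (v $ j) (der C origin (basis_lift j)) + der C origin (\<Sum>j\<in>J. v $ j *s basis_lift j)"
      unfolding der_add[OF C_proj origin(1) tancone_scale[OF b(1)] t] der_scale[OF C_proj origin(1) b(1)] ..
    have "tangent_scale (v $ j) (der C origin (basis_lift j)) \<in> T0"
      using der_origin_T0[OF tancone_scale[OF b(1)]] der_scale[OF C_proj origin(1) b(1)] by simp
    note phi_add[OF this der_origin_T0[OF t], of J]
    then have "\<phi> (der C origin (v $ j *s basis_lift j + (\<Sum>j\<in>J. v $ j *s basis_lift j)))
      = v $ j *s axis j 1 + (\<Sum>j\<in>J. v $ j *s axis j 1)"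
      unfolding e insert.IH phi_scale[OF der_origin_T0[OF b(1)]] b(2) .
    then show ?case using insert.hyps by simp
  qed (simp only: sum.empty p0 d0)
  then have "\<phi> (der C origin (lift v)) = (\<Sum>j\<in>UNIV. v $ j *s axis j 1)" by (simp add: lift_def)
  also have "\<dots> = v" by (rule basis_expansion)
  finally show "\<phi> (der C origin (lift v)) = v" .
qed

lemma lift_polyf: "(\<lambda>v. lift v $ i) \<in> polyf"
  unfolding lift_def by (simp add: sum_component) (intro alg_sum alg.mult polyf_coord alg.const, simp)

definition invariant_field :: "complex ^ 'n \<Rightarrow> 'i point \<Rightarrow> 'i tangent" where
  "invariant_field v x = from_origin x (der C origin (lift v))"

text \<open>Links the invariant fields with the trivialization behind the tangent map, because
  translations to and from the origin are inverse to each other.\<close>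

lemma invariant_field_iff:
  assumes x: "x \<in> C" and D: "D \<in> tangent_space C x"
  shows "D = invariant_field v x \<longleftrightarrow> \<phi> (to_origin x D) = v"
proof
  assume "D = invariant_field v x"
  then show "\<phi> (to_origin x D) = v"
    unfolding invariant_field_def using to_from_origin[OF x der_origin_T0[OF lift(1)]] lift(2) by simp
next
  assume "\<phi> (to_origin x D) = v"
  then have "to_origin x D = der C origin (lift v)"
    using phi_inj[OF to_origin_tangent[OF x D] der_origin_T0[OF lift(1)]] lift(2) by simp
  then show "D = invariant_field v x" unfolding invariant_field_def using from_to_origin[OF x D] by simp
qed

text \<open>Near a given point the invariant field is given by polynomials: at the class of \<open>u\<close> it is
  the tangent vector of \<open>\<mu> u\<close>, another representative of the same point, in the
  direction \<open>\<tau> u v\<close>.\<close>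

lemma invariant_field_chart:
  assumes x0: "x0 \<in> \<Union>C"
  shows "\<exists>d \<mu> \<tau>. (\<forall>j. hom_poly d (\<lambda>u. \<mu> u $ j)) \<and> (\<forall>j. (\<lambda>z. \<tau> (fst z) (snd z) $ j) \<in> polyp) \<and>
    (\<forall>c u v. \<tau> (c *s u) v = c ^ d *s \<tau> u v) \<and> \<mu> x0 \<noteq> 0 \<and>
    (\<forall>u\<in>\<Union>C. \<mu> u \<noteq> 0 \<longrightarrow> cls (\<mu> u) = cls u \<and> (\<forall>v. \<tau> u v \<in> tancone C (\<mu> u) \<and>
       invariant_field v (cls u) = der C (\<mu> u) (\<tau> u v)))"
proof -
  obtain d e f where f: "\<forall>j. bihom_poly d e (\<lambda>v w. f v w $ j)" "f x0 origin \<noteq> 0"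
    "\<forall>v'\<in>\<Union>C. \<forall>w'\<in>\<Union>C. f v' w' \<noteq> (0 :: complex ^ 'i) \<longrightarrow> cls v' \<otimes>\<^bsub>A\<^esub> cls w' = cls (f v' w')"
    using mult_chart[OF x0 origin(1)] by (elim exE conjE)
  \<comment> \<open>\<open>\<mu> u\<close> represents the product of \<open>cls u\<close> with the
    identity, that is \<open>cls u\<close> again; \<open>\<tau> u v\<close> is the derivative of the
    product in its second factor at the identity.\<close>
  define \<mu> where "\<mu> u = f u origin" for u
  define \<tau> where "\<tau> u v = dvec (f u) origin (lift v)" for u v
  have "hom_poly d (\<lambda>u. \<mu> u $ j)" for j unfolding \<mu>_def by (rule bihom_poly_dder(5)[OF spec[OF f(1)]])
  moreover have "(\<lambda>z. \<tau> (fst z) (snd z) $ j) \<in> polyp" for j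
  proof -
    have "(\<lambda>z. lift (snd z) $ i) \<in> polyp" for i
      by (rule polyf_comp[OF lift_polyf polyp_snd])
    from polyp_comp[OF bihom_poly_dder(1)[OF spec[OF f(1)]] polyp_fst this]
    show ?thesis unfolding \<tau>_def dvec_def by simp
  qed
  moreover have "\<tau> (c *s u) v = c ^ d *s \<tau> u v" for c u v
    unfolding \<tau>_def dvec_def vec_eq_iff using bihom_poly_dder(2)[OF spec[OF f(1)]] by simp
  moreover have "cls (\<mu> u) = cls u \<and> (\<forall>v. \<tau> u v \<in> tancone C (\<mu> u) \<and> invariant_field v (cls u) = der C (\<mu> u) (\<tau> u v))"
    if u: "u \<in> \<Union>C" "\<mu> u \<noteq> 0" for u
  proof -
    note T = translation_der[OF u(1) origin(1) _ f(1) u(2)[unfolded \<mu>_def] f(3)]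
    have uC: "cls u \<in> C" using u mem_Union_cls[OF C_proj] by blast
    have "cls (\<mu> u) = cls u"
      using T(3)[OF tancone_0] inv_mult_cancel(5)[OF uC] by (simp add: origin(2) \<mu>_def)
    moreover have "\<tau> u v \<in> tancone C (\<mu> u)" for v unfolding \<tau>_def \<mu>_def by (rule T(2)[OF lift(1)])
    moreover have "invariant_field v (cls u) = der C (\<mu> u) (\<tau> u v)" for v
      unfolding invariant_field_def from_origin_def \<tau>_def \<mu>_def using T(5)[OF lift(1)] by (simp add: origin(2))
    ultimately show ?thesis by blast
  qed
  moreover have "\<mu> x0 \<noteq> 0" using f(2) by (simp add: \<mu>_def)
  ultimately show ?thesis by (intro exI[of _ d] exI[of _ \<mu>] exI[of _ \<tau>]) simp
qed

end

section \<open>Regular functions on closed sets\<close>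

definition vanishing :: "'i::finite point set \<Rightarrow> (complex ^ 'i \<Rightarrow> complex) set" where
  "vanishing X = {F. (\<exists>d. hom_poly d F) \<and> (\<forall>u\<in>\<Union>X. F u = 0)}"

text \<open>A point off \<open>X\<close> has a basic neighbourhood missing \<open>X\<close>, and the
  polynomial of that neighbourhood vanishes on \<open>X\<close> but not at the point.\<close>

lemma closed_cone:
  assumes X: "closedin zariski X" and v: "v \<noteq> 0" and F: "\<And>F. F \<in> vanishing X \<Longrightarrow> F v = 0"
  shows "v \<in> \<Union>X"
proof (rule ccontr)
  assume nv: "v \<notin> \<Union>X"
  have XP: "X \<subseteq> proj_space" using X closedin_subset topspace_zariski by blast
  have "openin zariski (proj_space - X)" using X by (simp add: closedin_def topspace_zariski)
  moreover have "cls v \<in> proj_space - X" using nv mem_Union_cls[OF XP] cls_in_proj_space[OF v] by blast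
  ultimately obtain d P where P: "hom_poly d P" "cls v \<in> basic_open P" "basic_open P \<subseteq> proj_space - X"
    using zariski_basis by blast
  have "P u = 0" if u: "u \<in> \<Union>X" for u
  proof -
    obtain y where y: "y \<in> X" "u \<in> y" using u by blast
    then have "y \<in> proj_space" "y \<notin> basic_open P" using XP P(3) by blast+
    then show ?thesis using basic_open_iff[OF P(1) _ y(2)] by blast
  qed
  then have "P \<in> vanishing X" using P(1) unfolding vanishing_def by blast
  then have "P v = 0" by (rule F)
  then show False using P(2) cls_mem by (auto simp: basic_open_def)
qed

text \<open>The Lindelof property of the classical topology: the nonvanishing sets of the equations
  are open, and countably many of them have the same union.\<close>

lemma countable_equations:
  fixes \<F> :: "('a::second_countable_topology \<Rightarrow> complex) set"
  assumes "\<And>F. F \<in> \<F> \<Longrightarrow> continuous_on UNIV F"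
  shows "\<exists>\<G>. countable \<G> \<and> \<G> \<subseteq> \<F> \<and> (\<forall>z. (\<forall>F\<in>\<G>. F z = 0) \<longleftrightarrow> (\<forall>F\<in>\<F>. F z = 0))"
proof -
  define S where "S F = {z. F z \<noteq> 0}" for F :: "'a \<Rightarrow> complex"
  have op: "open U" if U: "U \<in> S ` \<F>" for U
  proof -
    obtain F where F: "F \<in> \<F>" "U = S F" using U by blast
    have "open (F -` (- {0}))" using assms[OF F(1)] open_vimage by blast
    moreover have "F -` (- {0}) = S F" by (auto simp: S_def)
    ultimately show ?thesis using F(2) by simp
  qed
  obtain \<U> where \<U>: "\<U> \<subseteq> S ` \<F>" "countable \<U>" "\<Union>\<U> = \<Union>(S ` \<F>)" using Lindelof[of "S ` \<F>", OF op] by blast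
  obtain \<G> where \<G>: "countable \<G>" "\<G> \<subseteq> \<F>" "\<U> = S ` \<G>"
    using countable_subset_image[of \<U> S \<F>] \<U>(1,2) by blast
  have "(\<forall>F\<in>\<G>. F z = 0) \<longleftrightarrow> (\<forall>F\<in>\<F>. F z = 0)" for z
    using \<U>(3) \<G>(2) unfolding \<G>(3) S_def by blast
  then show ?thesis using \<G> by blast
qed

lemma vanishing_polyf: "F \<in> vanishing X \<Longrightarrow> F \<in> polyf"
  by (auto simp: vanishing_def intro: hom_poly_polyf)

lemma closed_cone_equations:
  assumes X: "closedin zariski X"
  shows "\<exists>\<G>. countable \<G> \<and> \<G> \<subseteq> vanishing X \<and> (\<forall>v. v \<noteq> 0 \<longrightarrow> v \<in> \<Union>X \<longleftrightarrow> (\<forall>F\<in>\<G>. F v = 0))"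
proof -
  obtain \<G> where \<G>: "countable \<G>" "\<G> \<subseteq> vanishing X" "\<forall>z. (\<forall>F\<in>\<G>. F z = 0) \<longleftrightarrow> (\<forall>F\<in>vanishing X. F z = 0)"
    using countable_equations[of "vanishing X"] vanishing_polyf polyf_continuous by blast
  have "v \<in> \<Union>X \<longleftrightarrow> (\<forall>F\<in>\<G>. F v = 0)" if "v \<noteq> 0" for v
    using closed_cone[OF X that] \<G>(3) unfolding vanishing_def by blast
  then show ?thesis using \<G> by blast
qed

text \<open>Continuous equations cut these vectors out of the sphere. This is the compactness behind
  boundedness, finite covers by charts and the continuity of \<open>G\<close>.\<close>

lemma unit_cone_compact:
  assumes X: "closedin zariski X"
  shows "compact {v \<in> \<Union>X. norm v = 1}"
proof -
  obtain \<G> where \<G>: "countable \<G>" "\<G> \<subseteq> vanishing X" "\<forall>v. v \<noteq> 0 \<longrightarrow> v \<in> \<Union>X \<longleftrightarrow> (\<forall>F\<in>\<G>. F v = 0)"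
    using closed_cone_equations[OF X] by blast
  have "{v \<in> \<Union>X. norm v = 1} = sphere 0 1 \<inter> (\<Inter>F\<in>\<G>. {v. F v = 0})"
  proof (rule Set.set_eqI)
    fix v :: "complex ^ 'a"
    show "v \<in> {v \<in> \<Union>X. norm v = 1} \<longleftrightarrow> v \<in> sphere 0 1 \<inter> (\<Inter>F\<in>\<G>. {v. F v = 0})"
    proof (cases "norm v = 1")
      case True
      then have "v \<noteq> 0" by auto
      then have "v \<in> \<Union>X \<longleftrightarrow> (\<forall>F\<in>\<G>. F v = 0)" using \<G>(3) by (simp only: simp_thms)
      then show ?thesis using True by (simp del: Union_iff)
    qed simp
  qed
  moreover have "closed {v. F v = 0}" if "F \<in> \<G>" for F
    using vanishing_polyf polyf_continuous \<G>(2) that by (intro closed_Collect_eq continuous_on_const) blast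
  ultimately show ?thesis by (auto intro!: compact_Int_closed closed_INT)
qed

lemma unit_rep:
  assumes X: "X \<subseteq> proj_space" and x: "x \<in> X"
  shows "\<exists>v. v \<in> x \<and> v \<in> \<Union>X \<and> norm v = 1"
proof -
  obtain v where v: "v \<in> x" using X x proj_space_nonempty by blast
  then have v0: "v \<noteq> 0" and xc: "x = cls v" using X x proj_point by blast+
  define u where "u = of_real (1 / norm v) *s v"
  have "u = (1 / norm v) *\<^sub>R v" unfolding u_def by (subst vec_eq_iff) (simp add: scaleR_conv_of_real[where 'a = complex])
  then have "norm u = 1" using v0 by simp
  moreover have "u \<in> x" unfolding xc proj_class_def u_def using v0 by (auto intro!: exI[of _ "of_real (1 / norm v)"])
  ultimately show ?thesis using x by blast
qed

text \<open>The factor \<open>w $ i\<close> excludes the vertex of the cone.\<close>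

lemma fraction_rep_coord_factor:
  assumes X: "X \<subseteq> proj_space" and x: "x \<in> X" "v \<in> x" and reg: "regular_at X x h"
  shows "\<exists>d P Q. fraction_rep X v h d P Q \<and> Q 0 = 0"
proof -
  obtain d P Q where r: "fraction_rep X v h d P Q" using reg regular_at_iff[OF X x] by blast
  have "v \<noteq> 0" using proj_point X x by blast
  then obtain i where i: "v $ i \<noteq> 0" by (auto simp: vec_eq_iff)
  have "fraction_rep X v h (d + 1) (\<lambda>w. P w * w $ i) (\<lambda>w. Q w * w $ i)"
    using r i unfolding fraction_rep_def by (auto intro!: hom_poly_mult hom_poly_coord simp del: One_nat_def)
  then show ?thesis by (intro exI[of _ "d + 1"] exI[of _ "\<lambda>w. P w * w $ i"] exI[of _ "\<lambda>w. Q w * w $ i"]) simp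
qed

text \<open>By compactness \<open>h\<close> is bounded and finitely many charts suffice. On each
  chart the values are those of one fraction at the solutions of countably many polynomial
  equations, so \<open>bounded_values_finite\<close> applies.\<close>

lemma regular_finite_values:
  assumes Y: "closedin zariski Y" and reg: "\<And>y. y \<in> Y \<Longrightarrow> regular_at Y y h"
  shows "finite (h ` Y)"
proof -
  have YP: "Y \<subseteq> proj_space" using Y closedin_subset topspace_zariski by blast
  define S where "S = {v \<in> \<Union>Y. norm v = 1}"
  have S: "compact S" unfolding S_def by (rule unit_cone_compact[OF Y])
  have "\<exists>d P Q. fraction_rep Y v h d P Q \<and> Q 0 = 0" if v: "v \<in> S" for v
  proof -
    obtain y where "y \<in> Y" "v \<in> y" using v by (auto simp: S_def)
    then show ?thesis using fraction_rep_coord_factor[OF YP _ _ reg] by blast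
  qed
  then obtain d P Q where r: "\<And>v. v \<in> S \<Longrightarrow> fraction_rep Y v h (d v) (P v) (Q v)" and Q0: "\<And>v. v \<in> S \<Longrightarrow> Q v 0 = 0"
    by metis
  have PQ: "P v \<in> polyf" "Q v \<in> polyf" "Q v v \<noteq> 0" if "v \<in> S" for v
    using r[OF that] fraction_rep_polyf by (auto simp: fraction_rep_def intro: hom_poly_polyf)
  have hv: "h (cls u) = P v u / Q v u" if "v \<in> S" "u \<in> \<Union>Y" "Q v u \<noteq> 0" for u v
    using r[OF that(1)] that(2,3) mem_Union_cls[OF YP] cls_mem unfolding fraction_rep_def by blast
  define U where "U v = {u. Q v u \<noteq> 0}" for v
  have oU: "open (U v)" if "v \<in> S" for v
  proof -
    have "open (Q v -` (- {0}))" using polyf_continuous[OF PQ(2)[OF that]] open_vimage by blast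
    moreover have "Q v -` (- {0}) = U v" by (auto simp: U_def)
    ultimately show ?thesis by simp
  qed
  have "\<exists>T\<subseteq>S. finite T \<and> S \<subseteq> (\<Union>v\<in>T. U v)"
    by (rule compactE_image[OF S, of S U]) (use oU PQ(3) in \<open>auto simp: U_def\<close>)
  then obtain T where T: "T \<subseteq> S" "finite T" "S \<subseteq> (\<Union>v\<in>T. U v)" by blast
  have "continuous_on S (\<lambda>u. h (cls u))"
    unfolding continuous_on_eq_continuous_within
  proof
    fix v assume v: "v \<in> S"
    have "isCont (P v) v" "isCont (Q v) v"
      using polyf_continuous[OF PQ(1)[OF v]] polyf_continuous[OF PQ(2)[OF v]]
      by (simp_all add: continuous_on_eq_continuous_at)
    then have "isCont (\<lambda>u. P v u / Q v u) v" using PQ(3)[OF v] by (rule isCont_divide)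
    then have "continuous (at v within S) (\<lambda>u. P v u / Q v u)" by (rule continuous_at_imp_continuous_at_within)
    then show "continuous (at v within S) (\<lambda>u. h (cls u))"
    proof (rule continuous_transform_within_openin[where S = "S \<inter> U v"])
      show "openin (top_of_set S) (S \<inter> U v)" using oU[OF v] by (rule openin_open_Int)
      show "v \<in> S \<inter> U v" using v PQ(3)[OF v] by (simp add: U_def)
      show "P v u / Q v u = h (cls u)" if "u \<in> S \<inter> U v" for u
        using hv[OF v, of u] that by (simp add: S_def U_def)
    qed
  qed
  then have "compact ((\<lambda>u. h (cls u)) ` S)" using S by (rule compact_continuous_image)
  moreover have eq: "h ` Y \<subseteq> (\<lambda>u. h (cls u)) ` S"
  proof
    fix z assume "z \<in> h ` Y"
    then obtain y where y: "y \<in> Y" "z = h y" by blast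
    obtain u where u: "u \<in> y" "u \<in> S" using unit_rep[OF YP y(1)] by (auto simp: S_def)
    have "y = cls u" using proj_point(1) YP y(1) u(1) by blast
    then show "z \<in> (\<lambda>u. h (cls u)) ` S" using u(2) y(2) by blast
  qed
  ultimately have bd: "bounded (h ` Y)" using compact_imp_bounded bounded_subset by blast
  obtain \<G> where \<G>: "countable \<G>" "\<G> \<subseteq> vanishing Y" "\<forall>v. v \<noteq> 0 \<longrightarrow> v \<in> \<Union>Y \<longleftrightarrow> (\<forall>F\<in>\<G>. F v = 0)"
    using closed_cone_equations[OF Y] by blast
  define W where "W v = {P v u / Q v u | u. Q v u \<noteq> 0 \<and> (\<forall>e\<in>\<G>. e u = 0)}" for v
  \<comment> \<open>Since \<open>Q v 0 = 0\<close>, a vector with \<open>Q v u\<close> nonzero is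
    not the vertex, and away from the vertex the equations in \<open>\<G>\<close> describe the
    cone.\<close>
  have uY: "u \<in> \<Union>Y" if "v \<in> S" "Q v u \<noteq> 0" "\<forall>e\<in>\<G>. e u = 0" for u v
    using \<G>(3) Q0[OF that(1)] that(2,3) by metis
  have Wh: "W v \<subseteq> h ` Y" if "v \<in> S" for v
  proof
    fix z assume "z \<in> W v"
    then obtain u where u: "z = P v u / Q v u" "Q v u \<noteq> 0" "\<forall>e\<in>\<G>. e u = 0" by (auto simp: W_def)
    have "u \<in> \<Union>Y" by (rule uY[OF that u(2,3)])
    then show "z \<in> h ` Y" using hv[OF that _ u(2)] u(1) mem_Union_cls[OF YP] by (metis imageI)
  qed
  have fin: "finite (W v)" if "v \<in> S" for v
    unfolding W_def
  proof (rule bounded_values_finite[where coords = "\<lambda>i v. v $ i"])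
    show "\<exists>y. \<forall>b. y $ b = g b" for g :: "'a \<Rightarrow> complex" by (rule exI[of _ "\<chi> b. g b"]) simp
    show "\<G> \<subseteq> polyf" using \<G>(2) vanishing_polyf by blast
    show "bounded {P v u / Q v u | u. Q v u \<noteq> 0 \<and> (\<forall>e\<in>\<G>. e u = 0)}"
      using bounded_subset[OF bd Wh[OF that]] by (simp add: W_def)
  qed (use \<G>(1) PQ(1,2)[OF that] in auto)
  have "h ` Y \<subseteq> (\<Union>v\<in>T. W v)"
  proof
    fix z assume "z \<in> h ` Y"
    then obtain u where u: "u \<in> S" "z = h (cls u)" using eq by blast
    then obtain v where v: "v \<in> T" "Q v u \<noteq> 0" using T(3) by (auto simp: U_def)
    have u': "u \<in> \<Union>Y" "u \<noteq> 0" using u(1) by (auto simp: S_def)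
    then have "\<forall>e\<in>\<G>. e u = 0" using \<G>(3) by blast
    moreover have "z = P v u / Q v u" using hv[of v u] v u' u(2) T(1) by blast
    ultimately have "z \<in> W v" using v(2) by (auto simp: W_def)
    then show "z \<in> (\<Union>v\<in>T. W v)" using v(1) by blast
  qed
  moreover have "finite (\<Union>v\<in>T. W v)" using T(1,2) fin by blast
  ultimately show ?thesis by (rule finite_subset)
qed

lemma regular_level_closed:
  assumes Y: "closedin zariski Y" and reg: "\<And>y. y \<in> Y \<Longrightarrow> regular_at Y y h"
  shows "closedin (zariski_of Y) {y \<in> Y. h y = a}"
proof -
  have YP: "Y \<subseteq> proj_space" using Y closedin_subset topspace_zariski by blast
  have top: "topspace (zariski_of Y) = Y" using YP by (auto simp: topspace_zariski)
  have "openin (zariski_of Y) {y \<in> Y. h y \<noteq> a}"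
  proof (subst openin_subopen, intro ballI)
    fix y assume y: "y \<in> {y \<in> Y. h y \<noteq> a}"
    then obtain v where v: "v \<in> y" using YP proj_space_nonempty by blast
    obtain d P Q where r: "fraction_rep Y v h d P Q" using reg[of y] regular_at_iff[OF YP _ v] y by blast
    \<comment> \<open>On the cone over \<open>Y\<close>, nonzero precisely where the fraction is
      defined and differs from \<open>a\<close>.\<close>
    define R where "R u = (P u - a * Q u) * Q u" for u
    have R: "hom_poly (d + d) R" unfolding R_def using r by (intro hom_poly_mult hom_poly_diff hom_poly_cmult) (auto simp: fraction_rep_def)
    have hP: "h z = P u / Q u" if "z \<in> Y" "u \<in> z" "Q u \<noteq> 0" for z u using r that by (auto simp: fraction_rep_def)
    have Qv: "Q v \<noteq> 0" using r by (simp add: fraction_rep_def)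
    have "R v \<noteq> 0" using hP[of y v] y v Qv by (auto simp: R_def field_simps)
    then have "y \<in> Y \<inter> basic_open R" using basic_open_iff[OF R _ v] y YP by blast
    moreover have "Y \<inter> basic_open R \<subseteq> {y \<in> Y. h y \<noteq> a}"
    proof
      fix z assume z: "z \<in> Y \<inter> basic_open R"
      then obtain u where u: "u \<in> z" using YP proj_space_nonempty by blast
      then have "R u \<noteq> 0" using z by (auto simp: basic_open_def)
      then have "h z \<noteq> a" using hP[of z u] z u by (auto simp: R_def)
      then show "z \<in> {y \<in> Y. h y \<noteq> a}" using z by simp
    qed
    ultimately show "\<exists>T. openin (zariski_of Y) T \<and> y \<in> T \<and> T \<subseteq> {y \<in> Y. h y \<noteq> a}"
      using openin_basic_open_of[OF R] by blast
  qed
  moreover have "Y - {y \<in> Y. h y = a} = {y \<in> Y. h y \<noteq> a}" by auto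
  ultimately show ?thesis unfolding closedin_def top by auto
qed

text \<open>The level sets are closed and finite in number, so a second value would disconnect
  \<open>Y\<close>.\<close>

lemma regular_constant:
  assumes Y: "closedin zariski Y" and reg: "\<And>y. y \<in> Y \<Longrightarrow> regular_at Y y h" and conn: "connectedin zariski Y"
  shows "y \<in> Y \<Longrightarrow> z \<in> Y \<Longrightarrow> h y = h z"
proof (rule ccontr)
  assume yz: "y \<in> Y" "z \<in> Y" "h y \<noteq> h z"
  have YP: "Y \<subseteq> proj_space" using Y closedin_subset topspace_zariski by blast
  have top: "topspace (zariski_of Y) = Y" using YP by (auto simp: topspace_zariski)
  define D where "D = (\<Union>a\<in>h ` Y - {h y}. {x \<in> Y. h x = a})"
  have "closedin (zariski_of Y) D" unfolding D_def
    using regular_finite_values[OF Y reg] regular_level_closed[OF Y reg] by (intro closedin_Union) auto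
  moreover have "closedin (zariski_of Y) {x \<in> Y. h x = h y}" by (rule regular_level_closed[OF Y reg])
  moreover have "{x \<in> Y. h x = h y} \<union> D = Y" "{x \<in> Y. h x = h y} \<inter> D = {}" by (auto simp: D_def)
  moreover have "{x \<in> Y. h x = h y} \<noteq> {}" "D \<noteq> {}" using yz by (auto simp: D_def)
  moreover have "connected_space (zariski_of Y)" using conn by (simp add: connectedin_def)
  ultimately show False unfolding connected_space_closedin_eq top by blast
qed

lemma irreducible_connected:
  assumes "projective_variety X"
  shows "closedin zariski X" "connectedin zariski X" "X \<noteq> {}"
proof -
  show X: "closedin zariski X" using assms by (simp add: projective_variety_def)
  have XP: "X \<subseteq> proj_space" using X closedin_subset topspace_zariski by blast
  have top: "topspace (zariski_of X) = X" using XP by (auto simp: topspace_zariski)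
  have irr: "irreducible_space (zariski_of X)" using assms by (simp add: projective_variety_def)
  then show "X \<noteq> {}" unfolding irreducible_space_def top by blast
  have "connected_space (zariski_of X)"
    using irr unfolding irreducible_space_def connected_space_closedin_eq top by blast
  then show "connectedin zariski X" using XP by (simp add: connectedin_def topspace_zariski)
qed

section \<open>Symmetric differentials along invariant fields\<close>

text \<open>A fraction near \<open>x0\<close> whose denominator does not involve the parameter
  \<open>v\<close>, so that one chart serves all directions. Numerator and denominator have equal
  degree in \<open>u\<close>.\<close>

definition param_frac :: "complex ^ 'i::finite \<Rightarrow> (complex ^ 'i \<Rightarrow> complex ^ 'n::finite \<Rightarrow> complex) \<Rightarrow> bool" where
  "param_frac x0 r \<longleftrightarrow> (\<exists>d N Q. hom_poly d Q \<and> Q x0 \<noteq> 0 \<and> N \<in> polyp \<and>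
     (\<forall>c u v. N (c *s u, v) = c ^ d * N (u, v)) \<and> (\<forall>u v. Q u \<noteq> 0 \<longrightarrow> r u v * Q u = N (u, v)))"

lemma polyp_of_polyf: "P \<in> polyf \<Longrightarrow> (\<lambda>z. P (fst z)) \<in> polyp"
  by (rule polyf_comp[OF _ polyp_fst])

lemma param_frac_const: "param_frac x0 (\<lambda>_ _. c)"
  unfolding param_frac_def
  by (intro exI[of _ 0] exI[of _ "\<lambda>_. c"] exI[of _ "\<lambda>_. 1"]) (simp add: hom_poly_const alg.const)

lemma param_frac_add:
  assumes "param_frac x0 r" "param_frac x0 s"
  shows "param_frac x0 (\<lambda>u v. r u v + s u v)"
proof -
  from assms(1) obtain d N Q where r: "hom_poly d Q" "Q x0 \<noteq> 0" "N \<in> polyp"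
     "\<forall>c u v. N (c *s u, v) = c ^ d * N (u, v)" "\<forall>u v. Q u \<noteq> 0 \<longrightarrow> r u v * Q u = N (u, v)"
    unfolding param_frac_def by (elim exE conjE)
  from assms(2) obtain e M R where s: "hom_poly e R" "R x0 \<noteq> 0" "M \<in> polyp"
     "\<forall>c u v. M (c *s u, v) = c ^ e * M (u, v)" "\<forall>u v. R u \<noteq> 0 \<longrightarrow> s u v * R u = M (u, v)"
    unfolding param_frac_def by (elim exE conjE)
  have "(\<lambda>z. N z * R (fst z) + M z * Q (fst z)) \<in> polyp"
    by (intro alg.add alg.mult r(3) s(3) polyp_of_polyf hom_poly_polyf[OF r(1)] hom_poly_polyf[OF s(1)])
  moreover have "hom_poly (d + e) (\<lambda>u. Q u * R u)" by (rule hom_poly_mult[OF r(1) s(1)])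
  ultimately show ?thesis unfolding param_frac_def using r(2,4,5) s(2,4,5) hom_poly_scale[OF r(1)] hom_poly_scale[OF s(1)]
    by (intro exI[of _ "d + e"] exI[of _ "\<lambda>z. N z * R (fst z) + M z * Q (fst z)"] exI[of _ "\<lambda>u. Q u * R u"])
       (simp add: power_add algebra_simps)
qed

lemma param_frac_mult:
  assumes "param_frac x0 r" "param_frac x0 s"
  shows "param_frac x0 (\<lambda>u v. r u v * s u v)"
proof -
  from assms(1) obtain d N Q where r: "hom_poly d Q" "Q x0 \<noteq> 0" "N \<in> polyp"
     "\<forall>c u v. N (c *s u, v) = c ^ d * N (u, v)" "\<forall>u v. Q u \<noteq> 0 \<longrightarrow> r u v * Q u = N (u, v)"
    unfolding param_frac_def by (elim exE conjE)
  from assms(2) obtain e M R where s: "hom_poly e R" "R x0 \<noteq> 0" "M \<in> polyp"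
     "\<forall>c u v. M (c *s u, v) = c ^ e * M (u, v)" "\<forall>u v. R u \<noteq> 0 \<longrightarrow> s u v * R u = M (u, v)"
    unfolding param_frac_def by (elim exE conjE)
  have "(\<lambda>z. N z * M z) \<in> polyp" by (intro alg.mult r(3) s(3))
  moreover have "hom_poly (d + e) (\<lambda>u. Q u * R u)" by (rule hom_poly_mult[OF r(1) s(1)])
  moreover have "r u v * s u v * (Q u * R u) = N (u, v) * M (u, v)" if "Q u * R u \<noteq> 0" for u v
  proof -
    have "r u v * Q u = N (u, v)" "s u v * R u = M (u, v)" using r(5) s(5) that by simp_all
    from this[symmetric] show ?thesis by (simp add: mult_ac)
  qed
  ultimately show ?thesis unfolding param_frac_def using r(2,4) s(2,4)
    by (intro exI[of _ "d + e"] exI[of _ "\<lambda>z. N z * M z"] exI[of _ "\<lambda>u. Q u * R u"])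
       (simp add: power_add mult_ac)
qed

lemma param_frac_sum:
  assumes "\<And>i. i \<in> I \<Longrightarrow> param_frac x0 (f i)"
  shows "param_frac x0 (\<lambda>u v. \<Sum>i\<in>I. f i u v)"
  using assms by (induction I rule: infinite_finite_induct) (simp_all add: param_frac_const param_frac_add)

lemma param_frac_prod:
  assumes "\<And>i. i \<in> I \<Longrightarrow> param_frac x0 (f i)"
  shows "param_frac x0 (\<lambda>u v. \<Prod>i\<in>I. f i u v)"
  using assms by (induction I rule: infinite_finite_induct) (simp_all add: param_frac_const param_frac_mult)

lemma hom_vec_scale: "(\<And>j. hom_poly d (\<lambda>u. \<mu> u $ j)) \<Longrightarrow> \<mu> (c *s u) = c ^ d *s \<mu> u"
  by (simp add: vec_eq_iff hom_poly_iff)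

lemma param_frac_quotient:
  assumes \<mu>: "\<And>j. hom_poly a (\<lambda>u. \<mu> u $ j)" and PQ: "hom_poly d P" "hom_poly d Q" and Q: "Q (\<mu> x0) \<noteq> 0"
  shows "param_frac x0 (\<lambda>u v. P (\<mu> u) / Q (\<mu> u))"
proof -
  have h: "hom_poly (a * d) (\<lambda>u. P (\<mu> u))" "hom_poly (a * d) (\<lambda>u. Q (\<mu> u))"
    by (rule hom_poly_comp[OF PQ(1) \<mu>], rule hom_poly_comp[OF PQ(2) \<mu>])
  show ?thesis unfolding param_frac_def
    using h(2) Q polyp_of_polyf[OF hom_poly_polyf[OF h(1)]] hom_poly_scale[OF h(1)]
    by (intro exI[of _ "a * d"] exI[of _ "\<lambda>z. P (\<mu> (fst z))"] exI[of _ "\<lambda>u. Q (\<mu> u)"]) simp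
qed

lemma param_frac_qder:
  assumes \<mu>: "\<And>j. hom_poly a (\<lambda>u. \<mu> u $ j)" and \<tau>: "\<And>j. (\<lambda>z. \<tau> (fst z) (snd z) $ j) \<in> polyp"
    "\<And>c u v. \<tau> (c *s u) v = c ^ a *s \<tau> u v"
    and PQ: "hom_poly d P" "hom_poly d Q" and Q: "Q (\<mu> x0) \<noteq> 0"
  shows "param_frac x0 (\<lambda>u v. qder P Q (\<mu> u) (\<tau> u v))"
proof -
  define N where "N z = dder P (\<mu> (fst z)) (\<tau> (fst z) (snd z)) * Q (\<mu> (fst z)) - P (\<mu> (fst z)) * dder Q (\<mu> (fst z)) (\<tau> (fst z) (snd z))" for z
  have mp: "(\<lambda>z. \<mu> (fst z) $ j) \<in> polyp" for j by (rule polyp_of_polyf[OF hom_poly_polyf[OF \<mu>]])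
  note pf = PQ[THEN hom_poly_polyf]
  have N: "N \<in> polyp" unfolding N_def
    by (intro alg_diff alg.mult dder_polyp_comp[OF pf(1) mp \<tau>(1)] dder_polyp_comp[OF pf(2) mp \<tau>(1)]
        polyf_comp[OF pf(1) mp] polyf_comp[OF pf(2) mp])
  have h: "hom_poly (a * d) (\<lambda>u. Q (\<mu> u))" by (rule hom_poly_comp[OF PQ(2) \<mu>])
  have h2: "hom_poly (a * d + a * d) (\<lambda>u. Q (\<mu> u) * Q (\<mu> u))" by (rule hom_poly_mult[OF h h])
  have s: "N (c *s u, v) = c ^ (a * d + a * d) * N (u, v)" for c u v
    unfolding N_def fst_conv snd_conv hom_vec_scale[OF \<mu>] \<tau>(2) dder_scale[OF PQ(1)] dder_scale[OF PQ(2)]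
      hom_poly_scale[OF PQ(1)] hom_poly_scale[OF PQ(2)]
    by (simp add: power_add power_mult algebra_simps)
  have e: "qder P Q (\<mu> u) (\<tau> u v) * (Q (\<mu> u) * Q (\<mu> u)) = N (u, v)" if "Q (\<mu> u) * Q (\<mu> u) \<noteq> 0" for u v
    using that by (simp add: qder_def N_def power2_eq_square)
  show ?thesis unfolding param_frac_def
    by (intro exI[of _ "a * d + a * d"] exI[of _ N] exI[of _ "\<lambda>u. Q (\<mu> u) * Q (\<mu> u)"])
       (use h2 Q N s e in simp)
qed

lemma hom_poly_prod:
  assumes "\<And>i. i \<in> I \<Longrightarrow> \<exists>d. hom_poly d (f i)"
  shows "\<exists>d. hom_poly d (\<lambda>u. \<Prod>i\<in>I. f i u)"
  using assms
proof (induction I rule: infinite_finite_induct)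
  case (insert x F)
  obtain d where d: "hom_poly d (f x)" using insert.prems by blast
  obtain e where e: "hom_poly e (\<lambda>u. \<Prod>i\<in>F. f i u)" using insert.IH insert.prems by blast
  have "hom_poly (d + e) (\<lambda>u. f x u * (\<Prod>i\<in>F. f i u))" by (rule hom_poly_mult[OF d e])
  then show ?case using insert.hyps by (intro exI[of _ "d + e"]) simp
qed (auto intro: hom_poly_const exI[of _ 0])

lemma symmetric_differentialE:
  assumes "\<omega> \<in> symmetric_differentials X m" "x \<in> X"
  obtains U f g and r :: nat where "openin (zariski_of X) U" "x \<in> U"
    "\<forall>y\<in>U. \<forall>i<r. regular_at X y (f i) \<and> (\<forall>j<m. regular_at X y (g i j))"
    "\<forall>y\<in>U. \<forall>D\<in>tangent_space X y. \<omega> y D = (\<Sum>i<r. f i y * (\<Prod>j<m. D (g i j)))"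
proof -
  have "\<exists>U (r::nat) f g. openin (zariski_of X) U \<and> x \<in> U \<and>
        (\<forall>y\<in>U. \<forall>i<r. regular_at X y (f i) \<and> (\<forall>j<m. regular_at X y (g i j))) \<and>
        (\<forall>y\<in>U. \<forall>D\<in>tangent_space X y. \<omega> y D = (\<Sum>i<r. f i y * (\<Prod>j<m. D (g i j))))"
    using assms by (simp add: symmetric_differentials_def)
  then show thesis by (elim exE conjE) (rule that)
qed

text \<open>One chart for all regular functions of a local expression: \<open>R\<close> is the
  product of their denominators with the polynomial of a neighbourhood.\<close>

lemma symmetric_differential_local:
  assumes X: "X \<subseteq> proj_space" and \<omega>: "\<omega> \<in> symmetric_differentials X m" and x0: "x0 \<in> \<Union>X"
  shows "\<exists>(r::nat) a P Q b P' Q' e R. hom_poly e R \<and> R x0 \<noteq> 0 \<and>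
    (\<forall>i<r. hom_poly (a i) (P i) \<and> hom_poly (a i) (Q i) \<and> (\<forall>j<m. hom_poly (b i j) (P' i j) \<and> hom_poly (b i j) (Q' i j))) \<and>
    (\<forall>p\<in>\<Union>X. R p \<noteq> 0 \<longrightarrow> (\<forall>i<r. Q i p \<noteq> 0 \<and> (\<forall>j<m. Q' i j p \<noteq> 0)) \<and>
       (\<forall>w\<in>tancone X p. \<omega> (cls p) (der X p w) = (\<Sum>i<r. P i p / Q i p * (\<Prod>j<m. qder (P' i j) (Q' i j) p w))))"
proof -
  obtain x where x: "x \<in> X" "x0 \<in> x" using x0 by blast
  obtain U f g and r :: nat where U: "openin (zariski_of X) U" "x \<in> U"
    "\<forall>y\<in>U. \<forall>i<r. regular_at X y (f i) \<and> (\<forall>j<m. regular_at X y (g i j))"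
    "\<forall>y\<in>U. \<forall>D\<in>tangent_space X y. \<omega> y D = (\<Sum>i<r. f i y * (\<Prod>j<m. D (g i j)))"
    by (rule symmetric_differentialE[OF \<omega> x(1)])
  obtain e0 R0 where R0: "hom_poly e0 R0" "x \<in> basic_open R0" "X \<inter> basic_open R0 \<subseteq> U" using zariski_of_basis[OF U(1,2)] by blast
  have "\<forall>i. \<exists>a P Q. i < r \<longrightarrow> fraction_rep X x0 (f i) a P Q" using U(2,3) regular_at_iff[OF X x] by meson
  then obtain a P Q where f: "\<And>i. i < r \<Longrightarrow> fraction_rep X x0 (f i) (a i) (P i) (Q i)" by metis
  have "\<forall>i j. \<exists>b P Q. i < r \<and> j < m \<longrightarrow> fraction_rep X x0 (g i j) b P Q" using U(2,3) regular_at_iff[OF X x] by meson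
  then obtain b P' Q' where g: "\<And>i j. i < r \<Longrightarrow> j < m \<Longrightarrow> fraction_rep X x0 (g i j) (b i j) (P' i j) (Q' i j)" by metis
  define R where "R u = R0 u * (\<Prod>i<r. Q i u * (\<Prod>j<m. Q' i j u))" for u
  have "\<exists>d. hom_poly d (\<lambda>u. Q i u * (\<Prod>j<m. Q' i j u))" if "i < r" for i
  proof -
    have "\<exists>d. hom_poly d (\<lambda>u. \<Prod>j<m. Q' i j u)" using g[OF that] by (intro hom_poly_prod) (auto simp: fraction_rep_def)
    then show ?thesis using f[OF that] hom_poly_mult[of "a i" "Q i"] by (auto simp: fraction_rep_def)
  qed
  then have "\<exists>d. hom_poly d (\<lambda>u. \<Prod>i<r. Q i u * (\<Prod>j<m. Q' i j u))" by (intro hom_poly_prod) simp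
  then obtain e where e: "hom_poly e R" unfolding R_def using hom_poly_mult[OF R0(1)] by blast
  have "R0 x0 \<noteq> 0" using R0(2) x by (auto simp: basic_open_def)
  then have Rx0: "R x0 \<noteq> 0" using f g by (auto simp: R_def fraction_rep_def)
  have "(\<forall>i<r. Q i p \<noteq> 0 \<and> (\<forall>j<m. Q' i j p \<noteq> 0)) \<and>
       (\<forall>w\<in>tancone X p. \<omega> (cls p) (der X p w) = (\<Sum>i<r. P i p / Q i p * (\<Prod>j<m. qder (P' i j) (Q' i j) p w)))"
    if p: "p \<in> \<Union>X" "R p \<noteq> 0" for p
  proof -
    have nz: "Q i p \<noteq> 0" "j < m \<Longrightarrow> Q' i j p \<noteq> 0" if "i < r" for i j using p(2) that by (auto simp: R_def)
    have pX: "cls p \<in> X" using p(1) mem_Union_cls[OF X] by blast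
    have "cls p \<in> basic_open R0" using basic_open_iff[OF R0(1) _ cls_mem] pX X p(2) by (auto simp: R_def)
    then have pU: "cls p \<in> U" using R0(3) pX by blast
    have "\<omega> (cls p) (der X p w) = (\<Sum>i<r. P i p / Q i p * (\<Prod>j<m. qder (P' i j) (Q' i j) p w))" if w: "w \<in> tancone X p" for w
    proof -
      have "\<omega> (cls p) (der X p w) = (\<Sum>i<r. f i (cls p) * (\<Prod>j<m. der X p w (g i j)))"
        using U(4) pU der_in_tangent_space[OF X p(1) w] by blast
      also have "\<dots> = (\<Sum>i<r. P i p / Q i p * (\<Prod>j<m. qder (P' i j) (Q' i j) p w))"
      proof (intro sum.cong arg_cong2[where f = times] prod.cong refl)
        fix i assume i: "i \<in> {..<r}"
        show "f i (cls p) = P i p / Q i p" using f[of i] i nz(1)[of i] pX cls_mem[of p] by (auto simp: fraction_rep_def)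
        fix j assume j: "j \<in> {..<m}"
        have "fraction_rep X p (g i j) (b i j) (P' i j) (Q' i j)" using g[of i j] i j nz(2)[of i j] by (simp add: fraction_rep_def)
        then show "der X p w (g i j) = qder (P' i j) (Q' i j) p w" by (rule der_eq[OF X p(1) w])
      qed
      finally show ?thesis .
    qed
    then show ?thesis using nz by blast
  qed
  then show ?thesis using e Rx0 f g
    by (intro exI[of _ r] exI[of _ a] exI[of _ P] exI[of _ Q] exI[of _ b] exI[of _ P'] exI[of _ Q'] exI[of _ e] exI[of _ R])
       (simp add: fraction_rep_def)
qed

section \<open>Loci of tangency of the invariant fields\<close>

context abelian_coordinates
begin

text \<open>Meaningful at points of \<open>tangency X v\<close> only; there the vector is unique
  because the inclusion is injective on tangent vectors.\<close>

definition field_on :: "'i point set \<Rightarrow> complex ^ 'n \<Rightarrow> 'i point \<Rightarrow> 'i tangent" where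
  "field_on X v x = (THE D. D \<in> tangent_space X x \<and> differential C (\<lambda>y. y) x D = invariant_field v x)"

text \<open>This is the set \<open>F v\<close> of the introduction.\<close>

definition tangency :: "'i point set \<Rightarrow> complex ^ 'n \<Rightarrow> 'i point set" where
  "tangency X v = {x \<in> X. \<exists>D\<in>tangent_space X x. differential C (\<lambda>y. y) x D = invariant_field v x}"

text \<open>Directions giving the same vector of the abelian variety differ by a multiple of
  \<open>p\<close>, and the radial direction is tangent to the cone over \<open>X\<close> as
  well.\<close>

lemma inclusion_inj:
  assumes XC: "X \<subseteq> C" and p: "p \<in> \<Union>X" and w: "w \<in> tancone X p" "w' \<in> tancone C p"
    and eq: "der C p w = der C p w'"
  shows "w' \<in> tancone X p" "der X p w = der X p w'"
proof -
  have XP: "X \<subseteq> proj_space" using XC C_proj by blast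
  have pC: "p \<in> \<Union>C" using p XC by blast
  have wC: "w \<in> tancone C p" using tancone_mono[OF XC] w(1) by blast
  obtain c where c: "w' = w + c *s p" using der_eq_iff[OF C_proj pC w(2) wC] eq by auto
  show w'X: "w' \<in> tancone X p" unfolding c by (intro tancone_add w(1) tancone_scale tancone_self p)
  show "der X p w = der X p w'" using der_eq_iff[OF XP p w'X w(1)] c by auto
qed

text \<open>Reduces tangency, a statement about derivations, to membership of a direction in the
  tangent space of the cone, which is given by polynomial equations.\<close>

lemma tangency_chart:
  assumes XC: "X \<subseteq> C" and p: "p \<in> \<Union>X" and w: "w \<in> tancone C p" and f: "invariant_field v (cls p) = der C p w"
  shows "cls p \<in> tangency X v \<longleftrightarrow> w \<in> tancone X p"
    "w \<in> tancone X p \<Longrightarrow> field_on X v (cls p) = der X p w"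
proof -
  have XP: "X \<subseteq> proj_space" using XC C_proj by blast
  have pX: "cls p \<in> X" using p mem_Union_cls[OF XP] by blast
  note inc = differential_inclusion[OF XC C_proj p]
  have D: "\<exists>z\<in>tancone X p. D = der X p z" if "D \<in> tangent_space X (cls p)" for D
    using tangent_space_der[OF XP p that] .
  show "cls p \<in> tangency X v \<longleftrightarrow> w \<in> tancone X p"
  proof
    assume "cls p \<in> tangency X v"
    then have "\<exists>D\<in>tangent_space X (cls p). differential C (\<lambda>y. y) (cls p) D = der C p w"
      by (simp add: tangency_def f)
    then obtain D where d: "D \<in> tangent_space X (cls p)" "differential C (\<lambda>y. y) (cls p) D = der C p w"
      by (elim bexE)
    from D[OF d(1)] obtain z where z: "z \<in> tancone X p" "D = der X p z" by (elim bexE)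
    have "der C p z = der C p w" using inc[OF z(1)] d(2) z(2) by simp
    then show "w \<in> tancone X p" by (rule inclusion_inj(1)[OF XC p z(1) w])
  next
    assume w: "w \<in> tancone X p"
    show "cls p \<in> tangency X v" unfolding tangency_def
      by (intro CollectI conjI pX bexI[OF _ der_in_tangent_space[OF XP p w]]) (simp add: inc[OF w] f)
  qed
  show "field_on X v (cls p) = der X p w" if wX: "w \<in> tancone X p"
    unfolding field_on_def f
  proof (rule the_equality)
    show "der X p w \<in> tangent_space X (cls p) \<and> differential C (\<lambda>y. y) (cls p) (der X p w) = der C p w"
      using inc[OF wX] der_in_tangent_space[OF XP p wX] by simp
    fix E assume E: "E \<in> tangent_space X (cls p) \<and> differential C (\<lambda>y. y) (cls p) E = der C p w"
    from D[OF conjunct1[OF E]] obtain z where z: "z \<in> tancone X p" "E = der X p z" by (elim bexE)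
    then have "der C p z = der C p w" using inc[OF z(1)] E by simp
    then show "E = der X p w" using inclusion_inj(2)[OF XC p z(1) w] z(2) by simp
  qed
qed

lemma tangency_field:
  assumes XC: "X \<subseteq> C" and x: "x \<in> X" and D: "D \<in> tangent_space X x" "differential C (\<lambda>y. y) x D = invariant_field v x"
  shows "x \<in> tangency X v" "field_on X v x = D"
proof -
  have XP: "X \<subseteq> proj_space" using XC C_proj by blast
  obtain p where p: "p \<in> x" using XP x proj_space_nonempty by blast
  then have xc: "x = cls p" and pX: "p \<in> \<Union>X" using proj_point(1) XP x by blast+
  from tangent_space_der[OF XP pX D(1)[unfolded xc]]
  obtain w where w: "w \<in> tancone X p" "D = der X p w" by (elim bexE)
  have f: "invariant_field v (cls p) = der C p w"
    using D(2) differential_inclusion[OF XC C_proj pX w(1)] unfolding w(2) xc by simp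
  show "x \<in> tangency X v" unfolding tangency_def by (intro CollectI conjI x bexI[of _ D] D)
  show "field_on X v x = D" unfolding xc w(2)
    by (rule tangency_chart(2)[OF XC pX _ f w(1)]) (use tancone_mono[OF XC] w(1) in blast)
qed

text \<open>A chart of the set of pairs \<open>(u, v)\<close> with the field of \<open>v\<close>
  tangent to \<open>X\<close> at \<open>cls u\<close>: where \<open>Q\<close> is nonzero,
  \<open>E\<close> are its equations on the cone over \<open>X\<close> and \<open>N / Q\<close> is
  the value of \<open>\<omega>\<close> along the field. \<open>Q 0 = 0\<close> excludes the vertex,
  and homogeneity in \<open>u\<close> alone permits the passage to projective points for each fixed
  \<open>v\<close>.\<close>

definition tangency_eqs ::
  "'i point set \<Rightarrow> ('i point \<Rightarrow> 'i tangent \<Rightarrow> complex) \<Rightarrow> complex ^ 'i \<Rightarrow> nat \<Rightarrow> (complex ^ 'i \<Rightarrow> complex) \<Rightarrow>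
    ((complex ^ 'i) \<times> (complex ^ 'n) \<Rightarrow> complex) \<Rightarrow> ((complex ^ 'i) \<times> (complex ^ 'n) \<Rightarrow> complex) set \<Rightarrow> bool" where
  "tangency_eqs X \<omega> x0 d Q N E \<longleftrightarrow> hom_poly d Q \<and> Q x0 \<noteq> 0 \<and> Q 0 = 0 \<and>
    N \<in> polyp \<and> (\<forall>c u v. N (c *s u, v) = c ^ d * N (u, v)) \<and>
    countable E \<and> E \<subseteq> polyp \<and> (\<forall>e\<in>E. \<exists>k. \<forall>c u v. e (c *s u, v) = c ^ k * e (u, v)) \<and>
    (\<forall>u\<in>\<Union>X. Q u \<noteq> 0 \<longrightarrow> (\<forall>v. (cls u \<in> tangency X v \<longleftrightarrow> (\<forall>e\<in>E. e (u, v) = 0)) \<and>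
       (cls u \<in> tangency X v \<longrightarrow> \<omega> (cls u) (field_on X v (cls u)) * Q u = N (u, v))))"

lemma tangency_eqsD:
  assumes "tangency_eqs X \<omega> x0 d Q N E"
  shows "hom_poly d Q" "Q x0 \<noteq> 0" "Q 0 = 0" "N \<in> polyp" "N (c *s u, v) = c ^ d * N (u, v)" "countable E" "E \<subseteq> polyp"
    "e \<in> E \<Longrightarrow> \<exists>k. \<forall>c u v. e (c *s u, v) = c ^ k * e (u, v)"
    "u \<in> \<Union>X \<Longrightarrow> Q u \<noteq> 0 \<Longrightarrow> cls u \<in> tangency X v \<longleftrightarrow> (\<forall>e\<in>E. e (u, v) = 0)"
    "u \<in> \<Union>X \<Longrightarrow> Q u \<noteq> 0 \<Longrightarrow> cls u \<in> tangency X v \<Longrightarrow> \<omega> (cls u) (field_on X v (cls u)) * Q u = N (u, v)"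
  using assms unfolding tangency_eqs_def by blast+

text \<open>Tangency at \<open>u\<close> means that every equation of \<open>X\<close> has
  derivative 0 at \<open>\<mu> u\<close> in the direction \<open>\<tau> u v\<close>, which is
  polynomial in \<open>u\<close> and \<open>v\<close> together. The value comes from a local
  expression of \<open>\<omega>\<close> with the quotient rule inserted.\<close>

lemma tangency_equations:
  assumes XC: "X \<subseteq> C" and \<omega>: "\<omega> \<in> symmetric_differentials X m" and x0: "x0 \<in> \<Union>X"
  shows "\<exists>d Q N E. tangency_eqs X \<omega> x0 d Q N E"
proof -
  have XP: "X \<subseteq> proj_space" using XC C_proj by blast
  have x0C: "x0 \<in> \<Union>C" using x0 XC by blast
  from invariant_field_chart[OF x0C] obtain a \<mu> \<tau> where \<mu>: "\<forall>j. hom_poly a (\<lambda>u. \<mu> u $ j)"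
    and \<tau>: "\<forall>j. (\<lambda>z. \<tau> (fst z) (snd z) $ j) \<in> polyp" "\<forall>c u v. \<tau> (c *s u) v = c ^ a *s \<tau> u v" and \<mu>0: "\<mu> x0 \<noteq> 0"
    and ch: "\<forall>u\<in>\<Union>C. \<mu> u \<noteq> 0 \<longrightarrow> cls (\<mu> u) = cls u \<and> (\<forall>v. \<tau> u v \<in> tancone C (\<mu> u) \<and>
       invariant_field v (cls u) = der C (\<mu> u) (\<tau> u v))"
    by (elim exE conjE)
  have \<mu>X: "\<mu> u \<in> \<Union>X" "cls (\<mu> u) = cls u" if "u \<in> \<Union>X" "\<mu> u \<noteq> 0" for u
  proof -
    have "u \<in> \<Union>C" using that(1) XC by blast
    then show e: "cls (\<mu> u) = cls u" using ch that(2) by blast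
    show "\<mu> u \<in> \<Union>X" using mem_Union_cls[OF XP, of u] mem_Union_cls[OF XP, of "\<mu> u"] that(1) e by simp
  qed
  from symmetric_differential_local[OF XP \<omega> \<mu>X(1)[OF x0 \<mu>0]]
  obtain A P Q B P' Q' e R and r :: nat where R: "hom_poly e R" "R (\<mu> x0) \<noteq> 0"
    and PQ: "\<forall>i<r. hom_poly (A i) (P i) \<and> hom_poly (A i) (Q i) \<and> (\<forall>j<m. hom_poly (B i j) (P' i j) \<and> hom_poly (B i j) (Q' i j))"
    and loc: "\<forall>p\<in>\<Union>X. R p \<noteq> 0 \<longrightarrow> (\<forall>i<r. Q i p \<noteq> 0 \<and> (\<forall>j<m. Q' i j p \<noteq> 0)) \<and>
       (\<forall>w\<in>tancone X p. \<omega> (cls p) (der X p w) = (\<Sum>i<r. P i p / Q i p * (\<Prod>j<m. qder (P' i j) (Q' i j) p w)))"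
    by (elim exE conjE)
  have nz0: "\<forall>i<r. Q i (\<mu> x0) \<noteq> 0 \<and> (\<forall>j<m. Q' i j (\<mu> x0) \<noteq> 0)" using loc \<mu>X(1)[OF x0 \<mu>0] R(2) by blast
  define \<rho> where "\<rho> u v = (\<Sum>i<r. P i (\<mu> u) / Q i (\<mu> u) * (\<Prod>j<m. qder (P' i j) (Q' i j) (\<mu> u) (\<tau> u v)))" for u v
  have "param_frac x0 \<rho>"
    unfolding \<rho>_def
  proof (intro param_frac_sum param_frac_mult param_frac_prod)
    fix i assume i: "i \<in> {..<r}"
    show "param_frac x0 (\<lambda>u v. P i (\<mu> u) / Q i (\<mu> u))"
      by (rule param_frac_quotient[OF spec[OF \<mu>], of "A i"]) (use i PQ nz0 in auto)
    fix j assume j: "j \<in> {..<m}"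
    show "param_frac x0 (\<lambda>u v. qder (P' i j) (Q' i j) (\<mu> u) (\<tau> u v))"
      by (rule param_frac_qder[OF spec[OF \<mu>] spec[OF \<tau>(1)] \<tau>(2)[rule_format], of "B i j"]) (use i j PQ nz0 in auto)
  qed
  then obtain d Q0 N where N: "hom_poly d Q0" "Q0 x0 \<noteq> 0" "N \<in> polyp" "\<forall>c u v. N (c *s u, v) = c ^ d * N (u, v)"
    "\<forall>u v. Q0 u \<noteq> 0 \<longrightarrow> \<rho> u v * Q0 u = N (u, v)" unfolding param_frac_def by (elim exE conjE)
  obtain j where j: "\<mu> x0 $ j \<noteq> 0" using \<mu>0 by (auto simp: vec_eq_iff)
  have "x0 \<noteq> 0" using x0 XP proj_point(2) by blast
  then obtain i where i: "x0 $ i \<noteq> 0" by (auto simp: vec_eq_iff)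
  \<comment> \<open>The first factor makes the local expression valid, the second makes
    \<open>\<mu> u\<close> nonzero, and the last makes the denominator vanish at 0.\<close>
  define S where "S u = R (\<mu> u) * (\<mu> u $ j * u $ i)" for u
  define s where "s = a * e + (a + 1)"
  have S: "hom_poly s S" unfolding S_def s_def
    by (intro hom_poly_mult hom_poly_comp[OF R(1)] spec[OF \<mu>] hom_poly_coord)
  define QQ where "QQ u = Q0 u * S u" for u
  define NN where "NN z = N z * S (fst z)" for z
  have QQ: "hom_poly (d + s) QQ" unfolding QQ_def by (rule hom_poly_mult[OF N(1) S])
  have QQ0: "QQ x0 \<noteq> 0" "QQ 0 = 0" using N(2) R(2) i j by (simp_all add: QQ_def S_def)
  have NN: "NN \<in> polyp" unfolding NN_def by (intro alg.mult N(3) polyp_of_polyf hom_poly_polyf[OF S])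
  have NNs: "\<forall>c u v. NN (c *s u, v) = c ^ (d + s) * NN (u, v)"
    using N(4) hom_poly_scale[OF S] by (simp add: NN_def power_add)
  define \<F> where "\<F> = (\<lambda>F z. dder F (fst z) (snd z)) ` vanishing X"
  have cont: "continuous_on UNIV G" if G: "G \<in> \<F>" for G
  proof -
    obtain F where F: "F \<in> vanishing X" "G = (\<lambda>z. dder F (fst z) (snd z))" using G unfolding \<F>_def by blast
    show ?thesis unfolding F(2) by (rule polyp_continuous[OF dder_polyp[OF vanishing_polyf[OF F(1)]]])
  qed
  \<comment> \<open>The countable choice is made on all pairs of point and direction, before
    substitution, so one family of equations works for every \<open>v\<close>.\<close>
  have "\<exists>\<G>. countable \<G> \<and> \<G> \<subseteq> \<F> \<and> (\<forall>z. (\<forall>F\<in>\<G>. F z = 0) \<longleftrightarrow> (\<forall>F\<in>\<F>. F z = 0))"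
    by (rule countable_equations) (rule cont)
  then obtain \<G> where \<G>: "countable \<G>" "\<G> \<subseteq> \<F>" "\<forall>z. (\<forall>F\<in>\<G>. F z = 0) \<longleftrightarrow> (\<forall>F\<in>\<F>. F z = 0)"
    by (elim exE conjE)
  define E where "E = (\<lambda>G z. G (\<mu> (fst z), \<tau> (fst z) (snd z))) ` \<G>"
  have "countable E" unfolding E_def using \<G>(1) by simp
  have Edest: "\<exists>F k. hom_poly k F \<and> g = (\<lambda>z. dder F (\<mu> (fst z)) (\<tau> (fst z) (snd z)))" if g: "g \<in> E" for g
  proof -
    obtain G where G: "G \<in> \<G>" "g = (\<lambda>z. G (\<mu> (fst z), \<tau> (fst z) (snd z)))" using g unfolding E_def by blast
    then obtain F where F: "F \<in> vanishing X" "G = (\<lambda>z. dder F (fst z) (snd z))" using \<G>(2) unfolding \<F>_def by blast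
    then obtain k where "hom_poly k F" by (auto simp: vanishing_def)
    then show ?thesis using G(2) F(2) by (intro exI[of _ F] exI[of _ k]) simp
  qed
  have mp: "(\<lambda>z. \<mu> (fst z) $ j) \<in> polyp" for j by (rule polyp_of_polyf[OF hom_poly_polyf[OF spec[OF \<mu>]]])
  have Ep: "g \<in> polyp \<and> (\<exists>k. \<forall>c u v. g (c *s u, v) = c ^ k * g (u, v))" if g: "g \<in> E" for g
  proof -
    obtain F k where F: "hom_poly k F" and gF: "g = (\<lambda>z. dder F (\<mu> (fst z)) (\<tau> (fst z) (snd z)))" using Edest[OF g] by (elim exE conjE)
    have "g \<in> polyp" unfolding gF by (rule dder_polyp_comp[OF hom_poly_polyf[OF F] mp spec[OF \<tau>(1)]])
    moreover have "\<forall>c u v. g (c *s u, v) = c ^ (a * k) * g (u, v)"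
      unfolding gF fst_conv snd_conv hom_vec_scale[OF spec[OF \<mu>]] \<tau>(2)[rule_format] dder_scale[OF F] power_mult by simp
    ultimately show ?thesis by (intro conjI exI[of _ "a * k"])
  qed
  have E_iff: "(\<forall>g\<in>E. g (u, v) = 0) \<longleftrightarrow> \<tau> u v \<in> tancone X (\<mu> u)" for u v
  proof -
    have "(\<forall>g\<in>E. g (u, v) = 0) \<longleftrightarrow> (\<forall>G\<in>\<G>. G (\<mu> u, \<tau> u v) = 0)" by (simp add: E_def)
    also have "\<dots> \<longleftrightarrow> (\<forall>G\<in>\<F>. G (\<mu> u, \<tau> u v) = 0)" by (rule spec[OF \<G>(3)])
    also have "\<dots> \<longleftrightarrow> (\<forall>F\<in>vanishing X. dder F (\<mu> u) (\<tau> u v) = 0)" by (simp add: \<F>_def)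
    also have "\<dots> \<longleftrightarrow> \<tau> u v \<in> tancone X (\<mu> u)" unfolding vanishing_def tancone_def by blast
    finally show ?thesis .
  qed
  have fin: "(cls u \<in> tangency X v \<longleftrightarrow> (\<forall>e\<in>E. e (u, v) = 0)) \<and>
       (cls u \<in> tangency X v \<longrightarrow> \<omega> (cls u) (field_on X v (cls u)) * QQ u = NN (u, v))" if u: "u \<in> \<Union>X" "QQ u \<noteq> 0" for u v
  proof -
    have m0: "\<mu> u \<noteq> 0" and Ru: "R (\<mu> u) \<noteq> 0" and Q0u: "Q0 u \<noteq> 0" using u(2) by (auto simp: QQ_def S_def)
    have uC: "u \<in> \<Union>C" using u(1) XC by blast
    have c: "cls (\<mu> u) = cls u" "\<tau> u v \<in> tancone C (\<mu> u)" "invariant_field v (cls u) = der C (\<mu> u) (\<tau> u v)"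
      using ch uC m0 by blast+
    note tc = tangency_chart[OF XC \<mu>X(1)[OF u(1) m0] c(2), unfolded c(1), OF c(3)]
    have "\<omega> (cls u) (field_on X v (cls u)) * QQ u = NN (u, v)" if t: "\<tau> u v \<in> tancone X (\<mu> u)"
    proof -
      have "\<omega> (cls (\<mu> u)) (der X (\<mu> u) (\<tau> u v)) = \<rho> u v"
        unfolding \<rho>_def using loc \<mu>X(1)[OF u(1) m0] Ru t by blast
      then have "\<omega> (cls u) (field_on X v (cls u)) = \<rho> u v" using tc(2)[OF t] c(1) by simp
      moreover have "\<rho> u v * Q0 u = N (u, v)" using N(5) Q0u by blast
      ultimately show ?thesis by (simp add: QQ_def NN_def)
    qed
    then show ?thesis using tc(1) E_iff by blast
  qed
  show ?thesis
    unfolding tangency_eqs_def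
  proof (intro exI conjI)
    show "hom_poly (d + s) QQ" by (rule QQ)
    show "E \<subseteq> polyp" "\<forall>e\<in>E. \<exists>k. \<forall>c u v. e (c *s u, v) = c ^ k * e (u, v)" using Ep by blast+
    show "\<forall>u\<in>\<Union>X. QQ u \<noteq> 0 \<longrightarrow> (\<forall>v. (cls u \<in> tangency X v \<longleftrightarrow> (\<forall>e\<in>E. e (u, v) = 0)) \<and>
       (cls u \<in> tangency X v \<longrightarrow> \<omega> (cls u) (field_on X v (cls u)) * QQ u = NN (u, v)))"
      using fin by blast
  qed (fact QQ0 NN NNs \<open>countable E\<close>)+
qed

end

lemma polyp_slice:
  assumes "N \<in> polyp" "\<And>c u. N (c *s u, v) = c ^ d * N (u, v)"
  shows "hom_poly d (\<lambda>u. N (u, v))"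
proof (rule hom_polyI)
  show "(\<lambda>u. N (u, v)) \<in> polyf"
    by (rule polyp_comp[OF assms(1), where f = "\<lambda>u. u" and g = "\<lambda>_. v"]) (simp_all add: polyf_coord alg.const)
qed (rule assms(2))

lemma differential_scale: "differential Y F x (tangent_scale c D) = tangent_scale c (differential Y F x D)"
  by (auto simp: differential_def tangent_scale_def fun_eq_iff)

lemma tangent_space_scale: "D \<in> tangent_space X x \<Longrightarrow> tangent_scale c D \<in> tangent_space X x"
  unfolding tangent_space_def tangent_scale_def by (auto simp: algebra_simps)

lemma symmetric_differential_scale:
  assumes \<omega>: "\<omega> \<in> symmetric_differentials X m" and x: "x \<in> X" and D: "D \<in> tangent_space X x"
  shows "\<omega> x (tangent_scale c D) = c ^ m * \<omega> x D"
proof -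
  obtain U f g and r :: nat where U: "openin (zariski_of X) U" "x \<in> U"
    "\<forall>y\<in>U. \<forall>i<r. regular_at X y (f i) \<and> (\<forall>j<m. regular_at X y (g i j))"
    "\<forall>y\<in>U. \<forall>D\<in>tangent_space X y. \<omega> y D = (\<Sum>i<r. f i y * (\<Prod>j<m. D (g i j)))"
    by (rule symmetric_differentialE[OF \<omega> x])
  have "\<omega> x (tangent_scale c D) = (\<Sum>i<r. f i x * (\<Prod>j<m. tangent_scale c D (g i j)))"
    using U(2,4) tangent_space_scale[OF D] by blast
  also have "\<dots> = c ^ m * (\<Sum>i<r. f i x * (\<Prod>j<m. D (g i j)))"
    by (simp add: tangent_scale_def prod.distrib sum_distrib_left mult_ac)
  finally show ?thesis using U(2,4) D by simp
qed

text \<open>Coordinates on pairs of a line parameter (\<open>None\<close>) and a vector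
  (\<open>Some i\<close>), the ambient space of a family of points over a line.\<close>

definition param_coord :: "'i option \<Rightarrow> complex \<times> (complex ^ 'i::finite) \<Rightarrow> complex" where
  "param_coord b z = (case b of None \<Rightarrow> fst z | Some i \<Rightarrow> snd z $ i)"

lemma param_coord_alg: "fst \<in> alg UNIV (range param_coord)" "(\<lambda>z. snd z $ i) \<in> alg UNIV (range param_coord)"
proof -
  have "param_coord None \<in> alg UNIV (range param_coord)" "param_coord (Some i) \<in> alg UNIV (range param_coord)"
    by (rule alg.gen[OF rangeI])+
  then show "fst \<in> alg UNIV (range param_coord)" "(\<lambda>z. snd z $ i) \<in> alg UNIV (range param_coord)"
    by (simp_all add: param_coord_def[abs_def])
qed

text \<open>If the degree were \<open>m + k\<close> with \<open>k > 0\<close>, multiplying by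
  \<open>s ^ k\<close> would give the reversed polynomial, whose value at 0 is the leading
  coefficient but whose limit is 0.\<close>

lemma degree_le_growth:
  fixes p :: "complex poly"
  assumes "((\<lambda>s. s ^ m * poly p (inverse s)) \<longlongrightarrow> l) (at 0)"
  shows "degree p \<le> m"
proof (rule ccontr)
  assume "\<not> degree p \<le> m"
  then obtain k where k: "degree p = m + k" "k > 0" by (metis less_imp_add_positive not_le)
  have "((\<lambda>s. s ^ k * (s ^ m * poly p (inverse s))) \<longlongrightarrow> 0 ^ k * l) (at 0)"
    by (intro tendsto_intros assms)
  moreover have "\<forall>\<^sub>F s in at 0. s ^ k * (s ^ m * poly p (inverse s)) = poly (reflect_poly p) s"
    unfolding eventually_at_filter
    by (rule always_eventually) (simp add: poly_reflect_poly_nz k(1) power_add mult_ac)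
  ultimately have "((\<lambda>s. poly (reflect_poly p) s) \<longlongrightarrow> 0) (at 0)"
    using k(2) by (simp add: tendsto_cong zero_power)
  moreover have "((\<lambda>s. poly (reflect_poly p) s) \<longlongrightarrow> poly (reflect_poly p) 0) (at 0)"
    by (intro tendsto_intros)
  ultimately have "poly (reflect_poly p) 0 = 0" using tendsto_unique[OF at_neq_bot] by blast
  then have "p = 0" by simp
  then show False using k by simp
qed

section \<open>The value of a differential along an invariant field\<close>

context abelian_coordinates
begin

lemma lift_scale: "lift (c *s v) = c *s lift v"
  by (simp add: lift_def vec_eq_iff sum_component sum_distrib_left mult.assoc)

lemma invariant_field_scale: "invariant_field (c *s v) x = tangent_scale c (invariant_field v x)"
  unfolding invariant_field_def lift_scale from_origin_def der_scale[OF C_proj origin(1) lift(1)] differential_scale ..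

text \<open>At a point of \<open>X\<close> off the locus some equation of the chart is nonzero;
  times the denominator of the chart, it defines a neighbourhood off the locus.\<close>

lemma tangency_closed:
  assumes XC: "X \<subseteq> C" and X: "closedin zariski X" and \<omega>: "\<omega> \<in> symmetric_differentials X m"
  shows "closedin zariski (tangency X v)"
proof -
  have XP: "X \<subseteq> proj_space" using XC C_proj by blast
  have top: "topspace (zariski_of X) = X" using XP by (auto simp: topspace_zariski)
  have "openin (zariski_of X) (X - tangency X v)"
  proof (subst openin_subopen, intro ballI)
    fix x assume x: "x \<in> X - tangency X v"
    then obtain x0 where x0: "x0 \<in> x" using XP proj_space_nonempty by blast
    have xc: "x = cls x0" and x0X: "x0 \<in> \<Union>X" using x x0 proj_point(1) XP by blast+
    obtain d Q N E where "tangency_eqs X \<omega> x0 d Q N E"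
      using tangency_equations[OF XC \<omega> x0X] by (elim exE)
    note T = tangency_eqsD[OF this]
    have "\<not> (\<forall>e\<in>E. e (x0, v) = 0)" using T(9)[OF x0X T(2)] x xc by blast
    then obtain e where e: "e \<in> E" "e (x0, v) \<noteq> 0" by blast
    obtain k where k: "\<forall>c u v. e (c *s u, v) = c ^ k * e (u, v)" using T(8)[OF e(1)] by (elim exE)
    have "hom_poly k (\<lambda>u. e (u, v))"
      by (rule polyp_slice) (use T(7) e(1) k in auto)
    then have R: "hom_poly (d + k) (\<lambda>u. Q u * e (u, v))" by (rule hom_poly_mult[OF T(1)])
    have "x \<in> X \<inter> basic_open (\<lambda>u. Q u * e (u, v))" using basic_open_iff[OF R _ x0] x XP T(2) e(2) by auto
    moreover have "X \<inter> basic_open (\<lambda>u. Q u * e (u, v)) \<subseteq> X - tangency X v"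
    proof
      fix y assume y: "y \<in> X \<inter> basic_open (\<lambda>u. Q u * e (u, v))"
      then obtain u where u: "u \<in> y" using XP proj_space_nonempty by blast
      have yc: "y = cls u" and uX: "u \<in> \<Union>X" using y u proj_point(1) XP by blast+
      have "Q u \<noteq> 0" "e (u, v) \<noteq> 0" using y u by (auto simp: basic_open_def)
      then show "y \<in> X - tangency X v" using T(9)[OF uX] yc y e(1) by blast
    qed
    ultimately show "\<exists>T. openin (zariski_of X) T \<and> x \<in> T \<and> T \<subseteq> X - tangency X v"
      by (intro exI[of _ "X \<inter> basic_open (\<lambda>u. Q u * e (u, v))"] conjI openin_basic_open_of[OF R])
  qed
  moreover have "tangency X v \<subseteq> X" by (auto simp: tangency_def)
  ultimately have "closedin (zariski_of X) (tangency X v)" unfolding closedin_def top by blast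
  then show ?thesis using X by (metis closedin_closed_subtopology)
qed

lemma value_regular:
  assumes XC: "X \<subseteq> C" and \<omega>: "\<omega> \<in> symmetric_differentials X m" and x: "x \<in> tangency X v"
  shows "regular_at (tangency X v) x (\<lambda>y. \<omega> y (field_on X v y))"
proof -
  have XP: "X \<subseteq> proj_space" using XC C_proj by blast
  have FX: "tangency X v \<subseteq> X" by (auto simp: tangency_def)
  then have FP: "tangency X v \<subseteq> proj_space" using XP by blast
  obtain x0 where x0: "x0 \<in> x" using x FP proj_space_nonempty by blast
  have x0X: "x0 \<in> \<Union>X" using x x0 FX by blast
  obtain d Q N E where "tangency_eqs X \<omega> x0 d Q N E"
      using tangency_equations[OF XC \<omega> x0X] by (elim exE)
    note T = tangency_eqsD[OF this]
  have "fraction_rep (tangency X v) x0 (\<lambda>y. \<omega> y (field_on X v y)) d (\<lambda>u. N (u, v)) Q"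
    unfolding fraction_rep_def
  proof (intro conjI ballI impI T(1,2))
    show "hom_poly d (\<lambda>u. N (u, v))" by (rule polyp_slice[OF T(4,5)])
    fix y u assume y: "y \<in> tangency X v" "u \<in> y" "Q u \<noteq> 0"
    have "y = cls u" "u \<in> \<Union>X" using y FX FP proj_point(1) by blast+
    then have "\<omega> y (field_on X v y) * Q u = N (u, v)" using T(10)[of u v] y by simp
    then show "\<omega> y (field_on X v y) = N (u, v) / Q u" using y(3) by (simp add: field_simps)
  qed
  then show ?thesis using regular_at_iff[OF FP x x0] by blast
qed

text \<open>This is \<open>G v\<close> of the introduction; the point may be chosen arbitrarily
  because the value is constant on a connected locus.\<close>

definition value_at :: "'i point set \<Rightarrow> ('i point \<Rightarrow> 'i tangent \<Rightarrow> complex) \<Rightarrow> complex ^ 'n \<Rightarrow> complex" where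
  "value_at X \<omega> v = (let x = (SOME x. x \<in> tangency X v) in \<omega> x (field_on X v x))"

lemma value_at:
  assumes XC: "X \<subseteq> C" and X: "closedin zariski X" and \<omega>: "\<omega> \<in> symmetric_differentials X m"
    and conn: "connectedin zariski (tangency X v)" and x: "x \<in> tangency X v"
  shows "\<omega> x (field_on X v x) = value_at X \<omega> v"
proof -
  have s: "(SOME x. x \<in> tangency X v) \<in> tangency X v" using x by (rule someI)
  show ?thesis unfolding value_at_def Let_def
    by (rule regular_constant[OF tangency_closed[OF XC X \<omega>] value_regular[OF XC \<omega>] conn x s])
qed

text \<open>Where the field of \<open>v\<close> is tangent, so is that of \<open>c *s v\<close>; the
  two values can be compared at one point.\<close>

lemma value_at_scale:
  assumes XC: "X \<subseteq> C" and X: "closedin zariski X" and \<omega>: "\<omega> \<in> symmetric_differentials X m"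
    and conn: "\<And>v. v \<noteq> 0 \<Longrightarrow> connectedin zariski (tangency X v)" and ne: "tangency X v \<noteq> {}"
    and v: "v \<noteq> 0" and c: "c \<noteq> 0"
  shows "value_at X \<omega> (c *s v) = c ^ m * value_at X \<omega> v"
proof -
  obtain x where x: "x \<in> tangency X v" using ne by blast
  then have "\<exists>D\<in>tangent_space X x. differential C (\<lambda>y. y) x D = invariant_field v x" and xX: "x \<in> X"
    by (auto simp: tangency_def)
  then obtain D where D: "D \<in> tangent_space X x" "differential C (\<lambda>y. y) x D = invariant_field v x" by (elim bexE)
  have D': "differential C (\<lambda>y. y) x (tangent_scale c D) = invariant_field (c *s v) x"
    unfolding differential_scale D(2) invariant_field_scale ..
  note f = tangency_field(2)[OF XC xX D]
  note f' = tangency_field[OF XC xX tangent_space_scale[OF D(1)] D']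
  have cv: "c *s v \<noteq> 0" using c v by (simp add: vec_eq_iff)
  have "value_at X \<omega> (c *s v) = \<omega> x (tangent_scale c D)"
    using value_at[OF XC X \<omega> conn[OF cv] f'(1)] f'(2) by simp
  also have "\<dots> = c ^ m * \<omega> x D" by (rule symmetric_differential_scale[OF \<omega> xX D(1)])
  also have "\<omega> x D = value_at X \<omega> v" using value_at[OF XC X \<omega> conn[OF v] x] f by simp
  finally show ?thesis .
qed

text \<open>Points of the loci over a sequence tending to \<open>v\<close> accumulate by compactness
  of the unit vectors of the cone. The equations are polynomial in point and parameter, so a limit
  point lies in the locus of \<open>v\<close>, and the chart \<open>N / Q\<close> around it carries
  the values to the limit.\<close>

lemma value_at_continuous:
  assumes XC: "X \<subseteq> C" and X: "closedin zariski X" and \<omega>: "\<omega> \<in> symmetric_differentials X m"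
    and conn: "\<And>v. v \<noteq> 0 \<Longrightarrow> connectedin zariski (tangency X v)" and ne: "\<And>v. v \<noteq> 0 \<Longrightarrow> tangency X v \<noteq> {}"
  shows "continuous_on (- {0}) (value_at X \<omega>)"
  unfolding continuous_on_sequentially
proof (intro allI ballI impI, elim conjE)
  fix f :: "nat \<Rightarrow> complex ^ 'n" and v :: "complex ^ 'n"
  assume v: "v \<in> - {0}" and f0: "\<forall>n. f n \<in> - {0}" and f: "f \<longlonglongrightarrow> v"
  have XP: "X \<subseteq> proj_space" using XC C_proj by blast
  define g where "g = value_at X \<omega> \<circ> f"
  show "(value_at X \<omega> \<circ> f) \<longlonglongrightarrow> value_at X \<omega> v"
  proof (rule ccontr)
    assume "\<not> (value_at X \<omega> \<circ> f) \<longlonglongrightarrow> value_at X \<omega> v"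
    \<comment> \<open>A subsequence stays away from the expected limit; a convergent choice of
      points along it will refute this.\<close>
    then obtain \<epsilon> where \<epsilon>: "\<epsilon> > 0" "\<forall>M. \<exists>n\<ge>M. dist (g n) (value_at X \<omega> v) \<ge> \<epsilon>"
      unfolding lim_sequentially g_def[symmetric] by (auto simp: not_less)
    then have "infinite {n. dist (g n) (value_at X \<omega> v) \<ge> \<epsilon>}" unfolding infinite_nat_iff_unbounded_le by simp
    then obtain r :: "nat \<Rightarrow> nat" where r: "strict_mono r" "\<And>n. dist (g (r n)) (value_at X \<omega> v) \<ge> \<epsilon>"
      using infinite_enumerate by (metis (mono_tags, lifting) mem_Collect_eq)
    have "\<exists>u. u \<in> \<Union>X \<and> norm u = 1 \<and> cls u \<in> tangency X (f (r n))" for n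
    proof -
      obtain x where x: "x \<in> tangency X (f (r n))" using ne f0 by blast
      then have xX: "x \<in> X" by (simp add: tangency_def)
      obtain u where u: "u \<in> x" "u \<in> \<Union>X" "norm u = 1" using unit_rep[OF XP xX] by blast
      have "x = cls u" using proj_point(1)[of x u] u XP xX by blast
      then show ?thesis using u x by blast
    qed
    then obtain u where u: "\<And>n. u n \<in> \<Union>X \<and> norm (u n) = 1 \<and> cls (u n) \<in> tangency X (f (r n))" by metis
    then have "\<forall>n. u n \<in> {v \<in> \<Union>X. norm v = 1}" by simp
    then obtain l s where l: "l \<in> {v \<in> \<Union>X. norm v = 1}" and s: "strict_mono s" "(u \<circ> s) \<longlonglongrightarrow> l"
      using unit_cone_compact[OF X] unfolding compact_def by blast
    have lX: "l \<in> \<Union>X" using l by simp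
    obtain d Q N E where "tangency_eqs X \<omega> l d Q N E"
      using tangency_equations[OF XC \<omega> lX] by (elim exE)
    note T = tangency_eqsD[OF this]
    define U where "U n = u (s n)" for n
    define V where "V n = f (r (s n))" for n
    have U: "U \<longlonglongrightarrow> l" using s(2) by (simp add: U_def[abs_def] o_def)
    have V: "V \<longlonglongrightarrow> v"
      using LIMSEQ_subseq_LIMSEQ[OF f strict_mono_o[OF r(1) s(1)]] by (simp add: V_def[abs_def] o_def)
    have UV: "(\<lambda>n. (U n, V n)) \<longlonglongrightarrow> (l, v)" by (rule tendsto_Pair[OF U V])
    have lim: "(\<lambda>n. P (U n, V n)) \<longlonglongrightarrow> P (l, v)" if "P \<in> polyp" for P
    proof -
      have "isCont P (l, v)" using polyp_continuous[OF that] by (simp add: continuous_on_eq_continuous_at)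
      then show ?thesis by (rule isCont_tendsto_compose[OF _ UV])
    qed
    have limQ: "(\<lambda>n. Q (U n)) \<longlonglongrightarrow> Q l"
    proof -
      have "isCont Q l" using polyf_continuous[OF hom_poly_polyf[OF T(1)]] by (simp add: continuous_on_eq_continuous_at)
      then show ?thesis by (rule isCont_tendsto_compose[OF _ U])
    qed
    have evQ: "\<forall>\<^sub>F n in sequentially. Q (U n) \<noteq> 0" using limQ T(2) by (rule tendsto_imp_eventually_ne)
    have UF: "U n \<in> \<Union>X" "cls (U n) \<in> tangency X (V n)" for n using u by (auto simp: U_def V_def)
    have "e (l, v) = 0" if e: "e \<in> E" for e
    proof -
      have "\<forall>\<^sub>F n in sequentially. e (U n, V n) = 0"
        using evQ by (rule eventually_mono) (use T(9)[OF UF(1)] UF(2) e in blast)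
      then have "(\<lambda>n. e (U n, V n)) \<longlonglongrightarrow> 0" by (rule tendsto_eventually)
      then show ?thesis using lim[of e] T(7) e LIMSEQ_unique by blast
    qed
    then have lF: "cls l \<in> tangency X v" using T(9)[OF lX T(2)] by blast
    have v0: "v \<noteq> 0" using v by simp
    have "\<omega> (cls l) (field_on X v (cls l)) * Q l = N (l, v)" by (rule T(10)[OF lX T(2) lF])
    then have "value_at X \<omega> v * Q l = N (l, v)"
      unfolding value_at[OF XC X \<omega> conn[OF v0] lF] .
    then have val: "value_at X \<omega> v = N (l, v) / Q l" using T(2) by (simp add: field_simps)
    have "\<forall>\<^sub>F n in sequentially. N (U n, V n) / Q (U n) = g (r (s n))"
      using evQ
    proof (rule eventually_mono)
      fix n assume q: "Q (U n) \<noteq> 0"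
      have V0: "V n \<noteq> 0" using f0 by (simp add: V_def)
      have "\<omega> (cls (U n)) (field_on X (V n) (cls (U n))) * Q (U n) = N (U n, V n)" by (rule T(10)[OF UF(1) q UF(2)])
      then have "value_at X \<omega> (V n) * Q (U n) = N (U n, V n)" using value_at[OF XC X \<omega> conn[OF V0] UF(2)] by simp
      then show "N (U n, V n) / Q (U n) = g (r (s n))" using q by (simp add: g_def V_def field_simps)
    qed
    moreover have "(\<lambda>n. N (U n, V n) / Q (U n)) \<longlonglongrightarrow> N (l, v) / Q l"
      by (intro tendsto_divide lim T(4) limQ T(2))
    ultimately have "(\<lambda>n. g (r (s n))) \<longlonglongrightarrow> value_at X \<omega> v" unfolding val by (metis (mono_tags) Lim_transform_eventually)
    then obtain n where "dist (g (r (s n))) (value_at X \<omega> v) < \<epsilon>" using \<epsilon>(1) unfolding lim_sequentially by blast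
    then show False using r(2)[of "s n"] by simp
  qed
qed

text \<open>Pairs of a parameter \<open>t\<close> and a vector over the locus of
  \<open>a + t *s b\<close> form an algebraic family, so the value is rational off a countable set
  and, being continuous, polynomial in \<open>t\<close>. The degree is read off at infinity, where
  homogeneity compares the line with its direction \<open>b\<close>.\<close>

lemma value_at_line:
  assumes XC: "X \<subseteq> C" and X: "closedin zariski X" and \<omega>: "\<omega> \<in> symmetric_differentials X m"
    and conn: "\<And>v. v \<noteq> 0 \<Longrightarrow> connectedin zariski (tangency X v)" and ne: "\<And>v. v \<noteq> 0 \<Longrightarrow> tangency X v \<noteq> {}"
    and ind: "\<And>t. a + t *s b \<noteq> 0" and b: "b \<noteq> 0"
  shows "\<exists>p. degree p \<le> m \<and> (\<forall>t. value_at X \<omega> (a + t *s b) = poly p t)"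
proof -
  have XP: "X \<subseteq> proj_space" using XC C_proj by blast
  define S where "S = {v \<in> \<Union>X. norm v = 1}"
  have S: "compact S" unfolding S_def by (rule unit_cone_compact[OF X])
  have "\<exists>dd Q N E. tangency_eqs X \<omega> x0 dd Q N E" if "x0 \<in> S" for x0
    by (rule tangency_equations[OF XC \<omega>]) (use that in \<open>simp add: S_def\<close>)
  then obtain dd Q N E where "\<And>x0. x0 \<in> S \<Longrightarrow> tangency_eqs X \<omega> x0 (dd x0) (Q x0) (N x0) (E x0)" by metis
  note gd = tangency_eqsD[OF this]
  have Qp: "Q x0 \<in> polyf" if "x0 \<in> S" for x0 by (rule hom_poly_polyf[OF gd(1)[OF that]])
  define W where "W x0 = {u. Q x0 u \<noteq> 0}" for x0
  have oW: "open (W x0)" if "x0 \<in> S" for x0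
  proof -
    have "open (Q x0 -` (- {0}))" using polyf_continuous[OF Qp[OF that]] open_vimage by blast
    moreover have "Q x0 -` (- {0}) = W x0" by (auto simp: W_def)
    ultimately show ?thesis by simp
  qed
  have "\<exists>T\<subseteq>S. finite T \<and> S \<subseteq> (\<Union>v\<in>T. W v)"
    by (rule compactE_image[OF S, of S W]) (use oW gd(2) in \<open>auto simp: W_def\<close>)
  then obtain T where T: "T \<subseteq> S" "finite T" "S \<subseteq> (\<Union>v\<in>T. W v)" by (elim exE conjE)
  obtain \<G> where \<G>: "countable \<G>" "\<G> \<subseteq> vanishing X" "\<forall>v. v \<noteq> 0 \<longrightarrow> v \<in> \<Union>X \<longleftrightarrow> (\<forall>F\<in>\<G>. F v = 0)"
    using closed_cone_equations[OF X] by (elim exE conjE)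
  define Y :: "(complex \<times> (complex ^ 'i) \<Rightarrow> complex) set" where "Y = range param_coord"
  define G where "G t = value_at X \<omega> (a + t *s b)" for t
  define L where "L P z = P (snd z, a + fst z *s b)" for P :: "(complex ^ 'i) \<times> (complex ^ 'n) \<Rightarrow> complex" and z :: "complex \<times> (complex ^ 'i)"
  have LP: "L P \<in> alg UNIV Y" if "P \<in> polyp" for P
    unfolding L_def Y_def
    by (rule polyp_comp[OF that param_coord_alg(2)]) (simp, intro alg.add alg.mult alg.const param_coord_alg UNIV_I)
  have FP: "(\<lambda>z. P (snd z)) \<in> alg UNIV Y" if "P \<in> polyf" for P
    unfolding Y_def by (rule polyf_comp[OF that param_coord_alg(2)])
  \<comment> \<open>Besides tangency the equations must force the vector onto the cone over
    \<open>X\<close>, since the chart describes tangency only there.\<close>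
  define EE where "EE x0 = L ` E x0 \<union> (\<lambda>F z. F (snd z)) ` \<G>" for x0
  have key: "snd z \<in> \<Union>X \<and> cls (snd z) \<in> tangency X (a + fst z *s b)"
    if "x0 \<in> S" "Q x0 (snd z) \<noteq> 0" "\<forall>e\<in>EE x0. e z = 0" for x0 z
  proof -
    have "snd z \<noteq> 0" using that(2) gd(3)[OF that(1)] by auto
    moreover have "\<forall>F\<in>\<G>. F (snd z) = 0" using that(3) by (simp add: EE_def ball_Un)
    ultimately have zX: "snd z \<in> \<Union>X" using \<G>(3) by blast
    have "\<forall>e\<in>E x0. L e z = 0" using that(3) by (simp add: EE_def ball_Un)
    then have "\<forall>e\<in>E x0. e (snd z, a + fst z *s b) = 0" by (simp add: L_def)
    then have "cls (snd z) \<in> tangency X (a + fst z *s b)" using gd(9)[OF that(1) zX that(2)] by blast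
    then show ?thesis using zX by blast
  qed
  have "\<exists>TT p q. countable TT \<and> q \<noteq> 0 \<and> (\<forall>t. t \<notin> TT \<longrightarrow> G t * poly q t = poly p t)"
  proof (rule algebraic_family_rational[where coords = param_coord and C = T and E = EE and N = "\<lambda>x0. L (N x0)"
        and D = "\<lambda>x0 z. Q x0 (snd z)" and ?b0.0 = None])
    show "\<exists>y. \<forall>b. param_coord b y = g b" for g :: "'i option \<Rightarrow> complex"
      by (rule exI[of _ "(g None, \<chi> i. g (Some i))"]) (simp add: param_coord_def split: option.split)
    show "countable T" using T(2) by (rule countable_finite)
    show "countable (EE x0) \<and> EE x0 \<subseteq> alg UNIV (range param_coord) \<and> L (N x0) \<in> alg UNIV (range param_coord) \<and>
        (\<lambda>z. Q x0 (snd z)) \<in> alg UNIV (range param_coord)" if "x0 \<in> T" for x0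
    proof -
      have x0: "x0 \<in> S" using that T(1) by blast
      have "countable (EE x0)" unfolding EE_def using gd(6)[OF x0] \<G>(1) by simp
      moreover have "EE x0 \<subseteq> alg UNIV Y"
        unfolding EE_def using gd(7)[OF x0] \<G>(2) vanishing_polyf by (intro Un_least image_subsetI LP FP) auto
      moreover have "L (N x0) \<in> alg UNIV Y" by (rule LP[OF gd(4)[OF x0]])
      ultimately show ?thesis using FP[OF Qp[OF x0]] unfolding Y_def by blast
    qed
    show "L (N x0) z = G (param_coord None z) * Q x0 (snd z)"
      if "x0 \<in> T" "Q x0 (snd z) \<noteq> 0" "\<forall>e\<in>EE x0. e z = 0" for x0 z
    proof -
      have x0: "x0 \<in> S" using that(1) T(1) by blast
      note k = key[OF x0 that(2,3)]
      have "\<omega> (cls (snd z)) (field_on X (a + fst z *s b) (cls (snd z))) * Q x0 (snd z) = N x0 (snd z, a + fst z *s b)"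
        by (rule gd(10)[OF x0 conjunct1[OF k] that(2) conjunct2[OF k]])
      moreover have "\<omega> (cls (snd z)) (field_on X (a + fst z *s b) (cls (snd z))) = G (fst z)"
        unfolding G_def by (rule value_at[OF XC X \<omega> conn[OF ind] conjunct2[OF k]])
      ultimately show ?thesis by (simp add: L_def param_coord_def)
    qed
    show "\<exists>x0\<in>T. \<exists>z. Q x0 (snd z) \<noteq> 0 \<and> (\<forall>e\<in>EE x0. e z = 0) \<and> param_coord None z = t" for t
    proof -
      obtain x where x: "x \<in> tangency X (a + t *s b)" using ne[OF ind] by blast
      then have xX: "x \<in> X" by (simp add: tangency_def)
      obtain u where u: "u \<in> x" "u \<in> \<Union>X" "norm u = 1" using unit_rep[OF XP xX] by blast
      have xc: "x = cls u" using proj_point(1)[of x u] u XP xX by blast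
      have "u \<in> S" using u by (simp add: S_def)
      then obtain x0 where x0: "x0 \<in> T" "Q x0 u \<noteq> 0" using T(3) by (auto simp: W_def)
      have x0S: "x0 \<in> S" using x0 T(1) by blast
      have "\<forall>e\<in>E x0. e (u, a + t *s b) = 0" using gd(9)[OF x0S u(2) x0(2)] x xc by blast
      moreover have "\<forall>F\<in>\<G>. F u = 0" using \<G>(2) u(2) by (auto simp: vanishing_def)
      ultimately have "\<forall>e\<in>EE x0. e (t, u) = 0" by (simp add: EE_def L_def ball_Un)
      then show ?thesis using x0 by (intro bexI[OF _ x0(1)] exI[of _ "(t, u)"]) (simp add: param_coord_def)
    qed
  qed
  then obtain TT p q where pq: "countable TT" "q \<noteq> 0" "\<And>t. t \<notin> TT \<Longrightarrow> G t * poly q t = poly p t" by blast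
  have cv: "continuous_on (- {0}) (value_at X \<omega>)" by (rule value_at_continuous[OF XC X \<omega> conn ne])
  have "continuous_on UNIV G" unfolding G_def
  proof (rule continuous_on_compose2[OF cv])
    have "(\<lambda>t. a + t *s b) = (\<lambda>t. \<chi> i. a $ i + t * b $ i)" by (simp add: vec_eq_iff fun_eq_iff)
    then show "continuous_on UNIV (\<lambda>t. a + t *s b)" by (simp only:) (intro continuous_intros)
  qed (use ind in auto)
  then have "\<exists>p. \<forall>t. G t = poly p t"
    by (rule continuous_rational_polynomial[OF _ pq(1,2)]) (rule pq(3))
  then obtain P where P: "\<forall>t. G t = poly P t" by (elim exE)
  \<comment> \<open>By homogeneity the expression is the value at \<open>s *s a + b\<close>, which
    tends to the value at \<open>b\<close>.\<close>
  have "((\<lambda>s. s ^ m * poly P (inverse s)) \<longlongrightarrow> value_at X \<omega> b) (at 0)"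
  proof (rule Lim_transform_eventually)
    have eq: "(\<lambda>s. s *s a + b) = (\<lambda>s. \<chi> i. s * a $ i + b $ i)" by (simp add: vec_eq_iff fun_eq_iff)
    have "((\<lambda>s. s *s a + b) \<longlongrightarrow> (\<chi> i. 0 * a $ i + b $ i)) (at 0)" unfolding eq by (intro tendsto_intros)
    then have "((\<lambda>s. s *s a + b) \<longlongrightarrow> b) (at 0)" by simp
    moreover have "isCont (value_at X \<omega>) b"
      using cv b by (simp add: continuous_on_eq_continuous_at open_Compl)
    ultimately show "((\<lambda>s. value_at X \<omega> (s *s a + b)) \<longlongrightarrow> value_at X \<omega> b) (at 0)"
      by (intro isCont_tendsto_compose[where g = "value_at X \<omega>"])
    show "\<forall>\<^sub>F s in at 0. value_at X \<omega> (s *s a + b) = s ^ m * poly P (inverse s)"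
      unfolding eventually_at_filter
    proof (rule always_eventually, intro allI impI)
      fix s :: complex assume s: "s \<noteq> 0"
      have e: "s *s a + b = s *s (a + inverse s *s b)" using s by (simp add: vec_eq_iff algebra_simps)
      have "value_at X \<omega> (s *s (a + inverse s *s b)) = s ^ m * value_at X \<omega> (a + inverse s *s b)"
        by (rule value_at_scale[OF XC X \<omega> conn ne[OF ind] ind s])
      then show "value_at X \<omega> (s *s a + b) = s ^ m * poly P (inverse s)" unfolding e using P by (simp add: G_def)
    qed
  qed
  then have "degree P \<le> m" by (rule degree_le_growth)
  then show ?thesis using P by (intro exI[of _ P]) (simp add: G_def)
qed

end

lemma tangent_space_zero: "0 \<in> tangent_space X x"
  unfolding tangent_space_def by simp

lemma differential_zero: "differential Y F x 0 = 0"
  by (auto simp: differential_def fun_eq_iff)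

section \<open>Differentials are polynomials in the coordinates of a tangent vector\<close>

text \<open>Lists of terms replace the indexed families of \<open>symmetric_differentials\<close>,
  so that sums concatenate and products combine without reindexing. \<open>V\<close> is fixed: all
  operations take place on one neighbourhood.\<close>

definition is_local_form ::
  "'i::finite point set \<Rightarrow> 'i point set \<Rightarrow> nat \<Rightarrow> ('i point \<Rightarrow> 'i tangent \<Rightarrow> complex) \<Rightarrow> bool" where
  "is_local_form X V m \<eta> \<longleftrightarrow> (\<exists>xs. (\<forall>(f, gs)\<in>set xs. length gs = m \<and> (\<forall>y\<in>V. regular_at X y f \<and> (\<forall>g\<in>set gs. regular_at X y g))) \<and>
     (\<forall>y\<in>V. \<forall>D\<in>tangent_space X y. \<eta> y D = (\<Sum>(f, gs)\<leftarrow>xs. f y * (\<Prod>g\<leftarrow>gs. D g))))"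

lemma is_local_form_add:
  assumes "is_local_form X V m \<eta>" "is_local_form X V m \<theta>"
  shows "is_local_form X V m (\<lambda>y D. \<eta> y D + \<theta> y D)"
proof -
  from assms(1) obtain xs where xs: "\<forall>(f, gs)\<in>set xs. length gs = m \<and> (\<forall>y\<in>V. regular_at X y f \<and> (\<forall>g\<in>set gs. regular_at X y g))"
     "\<forall>y\<in>V. \<forall>D\<in>tangent_space X y. \<eta> y D = (\<Sum>(f, gs)\<leftarrow>xs. f y * (\<Prod>g\<leftarrow>gs. D g))"
    unfolding is_local_form_def by (elim exE conjE)
  from assms(2) obtain ys where ys: "\<forall>(f, gs)\<in>set ys. length gs = m \<and> (\<forall>y\<in>V. regular_at X y f \<and> (\<forall>g\<in>set gs. regular_at X y g))"
     "\<forall>y\<in>V. \<forall>D\<in>tangent_space X y. \<theta> y D = (\<Sum>(f, gs)\<leftarrow>ys. f y * (\<Prod>g\<leftarrow>gs. D g))"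
    unfolding is_local_form_def by (elim exE conjE)
  show ?thesis unfolding is_local_form_def using xs ys
    by (intro exI[of _ "xs @ ys"]) (simp add: ball_Un)
qed

lemma regular_at_mult:
  assumes "X \<subseteq> proj_space" "x \<in> X" "regular_at X x f" "regular_at X x g"
  shows "regular_at X x (\<lambda>y. f y * g y)"
proof -
  obtain v where v: "v \<in> x" using assms(1,2) proj_space_nonempty by blast
  note r = regular_at_iff[OF assms(1,2) v]
  from assms(3)[unfolded r] obtain d P Q where f: "fraction_rep X v f d P Q" by (elim exE)
  from assms(4)[unfolded r] obtain e P' Q' where g: "fraction_rep X v g e P' Q'" by (elim exE)
  show ?thesis unfolding r by (intro exI) (rule fraction_rep_mult[OF f g])
qed

lemma regular_at_const:
  assumes "X \<subseteq> proj_space" "x \<in> X"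
  shows "regular_at X x (\<lambda>_. c)"
proof -
  obtain v where v: "v \<in> x" using assms proj_space_nonempty by blast
  show ?thesis unfolding regular_at_iff[OF assms v] by (intro exI) (rule fraction_rep_const)
qed

lemma is_local_form_mult:
  assumes X: "X \<subseteq> proj_space" and V: "V \<subseteq> X" and "is_local_form X V m \<eta>" "is_local_form X V n \<theta>"
  shows "is_local_form X V (m + n) (\<lambda>y D. \<eta> y D * \<theta> y D)"
proof -
  from assms(3) obtain xs where xs: "\<forall>(f, gs)\<in>set xs. length gs = m \<and> (\<forall>y\<in>V. regular_at X y f \<and> (\<forall>g\<in>set gs. regular_at X y g))"
     "\<forall>y\<in>V. \<forall>D\<in>tangent_space X y. \<eta> y D = (\<Sum>(f, gs)\<leftarrow>xs. f y * (\<Prod>g\<leftarrow>gs. D g))"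
    unfolding is_local_form_def by (elim exE conjE)
  from assms(4) obtain ys where ys: "\<forall>(f, gs)\<in>set ys. length gs = n \<and> (\<forall>y\<in>V. regular_at X y f \<and> (\<forall>g\<in>set gs. regular_at X y g))"
     "\<forall>y\<in>V. \<forall>D\<in>tangent_space X y. \<theta> y D = (\<Sum>(f, gs)\<leftarrow>ys. f y * (\<Prod>g\<leftarrow>gs. D g))"
    unfolding is_local_form_def by (elim exE conjE)
  define mm :: "('a point \<Rightarrow> complex) \<times> ('a point \<Rightarrow> complex) list \<Rightarrow> _ \<Rightarrow> ('a point \<Rightarrow> complex) \<times> ('a point \<Rightarrow> complex) list"
    where "mm x z = (\<lambda>y. fst x y * fst z y, snd x @ snd z)" for x z
  define val where "val y D x = fst x y * (\<Prod>g\<leftarrow>snd x. D g)" for y D and x :: "('a point \<Rightarrow> complex) \<times> ('a point \<Rightarrow> complex) list"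
  define zs where "zs = concat (map (\<lambda>x. map (mm x) ys) xs)"
  have ve: "val y D = (\<lambda>(f, gs). f y * (\<Prod>g\<leftarrow>gs. D g))" for y D
    by (simp add: val_def fun_eq_iff case_prod_beta)
  have one: "(\<Sum>z\<leftarrow>ys. val y D (mm x z)) = val y D x * (\<Sum>z\<leftarrow>ys. val y D z)" for x y D ys
    by (induction ys) (simp_all add: val_def mm_def algebra_simps)
  have two: "(\<Sum>z\<leftarrow>concat (map (\<lambda>x. map (mm x) ys) xs). val y D z) = (\<Sum>x\<leftarrow>xs. val y D x) * (\<Sum>z\<leftarrow>ys. val y D z)" for y D xs
    by (induction xs) (simp_all add: one[unfolded o_def] distrib_right o_def)
  have reg: "length (snd z) = m + n \<and> (\<forall>y\<in>V. regular_at X y (fst z) \<and> (\<forall>g\<in>set (snd z). regular_at X y g))" if z: "z \<in> set zs" for z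
  proof -
    obtain x w where xw: "x \<in> set xs" "w \<in> set ys" "z = mm x w" using z by (auto simp: zs_def)
    have x: "length (snd x) = m" "\<forall>y\<in>V. regular_at X y (fst x) \<and> (\<forall>g\<in>set (snd x). regular_at X y g)"
      using bspec[OF xs(1) xw(1)] by (simp_all add: case_prod_beta)
    have w: "length (snd w) = n" "\<forall>y\<in>V. regular_at X y (fst w) \<and> (\<forall>g\<in>set (snd w). regular_at X y g)"
      using bspec[OF ys(1) xw(2)] by (simp_all add: case_prod_beta)
    have "regular_at X y (\<lambda>y. fst x y * fst w y)" if "y \<in> V" for y
      using regular_at_mult[OF X, of y "fst x" "fst w"] that V x(2) w(2) by blast
    then show ?thesis using x w unfolding xw(3) mm_def by (simp add: ball_Un)
  qed
  have "\<eta> y D * \<theta> y D = (\<Sum>z\<leftarrow>zs. val y D z)" if "y \<in> V" "D \<in> tangent_space X y" for y D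
    unfolding zs_def two unfolding ve using xs(2) ys(2) that by simp
  then show ?thesis unfolding is_local_form_def using reg
    by (intro exI[of _ zs]) (simp add: case_prod_beta[abs_def] val_def[abs_def])
qed

lemma is_local_form_const:
  assumes "X \<subseteq> proj_space" "V \<subseteq> X"
  shows "is_local_form X V 0 (\<lambda>_ _. c)"
  unfolding is_local_form_def using assms regular_at_const[of X _ c]
  by (intro exI[of _ "[(\<lambda>_. c, [])]"]) auto

lemma is_local_form_one:
  assumes "\<And>y. y \<in> V \<Longrightarrow> regular_at X y f \<and> regular_at X y g"
  shows "is_local_form X V 1 (\<lambda>y D. f y * D g)"
  unfolding is_local_form_def using assms by (intro exI[of _ "[(f, [g])]"]) simp

lemma is_local_form_zero: "is_local_form X V m (\<lambda>_ _. 0)"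
  unfolding is_local_form_def by (intro exI[of _ "[]"]) simp

lemma is_local_form_sum:
  assumes "\<And>i. i \<in> I \<Longrightarrow> is_local_form X V m (\<eta> i)"
  shows "is_local_form X V m (\<lambda>y D. \<Sum>i\<in>I. \<eta> i y D)"
  using assms by (induction I rule: infinite_finite_induct) (simp_all add: is_local_form_zero is_local_form_add)

lemma is_local_form_power:
  assumes "X \<subseteq> proj_space" "V \<subseteq> X" "is_local_form X V 1 \<eta>"
  shows "is_local_form X V k (\<lambda>y D. \<eta> y D ^ k)"
proof (induction k)
  case 0
  then show ?case using is_local_form_const[OF assms(1,2), of 1] by simp
next
  case (Suc k)
  then show ?case using is_local_form_mult[OF assms(1,2,3) Suc] by simp
qed

lemma is_local_form_prod:
  assumes "X \<subseteq> proj_space" "V \<subseteq> X" "\<And>j. j \<in> J \<Longrightarrow> is_local_form X V (k j) (\<eta> j)"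
  shows "is_local_form X V (sum k J) (\<lambda>y D. \<Prod>j\<in>J. \<eta> j y D)"
  using assms(3)
proof (induction J rule: infinite_finite_induct)
  case (insert j J)
  then show ?case using is_local_form_mult[OF assms(1,2), of "k j" "\<eta> j" "sum k J" "\<lambda>y D. \<Prod>j\<in>J. \<eta> j y D"] by simp
qed (use is_local_form_const[OF assms(1,2), of 1] in simp_all)

lemma is_local_form_hom_poly:
  fixes \<phi> :: "'i::finite point \<Rightarrow> 'i tangent \<Rightarrow> complex ^ 'n::finite"
  assumes X: "X \<subseteq> proj_space" "V \<subseteq> X" and \<phi>: "\<And>j. is_local_form X V 1 (\<lambda>y D. \<phi> y D $ j)" and P: "hom_poly m P"
  shows "is_local_form X V m (\<lambda>y D. P (\<phi> y D))"
proof -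
  obtain c where c: "P = (\<lambda>v. \<Sum>k | sum k UNIV = m. c k * monomial_at k v)" using P unfolding hom_poly_def by blast
  have "is_local_form X V m (\<lambda>y D. c k * monomial_at k (\<phi> y D))" if "sum k UNIV = m" for k
  proof -
    have "is_local_form X V (sum k UNIV) (\<lambda>y D. \<Prod>j\<in>UNIV. (\<phi> y D $ j) ^ k j)"
      by (intro is_local_form_prod X is_local_form_power \<phi>)
    from is_local_form_mult[OF X is_local_form_const[OF X, of "c k"] this] show ?thesis
      by (simp add: monomial_at_def that)
  qed
  then show ?thesis unfolding c by (intro is_local_form_sum) simp
qed

lemma symmetric_differentialI:
  assumes X: "X \<subseteq> proj_space" and out: "\<And>x D. \<not> (x \<in> X \<and> D \<in> tangent_space X x) \<Longrightarrow> \<omega> x D = 0"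
    and loc: "\<And>x. x \<in> X \<Longrightarrow> \<exists>U. openin (zariski_of X) U \<and> x \<in> U \<and> is_local_form X U m \<omega>"
  shows "\<omega> \<in> symmetric_differentials X m"
  unfolding symmetric_differentials_def
proof (intro CollectI conjI allI impI ballI)
  fix x assume "x \<in> X"
  from loc[OF this] obtain U where U: "openin (zariski_of X) U" "x \<in> U" "is_local_form X U m \<omega>" by (elim exE conjE)
  from U(3) obtain xs where xs: "\<forall>(f, gs)\<in>set xs. length gs = m \<and> (\<forall>y\<in>U. regular_at X y f \<and> (\<forall>g\<in>set gs. regular_at X y g))"
     "\<forall>y\<in>U. \<forall>D\<in>tangent_space X y. \<omega> y D = (\<Sum>(f, gs)\<leftarrow>xs. f y * (\<Prod>g\<leftarrow>gs. D g))"
    unfolding is_local_form_def by (elim exE conjE)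
  have el: "length (snd (xs ! i)) = m" "\<forall>y\<in>U. regular_at X y (fst (xs ! i)) \<and> (\<forall>g\<in>set (snd (xs ! i)). regular_at X y g)"
    if "i < length xs" for i
    using bspec[OF xs(1) nth_mem[OF that]] by (simp_all add: case_prod_beta)
  have pl: "(\<Prod>g\<leftarrow>gs. D g) = (\<Prod>j<length gs. D (gs ! j))" for D :: "'a tangent" and gs
    by (simp add: prod.list_conv_set_nth atLeast0LessThan)
  have "(\<Sum>(f, gs)\<leftarrow>xs. f y * (\<Prod>g\<leftarrow>gs. D g)) = (\<Sum>i<length xs. fst (xs ! i) y * (\<Prod>j<m. D (snd (xs ! i) ! j)))" for y and D :: "'a tangent"
    by (simp add: sum.list_conv_set_nth atLeast0LessThan case_prod_beta pl el(1))
  then show "\<exists>U (r::nat) f g. openin (zariski_of X) U \<and> x \<in> U \<and>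
        (\<forall>y\<in>U. \<forall>i<r. regular_at X y (f i) \<and> (\<forall>j<m. regular_at X y (g i j))) \<and>
        (\<forall>y\<in>U. \<forall>D\<in>tangent_space X y. \<omega> y D = (\<Sum>i<r. f i y * (\<Prod>j<m. D (g i j))))"
    using U(1,2) xs(2) el
    by (intro exI[of _ U] exI[of _ "length xs"] exI[of _ "\<lambda>i. fst (xs ! i)"] exI[of _ "\<lambda>i j. snd (xs ! i) ! j"]) simp
qed (use out in blast)

section \<open>Regularity of the invariant differentials\<close>

context abelian_coordinates
begin

lemma phi_zero: "\<phi> 0 = 0"
proof -
  have "tangent_scale 0 0 = (0 :: 'i tangent)" by (simp add: tangent_scale_def fun_eq_iff)
  then show ?thesis using phi_scale[OF tangent_space_zero, of 0] by simp
qed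

text \<open>Linear forms on the tangent directions extend to the whole space. The extension is read
  off from a left inverse of the matrix with columns \<open>origin\<close> and the lifted basis,
  which is injective because the lifts are independent modulo the radial direction.\<close>

lemma phi_component:
  "\<exists>l. \<forall>z\<in>tancone C origin. \<forall>j. \<phi> (der C origin z) $ j = (\<Sum>i\<in>UNIV. l j i * z $ i)"
proof -
  \<comment> \<open>\<open>None\<close> is the column of the radial direction, which
    \<open>\<phi>\<close> does not see.\<close>
  define M :: "complex ^ ('n option) ^ 'i" where "M = (\<chi> i k. case k of None \<Rightarrow> origin $ i | Some j \<Rightarrow> basis_lift j $ i)"
  define part where "part v = (\<chi> j. v $ Some j)" for v :: "complex ^ ('n option)"
  have Mv: "M *v v = lift (part v) + v $ None *s origin" for v
  proof -
    have "(\<Sum>k\<in>UNIV. f k) = f None + (\<Sum>j\<in>UNIV. f (Some j))" for f :: "'n option \<Rightarrow> complex"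
      by (simp add: UNIV_option_conv sum.reindex o_def)
    then show ?thesis
      by (simp add: M_def lift_def part_def matrix_vector_mult_def vec_eq_iff sum_component mult.commute)
  qed
  have o0: "origin \<noteq> 0" using origin(1) C_proj proj_point(2) by blast
  have "inj ((*v) M)"
  proof (rule injI)
    fix v w assume "M *v v = M *v w"
    then have d: "M *v (v - w) = 0" by (simp add: matrix_vector_mult_diff_distrib)
    define z where "z = v - w"
    have z: "lift (part z) = (- (z $ None)) *s origin" using d unfolding z_def[symmetric] Mv by (simp add: vec_eq_iff add_eq_0_iff)
    have "der C origin (lift (part z)) = tangent_scale (- (z $ None)) 0"
      unfolding z der_scale[OF C_proj origin(1) tancone_self[OF origin(1)]] der_self[OF C_proj origin(1)] ..
    also have "\<dots> = 0" by (simp add: tangent_scale_def fun_eq_iff)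
    finally have p0: "part z = 0" using lift(2)[of "part z"] phi_zero by simp
    then have "lift (part z) = 0" by (simp add: lift_def)
    then have "z $ None = 0" using z o0 by (auto simp: vec_eq_iff)
    moreover have "z $ Some j = 0" for j using p0 by (simp add: part_def vec_eq_iff)
    ultimately have "z $ k = 0" for k by (cases k) auto
    then have "z = 0" by (simp add: vec_eq_iff)
    then show "v = w" by (simp add: z_def)
  qed
  then obtain B where B: "B ** M = mat 1" using matrix_left_invertible_injective[of M] by blast
  have "\<phi> (der C origin z) $ j = (\<Sum>i\<in>UNIV. B $ Some j $ i * z $ i)" if z: "z \<in> tancone C origin" for z j
  proof -
    define v where "v = \<phi> (der C origin z)"
    have "der C origin z = der C origin (lift v)"
      using phi_inj[OF der_origin_T0[OF z] der_origin_T0[OF lift(1)]] lift(2)[of v] by (simp add: v_def)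
    then obtain c where c: "z = lift v + c *s origin" using der_eq_iff[OF C_proj origin(1) z lift(1)] by blast
    define v' where "v' = (\<chi> k. case k of None \<Rightarrow> c | Some j \<Rightarrow> v $ j)"
    have "part v' = v" "v' $ None = c" by (simp_all add: part_def v'_def vec_eq_iff)
    then have "M *v v' = z" unfolding Mv c by simp
    then have "B *v z = v'" using B by (metis matrix_vector_mul_assoc matrix_vector_mul_lid)
    then have "(B *v z) $ Some j = v $ j" by (simp add: v'_def)
    then show ?thesis by (simp add: matrix_vector_mult_def v_def)
  qed
  then show ?thesis by (intro exI[of _ "\<lambda>j i. B $ Some j $ i"]) blast
qed

lemma inverse_chart:
  assumes v: "v \<in> \<Union>C"
  shows "\<exists>d f. (\<forall>j. hom_poly d (\<lambda>u. f u $ j)) \<and> f v \<noteq> 0 \<and>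
    (\<forall>u\<in>\<Union>C. f u \<noteq> (0 :: complex ^ 'i) \<longrightarrow> inv\<^bsub>A\<^esub> (cls u) = cls (f u))"
proof -
  obtain x where x: "x \<in> C" "v \<in> x" using v by blast
  have "morphism_to_proj C (\<lambda>x. inv\<^bsub>A\<^esub> x)" using abelian by (simp add: abelian_variety_def)
  from bspec[OF this[unfolded morphism_to_proj_def] x(1)]
  obtain d f where f: "\<forall>j. hom_poly d (\<lambda>v. f v $ j)" "\<forall>v\<in>x. f v \<noteq> 0"
    "\<forall>y\<in>C. \<forall>v\<in>y. f v \<noteq> (0 :: complex ^ 'i) \<longrightarrow> inv\<^bsub>A\<^esub> y = cls (f v)"
    by (elim exE conjE)
  have "inv\<^bsub>A\<^esub> (cls u) = cls (f u)" if u: "u \<in> \<Union>C" "f u \<noteq> 0" for u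
  proof -
    have "cls u \<in> C" using u mem_Union_cls[OF C_proj] by blast
    from f(3)[rule_format, OF this cls_mem u(2)] show ?thesis .
  qed
  then show ?thesis using f(1) f(2)[rule_format, OF x(2)]
    by (intro exI[of _ d] exI[of _ f]) simp
qed

text \<open>Translation to the origin is lifted by \<open>f (\<iota> u)\<close>, which sends
  \<open>u\<close> itself to a multiple \<open>\<kappa>\<close> of \<open>origin\<close>. Its
  Jacobian followed by a linear form of \<open>phi_component\<close> is a linear form
  \<open>\<theta>\<close> in the direction, which kills \<open>u\<close> by Euler's identity and is
  therefore a combination of differentials of affine coordinates.\<close>

lemma to_origin_local_form:
  assumes x: "x \<in> C"
  shows "\<exists>U. openin (zariski_of C) U \<and> x \<in> U \<and> U \<subseteq> C \<and> (\<forall>j. is_local_form C U 1 (\<lambda>y D. \<phi> (to_origin y D) $ j))"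
proof -
  obtain x0 where x0: "x0 \<in> x" "x0 \<in> \<Union>C" "x = cls x0" using point_rep[OF x] by blast
  from inverse_chart[OF x0(2)] obtain a \<iota> where \<iota>: "\<forall>j. hom_poly a (\<lambda>u. \<iota> u $ j)" "\<iota> x0 \<noteq> 0"
    "\<forall>u\<in>\<Union>C. \<iota> u \<noteq> 0 \<longrightarrow> inv\<^bsub>A\<^esub> (cls u) = cls (\<iota> u)" by (elim exE conjE)
  have \<iota>C: "\<iota> u \<in> \<Union>C" if u: "u \<in> \<Union>C" "\<iota> u \<noteq> 0" for u
  proof -
    have "cls u \<in> C" using u mem_Union_cls[OF C_proj] by blast
    then have "cls (\<iota> u) \<in> C" using \<iota>(3)[rule_format, OF u] inv_C by metis
    then show ?thesis using mem_Union_cls[OF C_proj] by blast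
  qed
  from mult_chart[OF \<iota>C[OF x0(2) \<iota>(2)] x0(2)] obtain d e f where f: "\<forall>j. bihom_poly d e (\<lambda>v w. f v w $ j)" "f (\<iota> x0) x0 \<noteq> 0"
    "\<forall>v'\<in>\<Union>C. \<forall>w'\<in>\<Union>C. f v' w' \<noteq> (0 :: complex ^ 'i) \<longrightarrow> cls v' \<otimes>\<^bsub>A\<^esub> cls w' = cls (f v' w')"
    by (elim exE conjE)
  obtain l where l: "\<forall>z\<in>tancone C origin. \<forall>j. \<phi> (der C origin z) $ j = (\<Sum>i\<in>UNIV. l j i * z $ i)" using phi_component by (elim exE)
  have o0: "origin \<noteq> 0" using origin(1) C_proj proj_point(2) by blast
  have "x0 \<noteq> 0" using x0(2) C_proj proj_point(2) by blast
  then obtain i0 where i0: "x0 $ i0 \<noteq> 0" by (auto simp: vec_eq_iff)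
  obtain i1 where i1: "origin $ i1 \<noteq> 0" using o0 by (auto simp: vec_eq_iff)
  obtain k0 where k0: "\<iota> x0 $ k0 \<noteq> 0" using \<iota>(2) by (auto simp: vec_eq_iff)
  have loc: "\<exists>k. k \<noteq> 0 \<and> f (\<iota> u) u = k *s origin" if u: "u \<in> \<Union>C" "\<iota> u \<noteq> 0" "f (\<iota> u) u \<noteq> 0" for u
  proof -
    have uC: "cls u \<in> C" using u mem_Union_cls[OF C_proj] by blast
    have "cls (f (\<iota> u) u) = inv\<^bsub>A\<^esub> (cls u) \<otimes>\<^bsub>A\<^esub> cls u"
      using f(3)[rule_format, OF \<iota>C[OF u(1,2)] u(1,3)] \<iota>(3)[rule_format, OF u(1,2)] by simp
    also have "\<dots> = cls origin" using inv_mult_cancel(3)[OF uC] origin(2) by simp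
    finally have "f (\<iota> u) u \<in> cls origin" using cls_mem[of "f (\<iota> u) u"] by simp
    then show ?thesis by (auto simp: proj_class_def)
  qed
  have comp0: "f (\<iota> x0) x0 $ i1 \<noteq> 0" using loc[OF x0(2) \<iota>(2) f(2)] i1 by auto
  have \<iota>s: "\<iota> (c *s u) = c ^ a *s \<iota> u" for c u by (rule hom_vec_scale[OF spec[OF \<iota>(1)]])
  have \<iota>p: "(\<lambda>u. \<iota> u $ j) \<in> polyf" for j by (rule hom_poly_polyf[OF spec[OF \<iota>(1)]])
  \<comment> \<open>A polynomial substitute for \<open>\<kappa>\<close>: on the chart it is
    \<open>\<kappa>\<close> times the fixed nonzero number \<open>origin $ i1\<close>.\<close>
  define Den where "Den u = f (\<iota> u) u $ i1" for u
  \<comment> \<open>Numerator of the coefficient of the differential of the \<open>i\<close>-th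
    affine coordinate. The factor \<open>u $ i0\<close> compensates the denominator of that
    differential, and \<open>origin $ i1\<close> the same factor in \<open>Den\<close>.\<close>
  define Num where "Num j i u = origin $ i1 * (\<Sum>k\<in>UNIV. l j k * dder (\<lambda>w. f (\<iota> u) w $ k) u (u $ i0 *s axis i 1))" for j i u
  have Den: "hom_poly (a * d + e) Den"
  proof (rule hom_polyI)
    show "Den \<in> polyf" unfolding Den_def
      using polyp_comp[OF bihom_poly_polyp[OF spec[OF f(1), of i1]], where f = \<iota> and g = "\<lambda>u. u", OF \<iota>p polyf_coord] by simp
    show "Den (c *s u) = c ^ (a * d + e) * Den u" for c u
      unfolding Den_def \<iota>s using bihom_poly_scale[OF spec[OF f(1), of i1]] by (simp add: power_add power_mult)
  qed
  have Num: "hom_poly (a * d + e) (Num j i)" for j i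
  proof (rule hom_polyI)
    show "Num j i \<in> polyf" unfolding Num_def
      by (intro alg.mult alg.const alg_sum bihom_poly_dder_alg[OF spec[OF f(1)]] \<iota>p polyf_coord UNIV_I)
         (simp add: axis_def alg.const alg.mult polyf_coord)
    show "Num j i (c *s u) = c ^ (a * d + e) * Num j i u" for c u
    proof -
      have "dder (\<lambda>w. f (\<iota> (c *s u)) w $ k) (c *s u) ((c *s u) $ i0 *s axis i 1)
          = c ^ (a * d + e) * dder (\<lambda>w. f (\<iota> u) w $ k) u (u $ i0 *s axis i 1)" for k
      proof -
        have "(c *s u) $ i0 *s axis i 1 = c *s (u $ i0 *s axis i 1)" by (simp add: vec_eq_iff)
        then show ?thesis
          unfolding \<iota>s bihom_poly_dder(2)[OF spec[OF f(1)]]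
          by (simp only: dder_scale[OF bihom_poly_dder(4)[OF spec[OF f(1)]]]) (simp add: power_add power_mult mult_ac)
      qed
      then show ?thesis unfolding Num_def by (simp add: sum_distrib_left mult_ac)
    qed
  qed
  \<comment> \<open>\<open>Num\<close> and \<open>Den\<close> have equal degree, so every
    representative gives the same value.\<close>
  define F where "F j i y = (let u = (SOME u. u \<in> y) in Num j i u / Den u)" for j i and y :: "'i point"
  have Fy: "F j i y = Num j i u / Den u" if "y \<in> C" "u \<in> y" for j i y u
  proof -
    define u' where "u' = (SOME u. u \<in> y)"
    have "u' \<in> y" unfolding u'_def using that(2) by (rule someI)
    then have "u' \<in> cls u" using proj_point(1)[of y u] that C_proj by blast
    then obtain c where c: "c \<noteq> 0" "u' = c *s u" by (auto simp: proj_class_def)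
    then show ?thesis unfolding F_def Let_def u'_def[symmetric] c(2) hom_poly_scale[OF Den] hom_poly_scale[OF Num] by simp
  qed
  define S where "S u = Den u * (\<iota> u $ k0 * u $ i0)" for u
  have S: "hom_poly (a * d + e + (a + 1)) S" unfolding S_def
    by (intro hom_poly_mult Den spec[OF \<iota>(1)] hom_poly_coord)
  define U where "U = C \<inter> basic_open S"
  have xU: "x \<in> U" using basic_open_iff[OF S _ x0(1)] x C_proj comp0 k0 i0 by (auto simp: U_def S_def Den_def)
  have form: "\<phi> (to_origin y D) $ j = (\<Sum>i\<in>UNIV. F j i y * D (coord_ratio i0 i))"
    and regs: "regular_at C y (F j i) \<and> regular_at C y (coord_ratio i0 i)"
    if y: "y \<in> U" and D: "D \<in> tangent_space C y" for y D j i
  proof -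
    have yC: "y \<in> C" using y by (simp add: U_def)
    obtain u where u: "u \<in> y" "u \<in> \<Union>C" "y = cls u" using point_rep[OF yC] by blast
    have nz: "Den u \<noteq> 0" "\<iota> u \<noteq> 0" "u $ i0 \<noteq> 0" "f (\<iota> u) u \<noteq> 0"
      using y u(1) by (auto simp: U_def basic_open_def S_def Den_def)
    have rF: "fraction_rep C u (F j i) (a * d + e) (Num j i) Den" for j i
      unfolding fraction_rep_def using Num Den nz(1) Fy by blast
    have rc: "fraction_rep C u (coord_ratio i0 i) 1 (\<lambda>u. u $ i) (\<lambda>u. u $ i0)" for i
      by (rule fraction_rep_coord_ratio[OF C_proj nz(3)])
    show "regular_at C y (F j i) \<and> regular_at C y (coord_ratio i0 i)"
      unfolding regular_at_iff[OF C_proj yC u(1)] by (intro conjI exI) (rule rF, rule rc)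
    from tangent_space_der[OF C_proj u(2) D[unfolded u(3)]] obtain w where w: "w \<in> tancone C u" "D = der C u w" by (elim bexE)
    obtain \<kappa> where \<kappa>: "\<kappa> \<noteq> 0" "f (\<iota> u) u = \<kappa> *s origin" using loc[OF u(2) nz(2,4)] by blast
    note T = translation_der[OF \<iota>C[OF u(2) nz(2)] u(2) w(1) f(1) nz(4) f(3)]
    define z where "z = dvec (f (\<iota> u)) u w"
    have z: "z \<in> tancone C (\<kappa> *s origin)" using T(2) unfolding \<kappa>(2) z_def .
    have "to_origin y D = der C (\<kappa> *s origin) z"
      unfolding to_origin_def u(3) w(2) \<iota>(3)[rule_format, OF u(2) nz(2)] T(5) z_def \<kappa>(2) ..
    also have "\<dots> = der C origin (inverse \<kappa> *s z)"
      using der_rescale[OF C_proj mem_Union_scale[OF C_proj origin(1) \<kappa>(1)] z, of "inverse \<kappa>"] \<kappa>(1) by simp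
    finally have to: "to_origin y D = der C origin (inverse \<kappa> *s z)" .
    have "inverse \<kappa> *s z \<in> tancone C origin" using tancone_rescale[OF z, of "inverse \<kappa>"] \<kappa>(1) by simp
    then have val: "\<phi> (to_origin y D) $ j = (\<Sum>i\<in>UNIV. l j i * (inverse \<kappa> *s z) $ i)" unfolding to using l by blast
    \<comment> \<open>The linear form kills \<open>origin\<close>, because the radial direction is
      the zero tangent vector.\<close>
    have lo: "(\<Sum>k\<in>UNIV. l j k * origin $ k) = 0"
      using l[rule_format, OF tancone_self[OF origin(1)], of j] der_self[OF C_proj origin(1)] phi_zero by simp
    define \<theta> where "\<theta> w = (\<Sum>k\<in>UNIV. l j k * dder (\<lambda>w. f (\<iota> u) w $ k) u w)" for w
    have pf: "(\<lambda>w. f (\<iota> u) w $ k) \<in> polyf" for k by (rule bihom_poly_dder(3)[OF spec[OF f(1)]])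
    have \<theta>sum: "\<theta> (\<Sum>i\<in>I. c i *s b i) = (\<Sum>i\<in>I. c i * \<theta> (b i))" if "finite I" for I :: "'i set" and c b
    proof -
      have "\<theta> (\<Sum>i\<in>I. c i *s b i) = (\<Sum>k\<in>UNIV. \<Sum>i\<in>I. c i * (l j k * dder (\<lambda>w. f (\<iota> u) w $ k) u (b i)))"
        unfolding \<theta>_def dder_linear_sum[OF pf that] sum_distrib_left by (simp add: mult_ac)
      also have "\<dots> = (\<Sum>i\<in>I. c i * \<theta> (b i))" unfolding \<theta>_def sum_distrib_left by (rule sum.swap)
      finally show ?thesis .
    qed
    have \<theta>b: "\<theta> w = (\<Sum>i\<in>UNIV. w $ i * \<theta> (axis i 1))" for w
      using \<theta>sum[of UNIV "\<lambda>i. w $ i" "\<lambda>i. axis i 1"] by (simp add: basis_expansion)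
    have "\<theta> u = of_nat e * (\<kappa> * (\<Sum>k\<in>UNIV. l j k * origin $ k))"
      unfolding \<theta>_def dder_euler[OF bihom_poly_dder(4)[OF spec[OF f(1)]]] \<kappa>(2) by (simp add: sum_distrib_left mult_ac)
    then have \<theta>u: "\<theta> u = 0" using lo by simp
    have \<kappa>d: "Den u = \<kappa> * origin $ i1" by (simp add: Den_def \<kappa>(2))
    have v1: "\<phi> (to_origin y D) $ j = \<theta> w / \<kappa>"
      unfolding val \<theta>_def z_def dvec_def by (simp add: sum_distrib_left divide_inverse mult_ac)
    have Nu: "Num j i u = origin $ i1 * (u $ i0 * \<theta> (axis i 1))" for i
      unfolding Num_def \<theta>_def dder_linear(2)[OF pf] by (simp add: sum_distrib_left mult_ac)
    have FF: "F j i y = u $ i0 * \<theta> (axis i 1) / \<kappa>" for i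
      unfolding Fy[OF yC u(1)] Nu \<kappa>d using i1 by simp
    have Dc: "D (coord_ratio i0 i) = (w $ i * u $ i0 - u $ i * w $ i0) / (u $ i0)\<^sup>2" for i
      unfolding w(2) der_eq[OF C_proj u(2) w(1) rc] by (simp add: qder_def dder_coord)
    \<comment> \<open>The quotient rule contributes \<open>\<theta> w\<close> and a multiple of
      \<open>\<theta> u\<close>, which is 0.\<close>
    have "(\<Sum>i\<in>UNIV. F j i y * D (coord_ratio i0 i))
        = (\<Sum>i\<in>UNIV. (w $ i * \<theta> (axis i 1) - (w $ i0 / u $ i0) * (u $ i * \<theta> (axis i 1))) / \<kappa>)"
      unfolding FF Dc using nz(3) \<kappa>(1) by (intro sum.cong refl) (simp add: field_simps power2_eq_square)
    also have "\<dots> = (\<theta> w - (w $ i0 / u $ i0) * \<theta> u) / \<kappa>"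
      unfolding \<theta>b[of w] \<theta>b[of u] by (simp only: sum_divide_distrib[symmetric] sum_subtractf sum_distrib_left)
    finally show "\<phi> (to_origin y D) $ j = (\<Sum>i\<in>UNIV. F j i y * D (coord_ratio i0 i))"
      unfolding v1 \<theta>u by simp
  qed
  have "is_local_form C U 1 (\<lambda>y D. \<phi> (to_origin y D) $ j)" for j
  proof -
    have "is_local_form C U 1 (\<lambda>y D. \<Sum>i\<in>UNIV. F j i y * D (coord_ratio i0 i))"
      by (intro is_local_form_sum is_local_form_one) (rule regs[OF _ tangent_space_zero])
    then show ?thesis unfolding is_local_form_def using form by simp
  qed
  moreover have "openin (zariski_of C) U" unfolding U_def by (rule openin_basic_open_of[OF S])
  moreover have "U \<subseteq> C" by (simp add: U_def)
  ultimately show ?thesis using xU by blast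
qed

definition invariant_differential :: "(complex ^ 'n \<Rightarrow> complex) \<Rightarrow> 'i point \<Rightarrow> 'i tangent \<Rightarrow> complex" where
  "invariant_differential P x D = (if x \<in> C \<and> D \<in> tangent_space C x then P (\<phi> (to_origin x D)) else 0)"

lemma invariant_differential:
  assumes P: "hom_poly m P"
  shows "invariant_differential P \<in> symmetric_differentials C m"
proof (rule symmetric_differentialI[OF C_proj])
  fix x assume "x \<in> C"
  from to_origin_local_form[OF this] obtain U where U: "openin (zariski_of C) U" "x \<in> U" "U \<subseteq> C"
    "\<forall>j. is_local_form C U 1 (\<lambda>y D. \<phi> (to_origin y D) $ j)" by (elim exE conjE)
  have "is_local_form C U m (\<lambda>y D. P (\<phi> (to_origin y D)))"
    by (rule is_local_form_hom_poly[OF C_proj U(3) spec[OF U(4)] P])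
  then have "is_local_form C U m (invariant_differential P)"
    unfolding is_local_form_def invariant_differential_def using U(3) by (simp add: subset_iff)
  then show "\<exists>U. openin (zariski_of C) U \<and> x \<in> U \<and> is_local_form C U m (invariant_differential P)"
    using U by (intro exI[of _ U] conjI)
qed (auto simp: invariant_differential_def)

end

section \<open>Restriction of symmetric differentials\<close>

lemma regular_at_subset:
  assumes "X \<subseteq> Y" "x \<in> X" "regular_at Y x h"
  shows "regular_at X x h"
proof -
  from assms(3) obtain U d P Q where U: "openin (zariski_of Y) U" "x \<in> U" "hom_poly d P" "hom_poly d Q"
    "\<forall>y\<in>U. \<forall>v\<in>y. Q v \<noteq> 0 \<and> h y = P v / Q v" unfolding regular_at_def by (elim exE conjE)
  have "openin (zariski_of X) (U \<inter> X)" using U(1) assms(1) by (auto simp: openin_subtopology)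
  then show ?thesis unfolding regular_at_def using U(2-5) assms(2)
    by - (rule exI[of _ "U \<inter> X"], rule exI[of _ d], rule exI[of _ P], rule exI[of _ Q], auto)
qed

text \<open>The functions of a local expression on \<open>Y\<close> serve on \<open>X\<close>
  unchanged, since the differential of the inclusion evaluates a regular function by restricting
  it.\<close>

lemma restrict_differential_symmetric:
  assumes XY: "X \<subseteq> Y" and \<eta>: "\<eta> \<in> symmetric_differentials Y m"
    and inc: "\<And>x D. x \<in> X \<Longrightarrow> D \<in> tangent_space X x \<Longrightarrow> differential Y (\<lambda>y. y) x D \<in> tangent_space Y x"
  shows "restrict_differential Y X \<eta> \<in> symmetric_differentials X m"
  unfolding symmetric_differentials_def
proof (intro CollectI conjI allI impI ballI)
  fix x assume x: "x \<in> X"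
  obtain U f g and r :: nat where U: "openin (zariski_of Y) U" "x \<in> U"
    "\<forall>y\<in>U. \<forall>i<r. regular_at Y y (f i) \<and> (\<forall>j<m. regular_at Y y (g i j))"
    "\<forall>y\<in>U. \<forall>D\<in>tangent_space Y y. \<eta> y D = (\<Sum>i<r. f i y * (\<Prod>j<m. D (g i j)))"
    by (rule symmetric_differentialE[OF \<eta> subsetD[OF XY x]])
  have "openin (zariski_of X) (U \<inter> X)" using U(1) XY by (auto simp: openin_subtopology)
  moreover have "\<forall>y\<in>U \<inter> X. \<forall>i<r. regular_at X y (f i) \<and> (\<forall>j<m. regular_at X y (g i j))"
    using U(3) regular_at_subset[OF XY] by simp
  moreover have "restrict_differential Y X \<eta> y D = (\<Sum>i<r. f i y * (\<Prod>j<m. D (g i j)))"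
    if y: "y \<in> U \<inter> X" and D: "D \<in> tangent_space X y" for y D
  proof -
    have "restrict_differential Y X \<eta> y D = \<eta> y (differential Y (\<lambda>y. y) y D)"
      using y D by (simp add: restrict_differential_def)
    also have "\<dots> = (\<Sum>i<r. f i y * (\<Prod>j<m. differential Y (\<lambda>y. y) y D (g i j)))"
      using U(4) inc[OF _ D] y by simp
    also have "\<dots> = (\<Sum>i<r. f i y * (\<Prod>j<m. D (g i j)))"
      using U(3) y by (intro sum.cong prod.cong arg_cong2[where f = times] refl) (simp add: differential_def o_def)
    finally show ?thesis .
  qed
  ultimately show "\<exists>U (r::nat) f g. openin (zariski_of X) U \<and> x \<in> U \<and>
        (\<forall>y\<in>U. \<forall>i<r. regular_at X y (f i) \<and> (\<forall>j<m. regular_at X y (g i j))) \<and>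
        (\<forall>y\<in>U. \<forall>D\<in>tangent_space X y. restrict_differential Y X \<eta> y D = (\<Sum>i<r. f i y * (\<Prod>j<m. D (g i j))))"
    using U(2) x by (intro exI[of _ "U \<inter> X"] exI[of _ r] exI[of _ f] exI[of _ g]) simp
qed (auto simp: restrict_differential_def)

text \<open>An empty product does not see the tangent vector, so the differential is a regular
  function on \<open>X\<close>, which is closed and, being irreducible, connected.\<close>

lemma degree_zero_differential_constant:
  assumes X: "projective_variety X" and \<omega>: "\<omega> \<in> symmetric_differentials X 0"
  shows "\<exists>c. \<forall>x\<in>X. \<forall>D\<in>tangent_space X x. \<omega> x D = c"
proof -
  note ic = irreducible_connected[OF X]
  have XP: "X \<subseteq> proj_space" using ic(1) closedin_subset topspace_zariski by blast
  have loc: "regular_at X x (\<lambda>y. \<omega> y 0) \<and> (\<forall>D\<in>tangent_space X x. \<omega> x D = \<omega> x 0)" if x: "x \<in> X" for x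
  proof -
    obtain U f and g :: "nat \<Rightarrow> nat \<Rightarrow> 'a point \<Rightarrow> complex" and r :: nat where U: "openin (zariski_of X) U" "x \<in> U"
      "\<forall>y\<in>U. \<forall>i<r. regular_at X y (f i) \<and> (\<forall>j<0. regular_at X y (g i j))"
      "\<forall>y\<in>U. \<forall>D\<in>tangent_space X y. \<omega> y D = (\<Sum>i<r. f i y * (\<Prod>j<(0::nat). D (g i j)))"
      by (rule symmetric_differentialE[OF \<omega> x])
    obtain v where v: "v \<in> x" using x XP proj_space_nonempty by blast
    have "\<exists>d P Q. fraction_rep X v (\<lambda>y. \<Sum>i<n. f i y) d P Q" if "n \<le> r" for n
      using that
    proof (induction n)
      case 0
      show ?case using fraction_rep_const[of X v 0] by (simp, intro exI)
    next
      case (Suc n)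
      then obtain d P Q where s: "fraction_rep X v (\<lambda>y. \<Sum>i<n. f i y) d P Q" by auto
      have "regular_at X x (f n)" using U(2,3) Suc.prems by simp
      then obtain e P' Q' where t: "fraction_rep X v (f n) e P' Q'" unfolding regular_at_iff[OF XP x v] by (elim exE)
      show ?case using fraction_rep_add[OF s t] by (simp, intro exI)
    qed
    then have "regular_at X x (\<lambda>y. \<Sum>i<r. f i y)" unfolding regular_at_iff[OF XP x v] by simp
    then obtain V d P Q where V: "openin (zariski_of X) V" "x \<in> V" "hom_poly d P" "hom_poly d Q"
      "\<forall>y\<in>V. \<forall>v\<in>y. Q v \<noteq> 0 \<and> (\<Sum>i<r. f i y) = P v / Q v" unfolding regular_at_def by (elim exE conjE)
    have e: "\<omega> y 0 = (\<Sum>i<r. f i y)" if "y \<in> U" for y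
      using bspec[OF bspec[OF U(4) that] tangent_space_zero] by simp
    have "Q w \<noteq> 0 \<and> \<omega> y 0 = P w / Q w" if "y \<in> U \<inter> V" "w \<in> y" for y w
      using V(5) e[of y] that by (metis IntD1 IntD2)
    then have "regular_at X x (\<lambda>y. \<omega> y 0)" unfolding regular_at_def
      using U(2) V(2-4) openin_Int[OF U(1) V(1)]
      by - (rule exI[of _ "U \<inter> V"], rule exI[of _ d], rule exI[of _ P], rule exI[of _ Q], blast)
    then show ?thesis using U(2,4) e by auto
  qed
  obtain x where x: "x \<in> X" using ic(3) by blast
  have "\<omega> y D = \<omega> x 0" if "y \<in> X" "D \<in> tangent_space X y" for y D
    using loc[OF that(1)] that(2) regular_constant[OF ic(1) conjunct1[OF loc] ic(2) that(1) x] by simp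
  then show ?thesis by blast
qed

section \<open>The tangent map and its fibres\<close>

context abelian_coordinates
begin

lemma inclusion_tangent:
  assumes XC: "X \<subseteq> C" and x: "x \<in> X" and D: "D \<in> tangent_space X x"
  shows "differential C (\<lambda>y. y) x D \<in> tangent_space C x"
proof -
  have XP: "X \<subseteq> proj_space" using XC C_proj by blast
  obtain p where p: "p \<in> x" using XP x proj_space_nonempty by blast
  then have xc: "x = cls p" and pX: "p \<in> \<Union>X" and pC: "p \<in> \<Union>C" using proj_point(1) XP x XC by blast+
  from tangent_space_der[OF XP pX D[unfolded xc]] obtain w where w: "w \<in> tancone X p" "D = der X p w" by (elim bexE)
  have wC: "w \<in> tancone C p" using tancone_mono[OF XC] w(1) by blast
  show ?thesis unfolding xc w(2) differential_inclusion[OF XC C_proj pX w(1)]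
    by (rule der_in_tangent_space[OF C_proj pC wC])
qed

definition tangent_coords :: "'i point \<Rightarrow> 'i tangent \<Rightarrow> complex ^ 'n" where
  "tangent_coords x D = \<phi> (to_origin x (differential C (\<lambda>y. y) x D))"

lemma tangent_coords_iff:
  assumes XC: "X \<subseteq> C" and x: "x \<in> X" and D: "D \<in> tangent_space X x"
  shows "differential C (\<lambda>y. y) x D = invariant_field v x \<longleftrightarrow> tangent_coords x D = v"
  unfolding tangent_coords_def using x XC by (intro invariant_field_iff inclusion_tangent[OF XC x D]) blast

lemma tangent_coords_scale:
  assumes XC: "X \<subseteq> C" and x: "x \<in> X" and D: "D \<in> tangent_space X x"
  shows "tangent_coords x (tangent_scale c D) = c *s tangent_coords x D"
proof -
  have "to_origin x (differential C (\<lambda>y. y) x D) \<in> T0"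
    by (rule to_origin_tangent[OF _ inclusion_tangent[OF XC x D]]) (use x XC in blast)
  from phi_scale[OF this] show ?thesis
    unfolding tangent_coords_def differential_scale to_origin_def .
qed

lemma tangent_coords_zero: "tangent_coords x 0 = 0"
  unfolding tangent_coords_def differential_zero to_origin_def by (rule phi_zero)

lemma tangent_map_class:
  assumes XC: "X \<subseteq> C" and x: "x \<in> X" and D: "D \<in> tangent_space X x"
  shows "tangent_map A \<phi> (x, proj_class tangent_scale D) = cls (tangent_coords x D)"
proof -
  have "tangent_map A \<phi> (x, proj_class tangent_scale D) = tangent_coords x ` proj_class tangent_scale D"
    by (simp add: tangent_map_def cotangent_trivialization_def cotangent_inclusion_def tangent_coords_def[abs_def]
        to_origin_def[abs_def] image_image)
  also have "\<dots> = cls (tangent_coords x D)"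
  proof -
    have "tangent_coords x ` proj_class tangent_scale D = {tangent_coords x (tangent_scale c D) | c. c \<noteq> 0}"
      unfolding proj_class_def by auto
    then show ?thesis unfolding tangent_coords_scale[OF XC x D] proj_class_def .
  qed
  finally show ?thesis .
qed

text \<open>A vector with coordinates proportional to \<open>v\<close> can be rescaled to have
  coordinates \<open>v\<close>. Through this equality, surjectivity of the tangent map and
  connectedness of its fibres become nonemptiness and connectedness of the loci of tangency.\<close>

lemma fibre_tangency:
  assumes XC: "X \<subseteq> C" and v: "v \<noteq> 0"
  shows "fst ` {z \<in> proj_cotangent X. tangent_map A \<phi> z = cls v} = tangency X v"
proof
  show "fst ` {z \<in> proj_cotangent X. tangent_map A \<phi> z = cls v} \<subseteq> tangency X v"
  proof
    fix x assume "x \<in> fst ` {z \<in> proj_cotangent X. tangent_map A \<phi> z = cls v}"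
    then obtain L where L: "(x, L) \<in> proj_cotangent X" "tangent_map A \<phi> (x, L) = cls v" by auto
    then have x: "x \<in> X" and "L \<in> projectivization tangent_scale (tangent_space X x)"
      unfolding proj_cotangent_def by auto
    then obtain D where D: "D \<in> tangent_space X x" "L = proj_class tangent_scale D" unfolding projectivization_def by auto
    have "cls (tangent_coords x D) = cls v" using L(2) tangent_map_class[OF XC x D(1)] D(2) by simp
    then have "v \<in> cls (tangent_coords x D)" using cls_mem[of v] by simp
    then obtain c where c: "v = c *s tangent_coords x D" by (auto simp: proj_class_def)
    have cD: "tangent_scale c D \<in> tangent_space X x" by (rule tangent_space_scale[OF D(1)])
    have "tangent_coords x (tangent_scale c D) = v" using tangent_coords_scale[OF XC x D(1)] c by simp
    then have "differential C (\<lambda>y. y) x (tangent_scale c D) = invariant_field v x"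
      using tangent_coords_iff[OF XC x cD] by blast
    then show "x \<in> tangency X v" by (rule tangency_field(1)[OF XC x cD])
  qed
  show "tangency X v \<subseteq> fst ` {z \<in> proj_cotangent X. tangent_map A \<phi> z = cls v}"
  proof
    fix x assume "x \<in> tangency X v"
    then have x: "x \<in> X" and "\<exists>D\<in>tangent_space X x. differential C (\<lambda>y. y) x D = invariant_field v x"
      by (auto simp: tangency_def)
    then obtain D where D: "D \<in> tangent_space X x" "differential C (\<lambda>y. y) x D = invariant_field v x" by (elim bexE)
    have tc: "tangent_coords x D = v" using tangent_coords_iff[OF XC x D(1)] D(2) by blast
    then have "D \<noteq> 0" using tangent_coords_zero v by auto
    then have "(x, proj_class tangent_scale D) \<in> proj_cotangent X"
      using x D(1) unfolding proj_cotangent_def projectivization_def by blast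
    moreover have "tangent_map A \<phi> (x, proj_class tangent_scale D) = cls v"
      using tangent_map_class[OF XC x D(1)] tc by simp
    ultimately have "(x, proj_class tangent_scale D) \<in> {z \<in> proj_cotangent X. tangent_map A \<phi> z = cls v}" by simp
    then show "x \<in> fst ` {z \<in> proj_cotangent X. tangent_map A \<phi> z = cls v}" by (rule image_eqI[rotated]) simp
  qed
qed

end

lemma zariski_prod_fst: "continuous_map (zariski_prod :: ('i::finite point \<times> 'j::finite point) topology) zariski fst"
proof -
  define \<B> :: "('i point \<times> 'j point) set set" where
    "\<B> = {{(p, q) \<in> proj_space \<times> proj_space. \<forall>v\<in>p. \<forall>w\<in>q. P v w \<noteq> 0} | d e P. bihom_poly d e P}"
  have zp: "zariski_prod = topology_generated_by \<B>" unfolding zariski_prod_def \<B>_def ..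
  have top: "topspace (zariski_prod :: ('i point \<times> 'j point) topology) \<subseteq> proj_space \<times> proj_space"
    unfolding zp topology_generated_by_topspace by (auto simp: \<B>_def)
  have z: "zariski = topology_generated_by {basic_open P | d (P :: complex ^ 'i \<Rightarrow> complex). hom_poly d P}"
    unfolding zariski_def basic_open_def ..
  have img: "fst ` topspace (zariski_prod :: ('i point \<times> 'j point) topology) \<subseteq> \<Union>{basic_open P | d (P :: complex ^ 'i \<Rightarrow> complex). hom_poly d P}"
    using top topspace_zariski[where 'i = 'i, unfolded z topology_generated_by_topspace] by auto
  have "openin zariski_prod (fst -` U \<inter> topspace (zariski_prod :: ('i point \<times> 'j point) topology))"
    if U: "U \<in> {basic_open P | d (P :: complex ^ 'i \<Rightarrow> complex). hom_poly d P}" for U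
  proof -
    obtain d and P :: "complex ^ 'i \<Rightarrow> complex" where P: "U = basic_open P" "hom_poly d P" using U by blast
    define W :: "('i point \<times> 'j point) set" where "W = {(p, q) \<in> proj_space \<times> proj_space. \<forall>v\<in>p. \<forall>w\<in>q. P v \<noteq> 0}"
    \<comment> \<open>A polynomial in the first variables alone is bihomogeneous of degree 0 in the
      second.\<close>
    have "W \<in> \<B>" unfolding \<B>_def W_def
      by (intro CollectI exI[of _ d] exI[of _ 0] exI[of _ "\<lambda>v w. P v"] conjI refl bihom_poly_of_hom[OF P(2)])
    then have W: "openin zariski_prod W" unfolding zp by (rule topology_generated_by_Basis)
    have "fst -` U \<inter> topspace zariski_prod = W"
    proof
      show "fst -` U \<inter> topspace zariski_prod \<subseteq> W" using top unfolding W_def P(1) basic_open_def by fastforce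
      show "W \<subseteq> fst -` U \<inter> topspace zariski_prod"
      proof
        fix z assume zW: "z \<in> W"
        then have "z \<in> topspace zariski_prod" using openin_subset[OF W] by blast
        moreover obtain p q where pq: "z = (p, q)" "p \<in> proj_space" "q \<in> proj_space" "\<forall>v\<in>p. \<forall>w\<in>q. P v \<noteq> 0"
          using zW unfolding W_def by blast
        \<comment> \<open>The condition quantified over \<open>q\<close> has content only because
          \<open>q\<close> is nonempty.\<close>
        moreover have "\<exists>w. w \<in> q" by (rule proj_space_nonempty[OF pq(3)])
        ultimately show "z \<in> fst -` U \<inter> topspace zariski_prod" unfolding P(1) basic_open_def by auto
      qed
    qed
    then show ?thesis using W by simp
  qed
  then show ?thesis unfolding z continuous_on_generated_topo_iff using img by blast
qed

section \<open>Polynomiality and the bijectivity of restriction\<close>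

context abelian_coordinates
begin

lemma tangency_connected:
  assumes XC: "X \<subseteq> C" and v: "v \<noteq> 0"
    and conn: "connectedin (proj_cotangent_topology A \<phi> X) {z \<in> proj_cotangent X. tangent_map A \<phi> z = cls v}"
  shows "connectedin zariski (tangency X v)"
proof -
  let ?g = "cotangent_trivialization A \<phi> \<circ> cotangent_inclusion A"
  have "continuous_map (pullback_topology (proj_cotangent X) ?g zariski_prod) zariski (fst \<circ> ?g)"
    by (rule continuous_map_pullback[OF zariski_prod_fst])
  moreover have "fst \<circ> ?g = fst"
    by (auto simp: fun_eq_iff cotangent_trivialization_def cotangent_inclusion_def)
  ultimately have "continuous_map (proj_cotangent_topology A \<phi> X) zariski fst"
    by (simp add: proj_cotangent_topology_def)
  from connectedin_continuous_map_image[OF this conn] show ?thesis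
    unfolding fibre_tangency[OF XC v] .
qed

text \<open>Degree 0 is separate, as a differential may then be nonzero at the zero vector. In
  positive degree \<open>G\<close> is polynomial of degree at most \<open>m\<close> on every line
  parallel to an axis, hence polynomial.\<close>

lemma differential_polynomial:
  assumes XC: "X \<subseteq> C" and X: "projective_variety X" and \<omega>: "\<omega> \<in> symmetric_differentials X m"
    and conn: "\<And>v. v \<noteq> 0 \<Longrightarrow> connectedin zariski (tangency X v)" and ne: "\<And>v. v \<noteq> 0 \<Longrightarrow> tangency X v \<noteq> {}"
  shows "\<exists>P. hom_poly m P \<and> (\<forall>x\<in>X. \<forall>D\<in>tangent_space X x. \<omega> x D = P (tangent_coords x D))"
proof (cases "m = 0")
  case True
  from degree_zero_differential_constant[OF X \<omega>[unfolded True]]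
  obtain c where "\<forall>x\<in>X. \<forall>D\<in>tangent_space X x. \<omega> x D = c" by (elim exE)
  then show ?thesis using True by (intro exI[of _ "\<lambda>_. c"]) (simp add: hom_poly_const)
next
  case False
  have Xc: "closedin zariski X" by (rule irreducible_connected(1)[OF X])
  \<comment> \<open>Homogeneity of positive degree dictates the value at 0, where the loci are not
    assumed connected.\<close>
  define G where "G v = (if v = 0 then 0 else value_at X \<omega> v)" for v
  have Gs: "G (c *s v) = c ^ m * G v" for c v
  proof (cases "c = 0 \<or> v = 0")
    case True
    then show ?thesis using False by (auto simp: G_def)
  next
    case nz: False
    then have "c *s v \<noteq> 0" by (simp add: vec_eq_iff)
    moreover have "value_at X \<omega> (c *s v) = c ^ m * value_at X \<omega> v"
      by (rule value_at_scale[OF XC Xc \<omega> conn ne]) (use nz in auto)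
    ultimately show ?thesis using nz by (simp add: G_def)
  qed
  have "G \<in> polyf"
  proof (rule separately_polynomial)
    fix v :: "complex ^ 'n" and j
    define a where "a = (\<chi> i. if i = j then 0 else v $ i)"
    define b :: "complex ^ 'n" where "b = axis j 1"
    have ab: "(\<chi> i. if i = j then t else v $ i) = a + t *s b" for t
      by (simp add: vec_eq_iff a_def b_def axis_def)
    have b: "b \<noteq> 0" unfolding b_def by (simp add: axis_eq_0_iff)
    \<comment> \<open>A line through 0 is outside the scope of \<open>value_at_line\<close>, but
      there homogeneity alone gives a monomial.\<close>
    show "\<exists>p. degree p \<le> m \<and> (\<forall>t. G (\<chi> i. if i = j then t else v $ i) = poly p t)"
    proof (cases "a = 0")
      case True
      have "G (a + t *s b) = poly (monom (G b) m) t" for t using Gs[of t b] True by (simp add: poly_monom mult.commute)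
      then show ?thesis unfolding ab by (intro exI[of _ "monom (G b) m"]) (simp add: degree_monom_le)
    next
      case False
      then obtain i where "a $ i \<noteq> 0" by (auto simp: vec_eq_iff)
      then have "(a + t *s b) $ i \<noteq> 0" for t by (auto simp: a_def b_def axis_def split: if_splits)
      then have nz: "a + t *s b \<noteq> 0" for t by (metis zero_index)
      from value_at_line[OF XC Xc \<omega> conn ne nz b] show ?thesis unfolding ab using nz by (simp add: G_def)
    qed
  qed
  then have "hom_poly m G" using Gs by (rule hom_polyI)
  moreover have "\<omega> x D = G (tangent_coords x D)" if x: "x \<in> X" and D: "D \<in> tangent_space X x" for x D
  proof -
    define v where "v = tangent_coords x D"
    have "differential C (\<lambda>y. y) x D = invariant_field v x" using tangent_coords_iff[OF XC x D] v_def by blast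
    note f = tangency_field[OF XC x D this]
    show ?thesis
    proof (cases "v = 0")
      case True
      \<comment> \<open>A vector with zero coordinates is zero, because the vector of
        \<open>X\<close> over the invariant one is unique.\<close>
      have "differential C (\<lambda>y. y) x 0 = invariant_field v x"
        using tangent_coords_iff[OF XC x tangent_space_zero, of v] tangent_coords_zero True by simp
      from tangency_field(2)[OF XC x tangent_space_zero this] have D0: "D = 0" using f(2) by simp
      have "tangent_scale 0 0 = (0 :: 'i tangent)" by (simp add: tangent_scale_def fun_eq_iff)
      then have "\<omega> x 0 = 0 ^ m * \<omega> x 0" using symmetric_differential_scale[OF \<omega> x tangent_space_zero, of 0] by simp
      also have "(0::complex) ^ m = 0" using \<open>m \<noteq> 0\<close> by (simp add: zero_power)
      finally have "\<omega> x 0 = 0" by (simp only: mult_zero_left)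
      then show ?thesis using True D0 v_def by (simp add: G_def)
    next
      case nz: False
      have "\<omega> x D = value_at X \<omega> v" using value_at[OF XC Xc \<omega> conn[OF nz] f(1)] f(2) by simp
      then show ?thesis using nz v_def by (simp add: G_def)
    qed
  qed
  ultimately show ?thesis by (intro exI[of _ G]) simp
qed

text \<open>Constancy applied to the abelian variety itself: an invariant field is tangent to it
  everywhere, so the locus is the whole variety, which is connected.\<close>

lemma invariant_value:
  assumes \<eta>: "\<eta> \<in> symmetric_differentials C m" and x: "x \<in> C" and y: "y \<in> C"
  shows "\<eta> x (invariant_field v x) = \<eta> y (invariant_field v y)"
proof -
  have var: "projective_variety C" using abelian by (simp add: abelian_variety_def)
  note ic = irreducible_connected[OF var]
  have idD: "differential C (\<lambda>y. y) x D = D" if "D \<in> tangent_space C x" for x D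
    using that by (auto simp: differential_def fun_eq_iff o_def tangent_space_def)
  have inv: "invariant_field v x \<in> tangent_space C x" if "x \<in> C" for x
    unfolding invariant_field_def by (rule from_origin_tangent[OF that der_origin_T0[OF lift(1)]])
  note f = tangency_field[OF order_refl _ inv idD[OF inv]]
  have T: "tangency C v = C" using f(1) by (auto simp: tangency_def)
  have v: "\<eta> x (field_on C v x) = value_at C \<eta> v" if "x \<in> C" for x
    by (rule value_at[OF order_refl ic(1) \<eta>]) (simp_all add: T ic(2) that)
  show ?thesis using v[OF x] v[OF y] f(2)[OF x x x] f(2)[OF y y y] by simp
qed

text \<open>Injectivity: every invariant field is tangent to \<open>X\<close> somewhere, and the
  value of a differential on the abelian variety along it does not depend on the point.
  Surjectivity: the polynomial attached to a differential on \<open>X\<close> defines an invariant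
  differential that restricts to it.\<close>

lemma restriction_bij:
  assumes XC: "X \<subseteq> C" and X: "projective_variety X"
    and conn: "\<And>v. v \<noteq> 0 \<Longrightarrow> connectedin zariski (tangency X v)" and ne: "\<And>v. v \<noteq> 0 \<Longrightarrow> tangency X v \<noteq> {}"
  shows "bij_betw (restrict_differential C X) (symmetric_differentials C m) (symmetric_differentials X m)"
  unfolding bij_betw_def
proof
  \<comment> \<open>Extends nonemptiness to \<open>v = 0\<close>, which the zero vector at any point
    of \<open>X\<close> realizes.\<close>
  have ne': "\<exists>x D. x \<in> X \<and> D \<in> tangent_space X x \<and> differential C (\<lambda>y. y) x D = invariant_field v x" for v
  proof (cases "v = 0")
    case True
    obtain x where x: "x \<in> X" using irreducible_connected(3)[OF X] by blast
    have "differential C (\<lambda>y. y) x 0 = invariant_field v x"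
      using tangent_coords_iff[OF XC x tangent_space_zero, of v] tangent_coords_zero True by simp
    then show ?thesis using x tangent_space_zero by blast
  next
    case False
    then obtain x where "x \<in> tangency X v" using ne by blast
    then show ?thesis unfolding tangency_def by auto
  qed
  show "inj_on (restrict_differential C X) (symmetric_differentials C m)"
  proof (rule inj_onI)
    fix \<eta> \<theta> assume \<eta>: "\<eta> \<in> symmetric_differentials C m" and \<theta>: "\<theta> \<in> symmetric_differentials C m"
      and eq: "restrict_differential C X \<eta> = restrict_differential C X \<theta>"
    show "\<eta> = \<theta>"
    proof (intro ext)
      fix x D
      show "\<eta> x D = \<theta> x D"
      proof (cases "x \<in> C \<and> D \<in> tangent_space C x")
        case True
        define v where "v = \<phi> (to_origin x D)"
        have D: "D = invariant_field v x" using invariant_field_iff True v_def by blast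
        from ne'[of v] obtain y E where y: "y \<in> X" "E \<in> tangent_space X y" "differential C (\<lambda>y. y) y E = invariant_field v y"
          by (elim exE conjE)
        have yC: "y \<in> C" using y(1) XC by blast
        have "restrict_differential C X \<eta> y E = restrict_differential C X \<theta> y E" using eq by simp
        then have "\<eta> y (invariant_field v y) = \<theta> y (invariant_field v y)"
          using y by (simp add: restrict_differential_def)
        then show ?thesis unfolding D
          using invariant_value[OF \<eta> conjunct1[OF True] yC, of v] invariant_value[OF \<theta> conjunct1[OF True] yC, of v] by simp
      next
        case False
        then show ?thesis using \<eta> \<theta> unfolding symmetric_differentials_def by auto
      qed
    qed
  qed
  show "restrict_differential C X ` symmetric_differentials C m = symmetric_differentials X m"
  proof
    show "restrict_differential C X ` symmetric_differentials C m \<subseteq> symmetric_differentials X m"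
      using restrict_differential_symmetric[OF XC _ inclusion_tangent[OF XC]] by blast
    show "symmetric_differentials X m \<subseteq> restrict_differential C X ` symmetric_differentials C m"
    proof
      fix \<omega> assume \<omega>: "\<omega> \<in> symmetric_differentials X m"
      have "\<exists>P. hom_poly m P \<and> (\<forall>x\<in>X. \<forall>D\<in>tangent_space X x. \<omega> x D = P (tangent_coords x D))"
        by (rule differential_polynomial[OF XC X \<omega> conn ne])
      then obtain P where P: "hom_poly m P" "\<forall>x\<in>X. \<forall>D\<in>tangent_space X x. \<omega> x D = P (tangent_coords x D)" by (elim exE conjE)
      have "restrict_differential C X (invariant_differential P) x D = \<omega> x D" for x D
      proof (cases "x \<in> X \<and> D \<in> tangent_space X x")
        case True
        then have "x \<in> C" "differential C (\<lambda>y. y) x D \<in> tangent_space C x"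
          using XC inclusion_tangent[OF XC] by auto
        then show ?thesis using True P(2) by (simp add: restrict_differential_def invariant_differential_def tangent_coords_def)
      next
        case False
        then show ?thesis using \<omega> unfolding symmetric_differentials_def restrict_differential_def by auto
      qed
      then have "\<omega> = restrict_differential C X (invariant_differential P)" by (simp add: fun_eq_iff)
      then show "\<omega> \<in> restrict_differential C X ` symmetric_differentials C m"
        using invariant_differential[OF P(1)] by (rule image_eqI)
    qed
  qed
qed

end

theorem theoremF:
  fixes A :: "'i::finite point monoid" and X :: "'i point set"
    and \<phi> :: "'i tangent \<Rightarrow> complex ^ 'n::finite"
  assumes "abelian_variety A"
    and "krull_dim (zariski_of (carrier A)) = enat CARD('n)"
    and "linear_coordinates (tangent_space (carrier A) \<one>\<^bsub>A\<^esub>) \<phi>"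
    and "smooth_variety X" and "X \<subseteq> carrier A"
    and "tangent_map A \<phi> ` proj_cotangent X = proj_space"
    and "\<forall>p\<in>proj_space. connectedin (proj_cotangent_topology A \<phi> X)
           {z \<in> proj_cotangent X. tangent_map A \<phi> z = p}"
  shows "\<forall>m. bij_betw (restrict_differential (carrier A) X)
           (symmetric_differentials (carrier A) m) (symmetric_differentials X m)"
proof
  fix m
  interpret abelian_coordinates A \<phi> by unfold_locales fact+
  have X: "projective_variety X" using assms(4) by (simp add: smooth_variety_def)
  have conn: "connectedin zariski (tangency X v)" if "v \<noteq> 0" for v
    by (rule tangency_connected[OF assms(5) that]) (use assms(7) cls_in_proj_space[OF that] in blast)
  have ne: "tangency X v \<noteq> {}" if "v \<noteq> 0" for v
  proof -
    have "cls v \<in> tangent_map A \<phi> ` proj_cotangent X" using assms(6) cls_in_proj_space[OF that] by simp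
    then have "{z \<in> proj_cotangent X. tangent_map A \<phi> z = cls v} \<noteq> {}" by blast
    then show ?thesis using fibre_tangency[OF assms(5) that] by blast
  qed
  show "bij_betw (restrict_differential (carrier A) X) (symmetric_differentials (carrier A) m) (symmetric_differentials X m)"
    by (rule restriction_bij[OF assms(5) X conn ne])
qed

end
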